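(* The Kauffman bracket skein module is an essential invariant of links in lens spaces: it may take different values on links with equivalent lifts. That is, there are inequivalent links $L_1,L_2$ in a lens space $L(p,q)$ whose lifts $\widetilde L_1,\widetilde L_2\subset S^3$ are equivalent links, but whose values $\mathrm{KBSM}(L_1)$ and $\mathrm{KBSM}(L_2)$ in the Kauffman bracket skein module $S_{2,\infty}(L(p,q))$ are different.
   Context: **Lens spaces and lifts.** $L(p,q)$ is the lens space obtained by $p/q$ rational surgery on the unknot $U$ in $S^3$, with $p,q$ coprime integers and $0\le q<p$. A link in $L(p,q)$ is an embedding of finitely many circles, and two links are equivalent if there is a smooth ambient isotopy between them. The lift $\widetilde L\subset S^3$ of a link $L\subset L(p,q)$ is its preimage under the cyclic covering $S^3\to L(p,q)$. **Kauffman bracket skein module.** Let $M$ be an (oriented) 3-manifold and $\mathcal L_{fr}$ the set of ambient isotopy classes of unoriented framed links in $M$, including the empty link. Let $R=\mathbb{Z}[A^{\pm1}]$, and let $R\mathcal L_{fr}$ be the free $R$-module on $\mathcal L_{fr}$. Let $\mathcal S_{fr}$ be the submodule generated by all $L-AL_0-A^{-1}L_\infty$ and all $L^{(1)}+A^3L$. Here $L_0$ and $L_\infty$ are the links obtained from $L$ by the two Kauffman resolutions of one crossing, and $L^{(1)}$ is $L$ with one full right-handed twist added to its framing. Then $S_{2,\infty}(M)=R\mathcal L_{fr}/\mathcal S_{fr}$. **Value on a link.** A punctured disk diagram of a link $L\subset L(p,q)$ is a regular projection of $L\cup U$ (with $U$ the surgery unknot, regarded as an axis through infinity) to the plane orthogonal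 to $U$, so that $U$ projects to a dot. $\mathrm{KBSM}(L)$ denotes the element of $S_{2,\infty}(L(p,q))$ computed from a punctured disk diagram of $L$ by resolving all its crossings with the skein relation. **Essential invariant.** An invariant of links in $L(p,q)$ is called essential if it can take different values on two links with equivalent lifts in $S^3$. *)

theory Defs
  imports "HOL-Analysis.Analysis" "HOL-Library.Poly_Mapping"
begin

section \<open>Smooth maps between Euclidean spaces\<close>

primrec Ck_on :: "nat \<Rightarrow> 'a::euclidean_space set \<Rightarrow> ('a \<Rightarrow> 'b::euclidean_space) \<Rightarrow> bool" where
  "Ck_on 0 = (\<lambda>S f. continuous_on S f)"
| "Ck_on (Suc k) = (\<lambda>S f. (\<forall>x\<in>S. f differentiable (at x)) \<and>
      (\<forall>v. Ck_on k S (\<lambda>x. frechet_derivative f (at x) v)))"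

text \<open>\<^const>\<open>Ck_on\<close> is meaningful on open sets only; on an arbitrary set, smooth means having a
  smooth extension to an open neighbourhood.\<close>

definition smooth_on :: "'a::euclidean_space set \<Rightarrow> ('a \<Rightarrow> 'b::euclidean_space) \<Rightarrow> bool" where
  "smooth_on S f \<longleftrightarrow> (\<exists>U F. open U \<and> S \<subseteq> U \<and> (\<forall>k. Ck_on k U F) \<and> (\<forall>x\<in>S. F x = f x))"


section \<open>The 3-sphere and the 3-manifolds it covers\<close>

definition S3 :: "(complex \<times> complex) set" where
  "S3 = sphere 0 1"

text \<open>
  A closed 3-manifold \<open>M\<close> covered by the 3-sphere is given by its covering projection
  \<open>pr :: complex \<times> complex \<Rightarrow> 'm\<close>; its set of points is \<open>pr ` S3\<close>.  As \<open>pr\<close> is a local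
  diffeomorphism, a map into \<open>M\<close> is smooth iff it locally lifts to a smooth map into the sphere,
  and a map \<open>h\<close> out of \<open>M\<close> is smooth iff \<open>h \<circ> pr\<close> is.  The 3-sphere itself is \<open>pr = (\<lambda>x. x)\<close>.
\<close>

definition manifold :: "(complex \<times> complex \<Rightarrow> 'm) \<Rightarrow> 'm set" where
  "manifold pr = pr ` S3"

definition smooth_to ::
    "(complex \<times> complex \<Rightarrow> 'm) \<Rightarrow> 'a::euclidean_space set \<Rightarrow> ('a \<Rightarrow> 'm) \<Rightarrow> bool" where
  "smooth_to pr S f \<longleftrightarrow> (\<forall>x\<in>S. \<exists>U g. open U \<and> x \<in> U \<and> smooth_on (S \<inter> U) g \<and>
      (\<forall>y\<in>S \<inter> U. g y \<in> S3 \<and> f y = pr (g y)))"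

text \<open>Immersions defined on all of a Euclidean space.\<close>

definition immersion_to ::
    "(complex \<times> complex \<Rightarrow> 'm) \<Rightarrow> ('a::euclidean_space \<Rightarrow> 'm) \<Rightarrow> bool" where
  "immersion_to pr f \<longleftrightarrow> (\<forall>x. \<exists>U g. open U \<and> x \<in> U \<and> smooth_on U g \<and>
      (\<forall>y\<in>U. g y \<in> S3 \<and> f y = pr (g y)) \<and> inj (frechet_derivative g (at x)))"

definition diffeo :: "(complex \<times> complex \<Rightarrow> 'm) \<Rightarrow> ('m \<Rightarrow> 'm) \<Rightarrow> bool" where
  "diffeo pr h \<longleftrightarrow> bij_betw h (manifold pr) (manifold pr) \<and>
     smooth_to pr S3 (\<lambda>x. h (pr x)) \<and>
     smooth_to pr S3 (\<lambda>x. inv_into (manifold pr) h (pr x))"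

definition ambient_isotopy :: "(complex \<times> complex \<Rightarrow> 'm) \<Rightarrow> (real \<Rightarrow> 'm \<Rightarrow> 'm) \<Rightarrow> bool" where
  "ambient_isotopy pr H \<longleftrightarrow>
     smooth_to pr ({0..1} \<times> S3) (\<lambda>(t, x). H t (pr x)) \<and>
     (\<forall>t\<in>{0..1}. diffeo pr (H t)) \<and> (\<forall>m\<in>manifold pr. H 0 m = m)"


section \<open>Links and framed links\<close>

text \<open>
  Circles are \<open>\<real> / \<int>\<close>.  Links are unoriented: a link is the union of the images of finitely many
  disjoint smoothly embedded circles (possibly none).
\<close>

definition is_link :: "(complex \<times> complex \<Rightarrow> 'm) \<Rightarrow> 'm set \<Rightarrow> bool" where
  "is_link pr L \<longleftrightarrow> (\<exists>(n::nat) (\<gamma> :: nat \<Rightarrow> real \<Rightarrow> 'm).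
     (\<forall>i<n. immersion_to pr (\<gamma> i)) \<and>
     (\<forall>i<n. \<forall>j<n. \<forall>t t'. \<gamma> i t = \<gamma> j t' \<longleftrightarrow> i = j \<and> t - t' \<in> \<int>) \<and>
     L = (\<Union>i<n. range (\<gamma> i)))"

definition equivalent :: "(complex \<times> complex \<Rightarrow> 'm) \<Rightarrow> 'm set \<Rightarrow> 'm set \<Rightarrow> bool" where
  "equivalent pr L L' \<longleftrightarrow> (\<exists>H. ambient_isotopy pr H \<and> H 1 ` L = L')"

text \<open>
  A framed link is a link \<open>L\<close> together with a union \<open>B\<close> of disjoint embedded annuli whose cores are
  the components of \<open>L\<close>.  The annulus is \<open>\<real> / \<int> \<times> [-1, 1]\<close>; its embedding is required to extend
  to an embedding of an open collar, which is reparametrised as \<open>\<real> / \<int> \<times> \<real>\<close>.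
  The core has to be part of the data: without it, the local pictures below could be applied to a
  strip that is cut off from a band instead of to the band itself.
\<close>

type_synonym 'm framed_link = "'m set \<times> 'm set"

definition framed_links :: "(complex \<times> complex \<Rightarrow> 'm) \<Rightarrow> 'm framed_link set" where
  "framed_links pr = {(L, B). \<exists>(n::nat) (\<beta> :: nat \<Rightarrow> real \<times> real \<Rightarrow> 'm).
     (\<forall>i<n. immersion_to pr (\<beta> i)) \<and>
     (\<forall>i<n. \<forall>j<n. \<forall>t s t' s'. \<beta> i (t, s) = \<beta> j (t', s') \<longleftrightarrow> i = j \<and> t - t' \<in> \<int> \<and> s = s') \<and>
     L = (\<Union>i<n. \<beta> i ` (UNIV \<times> {0})) \<and>
     B = (\<Union>i<n. \<beta> i ` (UNIV \<times> {-1..1}))}"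

definition framed_isotopy ::
    "(complex \<times> complex \<Rightarrow> 'm) \<Rightarrow> ('m framed_link \<times> 'm framed_link) set" where
  "framed_isotopy pr = {(F, F'). F \<in> framed_links pr \<and> F' \<in> framed_links pr \<and>
     (\<exists>H. ambient_isotopy pr H \<and> H 1 ` fst F = fst F' \<and> H 1 ` snd F = snd F')}"

definition framed_link_classes :: "(complex \<times> complex \<Rightarrow> 'm) \<Rightarrow> 'm framed_link set set" where
  "framed_link_classes pr = framed_links pr // framed_isotopy pr"


section \<open>The local pictures of the skein relations\<close>

text \<open>
  The sphere is oriented as the boundary of the unit ball of \<open>\<complex>\<^sup>2\<close> (outward normal first), and
  \<open>complex \<times> real\<close> by the basis \<open>(1, 0), (\<i>, 0), (0, 1)\<close>; planar pictures lie in the first factor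
  and are seen from positive height.
\<close>

definition coords :: "complex \<times> complex \<Rightarrow> real ^ 4" where
  "coords x = vector [Re (fst x), Im (fst x), Re (snd x), Im (snd x)]"

definition cube :: "(complex \<times> real) set" where
  "cube = {(c, h). \<bar>Re c\<bar> < 1 \<and> \<bar>Im c\<bar> < 1 \<and> \<bar>h\<bar> < 1}"

text \<open>Orientation preserving embeddings of the open cube.\<close>

definition oriented_chart ::
    "(complex \<times> complex \<Rightarrow> 'm) \<Rightarrow> (complex \<times> real \<Rightarrow> 'm) \<Rightarrow> bool" where
  "oriented_chart pr \<phi> \<longleftrightarrow> inj_on \<phi> cube \<and>
     (\<forall>x\<in>cube. \<exists>U g. open U \<and> x \<in> U \<and> U \<subseteq> cube \<and> smooth_on U g \<and>
        (\<forall>y\<in>U. g y \<in> S3 \<and> \<phi> y = pr (g y)) \<and>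
        (let D = frechet_derivative g (at x) in
           det (vector [coords (g x), coords (D (1, 0)), coords (D (\<i>, 0)), coords (D (0, 1))]
             :: real ^ 4 ^ 4) > 0))"

text \<open>
  A picture assigns to each radius \<open>r\<close> the bands of half-width \<open>r\<close> in the cube; radius \<open>0\<close> gives the
  strands themselves, i.e. the cores of the bands.
\<close>

type_synonym picture = "real \<Rightarrow> (complex \<times> real) set"

definition looks_like ::
    "(complex \<times> real \<Rightarrow> 'm) \<Rightarrow> 'm framed_link \<Rightarrow> picture \<Rightarrow> bool" where
  "looks_like \<phi> F T \<longleftrightarrow> fst F \<inter> \<phi> ` cube = \<phi> ` (cube \<inter> T 0) \<and>
     snd F \<inter> \<phi> ` cube = \<phi> ` (cube \<inter> T (1 / 8))"

definition agree_outside ::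
    "(complex \<times> real \<Rightarrow> 'm) \<Rightarrow> 'm framed_link \<Rightarrow> 'm framed_link \<Rightarrow> bool" where
  "agree_outside \<phi> F F' \<longleftrightarrow> fst F - \<phi> ` cube = fst F' - \<phi> ` cube \<and>
     snd F - \<phi> ` cube = snd F' - \<phi> ` cube"

text \<open>
  The strands of the crossing run along the two diagonals; the strand along \<open>y = x\<close> is lifted by the
  bump function \<open>\<eta>\<close> and passes over the one along \<open>y = -x\<close>.
\<close>

definition bump :: "(real \<Rightarrow> real) \<Rightarrow> bool" where
  "bump \<eta> \<longleftrightarrow> smooth_on UNIV \<eta> \<and> (\<forall>t. 0 \<le> \<eta> t \<and> \<eta> t \<le> 1 / 2) \<and>
     (\<forall>t. \<bar>t\<bar> \<le> 1 / 4 \<longrightarrow> 0 < \<eta> t) \<and> (\<forall>t. 1 / 2 \<le> \<bar>t\<bar> \<longrightarrow> \<eta> t = 0)"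

definition crossing :: "(real \<Rightarrow> real) \<Rightarrow> picture" where
  "crossing \<eta> r = {(c, h). \<bar>Im c - Re c\<bar> \<le> r \<and> h = \<eta> (Re c)} \<union>
     {(c, h). \<bar>Im c + Re c\<bar> \<le> r \<and> h = 0}"

text \<open>
  The diagonals are \<open>\<bar>x\<bar> = \<bar>y\<bar>\<close>, and a smoothing of the crossing is obtained by replacing one of the
  absolute values by a positive smooth function.  The Kauffman resolution \<open>L\<^sub>0\<close>, with coefficient
  \<open>A\<close>, joins the regions swept by the upper strand when it is turned counterclockwise, here the
  upper and the lower one: its strands are \<open>x = \<plusminus> \<sigma> y\<close>.  Those of \<open>L\<^sub>\<infinity>\<close> are \<open>y = \<plusminus> \<sigma> x\<close>.
\<close>

definition smoothed_abs :: "(real \<Rightarrow> real) \<Rightarrow> bool" where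
  "smoothed_abs \<sigma> \<longleftrightarrow> smooth_on UNIV \<sigma> \<and> (\<forall>t. 1 / 2 \<le> \<bar>t\<bar> \<longrightarrow> \<sigma> t = \<bar>t\<bar>) \<and>
     (\<forall>t. \<bar>t\<bar> \<le> 1 / 2 \<longrightarrow> 1 / 4 \<le> \<sigma> t \<and> \<sigma> t \<le> 1 / 2)"

definition resolution_0 :: "(real \<Rightarrow> real) \<Rightarrow> picture" where
  "resolution_0 \<sigma> r = {(c, h). \<bar>\<bar>Re c\<bar> - \<sigma> (Im c)\<bar> \<le> r \<and> h = 0}"

definition resolution_inf :: "(real \<Rightarrow> real) \<Rightarrow> picture" where
  "resolution_inf \<sigma> r = {(c, h). \<bar>\<bar>Im c\<bar> - \<sigma> (Re c)\<bar> \<le> r \<and> h = 0}"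

definition skein_triple :: "(complex \<times> complex \<Rightarrow> 'm) \<Rightarrow>
    'm framed_link \<Rightarrow> 'm framed_link \<Rightarrow> 'm framed_link \<Rightarrow> bool" where
  "skein_triple pr F F0 Finf \<longleftrightarrow>
     F \<in> framed_links pr \<and> F0 \<in> framed_links pr \<and> Finf \<in> framed_links pr \<and>
     (\<exists>\<phi> \<eta> \<sigma>. oriented_chart pr \<phi> \<and> bump \<eta> \<and> smoothed_abs \<sigma> \<and>
        agree_outside \<phi> F F0 \<and> agree_outside \<phi> F Finf \<and>
        looks_like \<phi> F (crossing \<eta>) \<and>
        looks_like \<phi> F0 (resolution_0 \<sigma>) \<and>
        looks_like \<phi> Finf (resolution_inf \<sigma>))"

text \<open>A strand along the first axis whose band is turned by the angle \<open>\<theta>\<close>; since the axes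
  \<open>y, h, x\<close> are positively oriented, increasing \<open>\<theta>\<close> is a right-handed twist.\<close>

definition twisted_strand :: "(real \<Rightarrow> real) \<Rightarrow> picture" where
  "twisted_strand \<theta> r = {(Complex x (s * cos (\<theta> x)), s * sin (\<theta> x)) | x s. \<bar>s\<bar> \<le> r}"

definition full_right_twist :: "(real \<Rightarrow> real) \<Rightarrow> bool" where
  "full_right_twist \<theta> \<longleftrightarrow> smooth_on UNIV \<theta> \<and> (\<forall>x \<le> - 1 / 2. \<theta> x = 0) \<and> (\<forall>x \<ge> 1 / 2. \<theta> x = 2 * pi)"

definition framing_twist ::
    "(complex \<times> complex \<Rightarrow> 'm) \<Rightarrow> 'm framed_link \<Rightarrow> 'm framed_link \<Rightarrow> bool" where
  "framing_twist pr F F1 \<longleftrightarrow> F \<in> framed_links pr \<and> F1 \<in> framed_links pr \<and>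
     (\<exists>\<phi> \<theta>. oriented_chart pr \<phi> \<and> full_right_twist \<theta> \<and> agree_outside \<phi> F F1 \<and>
        looks_like \<phi> F (twisted_strand (\<lambda>_. 0)) \<and> looks_like \<phi> F1 (twisted_strand \<theta>))"


section \<open>The Kauffman bracket skein module\<close>

text \<open>\<open>\<int>[A\<^sup>\<plusminus>\<^sup>1]\<close> is the group ring of \<open>\<int>\<close>.\<close>

type_synonym laurent = "int \<Rightarrow>\<^sub>0 int"

definition A_pow :: "int \<Rightarrow> laurent" where
  "A_pow k = Poly_Mapping.single k 1"

lemma A_pow_add: "A_pow (k + l) = A_pow k * A_pow l"
  by (simp add: A_pow_def mult_single)

lemma A_pow_0: "A_pow 0 = 1"
  by (simp add: A_pow_def)

definition lscale :: "laurent \<Rightarrow> ('k \<Rightarrow>\<^sub>0 laurent) \<Rightarrow> ('k \<Rightarrow>\<^sub>0 laurent)" where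
  "lscale a x = Poly_Mapping.map ((*) a) x"

lemma lookup_lscale: "Poly_Mapping.lookup (lscale a x) k = a * Poly_Mapping.lookup x k"
  by (simp add: lscale_def Poly_Mapping.map.rep_eq when_def)

global_interpretation lmod: module "lscale :: laurent \<Rightarrow> ('k \<Rightarrow>\<^sub>0 laurent) \<Rightarrow> _"
  by standard (auto intro!: poly_mapping_eqI simp: lookup_lscale lookup_add algebra_simps)

definition free_module :: "(complex \<times> complex \<Rightarrow> 'm) \<Rightarrow> ('m framed_link set \<Rightarrow>\<^sub>0 laurent) set" where
  "free_module pr = {x. Poly_Mapping.keys x \<subseteq> framed_link_classes pr}"

definition gen ::
    "(complex \<times> complex \<Rightarrow> 'm) \<Rightarrow> 'm framed_link \<Rightarrow> ('m framed_link set \<Rightarrow>\<^sub>0 laurent)" where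
  "gen pr F = Poly_Mapping.single (framed_isotopy pr `` {F}) 1"

definition skein_relators ::
    "(complex \<times> complex \<Rightarrow> 'm) \<Rightarrow> ('m framed_link set \<Rightarrow>\<^sub>0 laurent) set" where
  "skein_relators pr =
     {gen pr F - lscale (A_pow 1) (gen pr F0) - lscale (A_pow (-1)) (gen pr Finf) | F F0 Finf.
        skein_triple pr F F0 Finf} \<union>
     {gen pr F1 + lscale (A_pow 3) (gen pr F) | F F1. framing_twist pr F F1}"

definition skein_submodule ::
    "(complex \<times> complex \<Rightarrow> 'm) \<Rightarrow> ('m framed_link set \<Rightarrow>\<^sub>0 laurent) set" where
  "skein_submodule pr = lmod.span (skein_relators pr)"

definition skein_rel :: "(complex \<times> complex \<Rightarrow> 'm) \<Rightarrow>
    (('m framed_link set \<Rightarrow>\<^sub>0 laurent) \<times> ('m framed_link set \<Rightarrow>\<^sub>0 laurent)) set" where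
  "skein_rel pr = {(x, y). x \<in> free_module pr \<and> y \<in> free_module pr \<and> x - y \<in> skein_submodule pr}"

definition skein_module ::
    "(complex \<times> complex \<Rightarrow> 'm) \<Rightarrow> ('m framed_link set \<Rightarrow>\<^sub>0 laurent) set set" where
  "skein_module pr = free_module pr // skein_rel pr"

definition skein_class ::
    "(complex \<times> complex \<Rightarrow> 'm) \<Rightarrow> 'm framed_link \<Rightarrow> ('m framed_link set \<Rightarrow>\<^sub>0 laurent) set" where
  "skein_class pr F = skein_rel pr `` {gen pr F}"

lemma skein_class_in_skein_module:
  assumes "F \<in> framed_links pr"
  shows "skein_class pr F \<in> skein_module pr"
proof -
  have "gen pr F \<in> free_module pr"
    using assms by (auto simp: gen_def free_module_def framed_link_classes_def intro: quotientI)
  thus ?thesis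
    by (auto simp: skein_class_def skein_module_def intro: quotientI)
qed


section \<open>Lens spaces, lifts and punctured disk diagrams\<close>

definition lens_parameters :: "nat \<Rightarrow> nat \<Rightarrow> bool" where
  "lens_parameters p q \<longleftrightarrow> q < p \<and> coprime p q"

text \<open>
  The lens space is the orbit space of the free action of the cyclic group of order \<open>p\<close> on the
  3-sphere generated by \<open>(z, w) \<mapsto> (\<zeta> z, \<zeta>\<^sup>-\<^sup>q w)\<close>, where \<open>\<zeta> = exp (2 \<pi> \<i> / p)\<close>.  The
  sign of \<open>q\<close> makes it the result of \<open>p/q\<close> (rather than \<open>-p/q\<close>) surgery on the unknot; see
  \<open>surgery_embed\<close> below.
\<close>

definition lens_pr :: "nat \<Rightarrow> nat \<Rightarrow> complex \<times> complex \<Rightarrow> (complex \<times> complex) set" where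
  "lens_pr p q x = range (\<lambda>k::int. (cis (2 * pi * of_int k / of_nat p) * fst x,
     cis (- (2 * pi * of_int k * of_nat q / of_nat p)) * snd x))"

definition lift :: "nat \<Rightarrow> nat \<Rightarrow> (complex \<times> complex) set set \<Rightarrow> (complex \<times> complex) set" where
  "lift p q L = {x \<in> S3. lens_pr p q x \<in> L}"

text \<open>
  The complement of the surgery unknot, i.e. of the axis \<open>c = 0\<close> together with infinity, consists of
  the points \<open>(c, h)\<close> with \<open>c \<noteq> 0\<close>.  It is identified with the complement of the circle \<open>z = 0\<close> in
  the lens space by \<open>(z / \<bar>z\<bar>)\<^sup>p = c / \<bar>c\<bar>\<close> and \<open>w (z / \<bar>z\<bar>)\<^sup>q / \<bar>z\<bar> = h + \<i> ln \<bar>c\<bar>\<close>; this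
  preserves the orientations.
\<close>

definition torus_point :: "nat \<Rightarrow> nat \<Rightarrow> real \<Rightarrow> complex \<Rightarrow> complex \<times> complex" where
  "torus_point p q \<alpha> v = (1 / sqrt (1 + (cmod v)\<^sup>2)) *\<^sub>R
     (cis (\<alpha> / of_nat p), v * cis (- (of_nat q * \<alpha> / of_nat p)))"

definition surgery_embed :: "nat \<Rightarrow> nat \<Rightarrow> complex \<times> real \<Rightarrow> (complex \<times> complex) set" where
  "surgery_embed p q = (\<lambda>(c, h). lens_pr p q (torus_point p q (Arg c) (Complex h (ln (cmod c)))))"

lemma lens_pr_orbit:
  "lens_pr p q (cis (2 * pi * of_int m / of_nat p) * z,
     cis (- (2 * pi * of_int m * of_nat q / of_nat p)) * w) = lens_pr p q (z, w)"
proof -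
  define f where "f = (\<lambda>k::int. (cis (2 * pi * of_int k / of_nat p) * z,
     cis (- (2 * pi * of_int k * of_nat q / of_nat p)) * w))"
  have "lens_pr p q (cis (2 * pi * of_int m / of_nat p) * z,
     cis (- (2 * pi * of_int m * of_nat q / of_nat p)) * w) = range (\<lambda>k. f (k + m))"
    by (simp add: lens_pr_def f_def mult.assoc[symmetric] cis_mult ring_distribs add_divide_distrib)
  also have "\<dots> = f ` range (\<lambda>k. k + m)"
    by (simp only: image_image)
  also have "range (\<lambda>k::int. k + m) = UNIV"
    by (rule surj_plus_right)
  finally show ?thesis
    by (simp add: lens_pr_def f_def)
qed

text \<open>The choice of the argument of \<open>c\<close> is immaterial.\<close>

lemma lens_pr_torus_point_cong:
  assumes "cis \<alpha> = cis \<alpha>'"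
  shows "lens_pr p q (torus_point p q \<alpha> v) = lens_pr p q (torus_point p q \<alpha>' v)"
proof -
  from assms have "sin \<alpha> = sin \<alpha>' \<and> cos \<alpha> = cos \<alpha>'"
    by (simp add: complex_eq_iff)
  then obtain m :: int where m: "\<alpha> = \<alpha>' + 2 * pi * of_int m"
    unfolding sin_cos_eq_iff by auto
  define N where "N = 1 / sqrt (1 + (cmod v)\<^sup>2)"
  have "\<alpha> / of_nat p = 2 * pi * of_int m / of_nat p + \<alpha>' / of_nat p"
    by (simp add: m add_divide_distrib)
  hence z: "cis (\<alpha> / of_nat p) = cis (2 * pi * of_int m / of_nat p) * cis (\<alpha>' / of_nat p)"
    by (simp only: cis_mult)
  have "- (of_nat q * \<alpha> / of_nat p) =
      - (2 * pi * of_int m * of_nat q / of_nat p) + - (of_nat q * \<alpha>' / of_nat p)"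
    by (simp add: m add_divide_distrib ring_distribs)
  hence w: "cis (- (of_nat q * \<alpha> / of_nat p)) =
      cis (- (2 * pi * of_int m * of_nat q / of_nat p)) * cis (- (of_nat q * \<alpha>' / of_nat p))"
    by (simp only: cis_mult)
  have "torus_point p q \<alpha> v =
     (cis (2 * pi * of_int m / of_nat p) * (N *\<^sub>R cis (\<alpha>' / of_nat p)),
      cis (- (2 * pi * of_int m * of_nat q / of_nat p)) *
        (N *\<^sub>R (v * cis (- (of_nat q * \<alpha>' / of_nat p)))))"
    unfolding torus_point_def z w N_def scaleR_Pair mult_scaleR_right
    by (simp only: mult.left_commute)
  also have "lens_pr p q \<dots> = lens_pr p q (N *\<^sub>R cis (\<alpha>' / of_nat p),
      N *\<^sub>R (v * cis (- (of_nat q * \<alpha>' / of_nat p))))"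
    by (rule lens_pr_orbit)
  finally show ?thesis
    by (simp add: torus_point_def N_def)
qed

text \<open>
  The surgery slope.  On the torus of the points with \<open>h + \<i> ln \<bar>c\<bar>\<close> of modulus \<open>r\<close>, let \<open>\<mu>\<close> be
  the meridian of the axis (the direction of increasing argument of \<open>c\<close>), and \<open>\<lambda>\<close> its longitude
  (upwards at small \<open>\<bar>c\<bar>\<close>, downwards at large \<open>\<bar>c\<bar>\<close>).  The curve \<open>p \<mu> + q \<lambda>\<close> becomes the
  boundary of a meridian disk of the complementary solid torus, namely of the image of the disk
  \<open>{(z, w) \<in> S3. w > 0, \<bar>z\<bar> \<le> 1 / sqrt (1 + r\<^sup>2)}\<close>.
\<close>

lemma surgery_slope:
  assumes "0 < p" and "0 \<le> r"
  shows "surgery_embed p q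
           (exp (Complex (r * sin (of_nat q * \<theta>)) (of_nat p * \<theta>)), r * cos (of_nat q * \<theta>)) =
         lens_pr p q ((1 / sqrt (1 + r\<^sup>2)) *\<^sub>R (cis \<theta>, of_real r))"
proof -
  let ?c = "exp (Complex (r * sin (of_nat q * \<theta>)) (of_nat p * \<theta>))"
  let ?v = "of_real r * cis (of_nat q * \<theta>)"
  have "sgn ?c = cis (of_nat p * \<theta>)"
    by (simp add: sgn_eq exp_eq_polar norm_mult)
  hence "cis (Arg ?c) = cis (of_nat p * \<theta>)"
    by (subst cis_Arg) auto
  moreover have "Complex (r * cos (of_nat q * \<theta>)) (ln (cmod ?c)) = ?v"
    by (simp add: complex_eq_iff)
  ultimately have "surgery_embed p q (?c, r * cos (of_nat q * \<theta>)) =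
      lens_pr p q (torus_point p q (of_nat p * \<theta>) ?v)"
    unfolding surgery_embed_def prod.case by (metis lens_pr_torus_point_cong)
  also have "torus_point p q (of_nat p * \<theta>) ?v = (1 / sqrt (1 + r\<^sup>2)) *\<^sub>R (cis \<theta>, of_real r)"
    using assms by (simp add: torus_point_def norm_mult mult.assoc cis_mult)
  finally show ?thesis .
qed

text \<open>
  A diagram with \<open>n\<close> components in the punctured plane: the projection forgets the height, is
  regular, and has finitely many multiple points, all of them transverse double points.
\<close>

definition punctured_disk_diagram :: "nat \<Rightarrow> (nat \<Rightarrow> real \<Rightarrow> complex \<times> real) \<Rightarrow> bool" where
  "punctured_disk_diagram n \<gamma> \<longleftrightarrow>
     (\<forall>i<n. smooth_on UNIV (\<gamma> i)) \<and>
     (\<forall>i<n. \<forall>t. fst (\<gamma> i t) \<noteq> 0) \<and>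
     (\<forall>i<n. \<forall>j<n. \<forall>t t'. \<gamma> i t = \<gamma> j t' \<longleftrightarrow> i = j \<and> t - t' \<in> \<int>) \<and>
     (let P = (\<lambda>i t. fst (\<gamma> i t));
          P' = (\<lambda>i t. vector_derivative (P i) (at t));
          pre = (\<lambda>c. {(i, t). i < n \<and> t \<in> {0..<1} \<and> P i t = c})
      in (\<forall>i<n. \<forall>t. P' i t \<noteq> 0) \<and>
         (\<forall>c. finite (pre c) \<and> card (pre c) \<le> 2) \<and>
         finite {c. card (pre c) = 2} \<and>
         (\<forall>c. \<forall>(i, t)\<in>pre c. \<forall>(j, s)\<in>pre c. (i, t) \<noteq> (j, s) \<longrightarrow> Im (cnj (P' i t) * P' j s) \<noteq> 0))"

definition diagram_core :: "nat \<Rightarrow> (nat \<Rightarrow> real \<Rightarrow> complex \<times> real) \<Rightarrow> (complex \<times> real) set" where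
  "diagram_core n \<gamma> = (\<Union>i<n. range (\<gamma> i))"

text \<open>Flat bands of width \<open>2 \<epsilon>\<close> (up to the speed of the parametrisation) around the strands.\<close>

definition blackboard_band ::
    "nat \<Rightarrow> (nat \<Rightarrow> real \<Rightarrow> complex \<times> real) \<Rightarrow> real \<Rightarrow> (complex \<times> real) set" where
  "blackboard_band n \<gamma> \<epsilon> = (\<Union>i<n. {(fst (\<gamma> i t) + of_real (\<epsilon> * s) * \<i> *
       vector_derivative (\<lambda>u. fst (\<gamma> i u)) (at t), snd (\<gamma> i t)) | t s. s \<in> {-1..1}})"

text \<open>
  \<open>KBSM p q L\<close> is the set of the values obtained from all punctured disk diagrams of links equivalent
  to \<open>L\<close>.  In the quotient module, resolving crossings does not change the element, so the
  value computed from a diagram is the class of the diagram with its blackboard framing.  Since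
  different diagrams of \<open>L\<close> induce different framings, the value is only determined up to powers
  of \<open>- A\<^sup>3\<close>, and the invariant of the unframed link is the set of all values.
  A band width \<open>\<epsilon>\<close> is admissible if the band is embedded and avoids the puncture.
\<close>

definition KBSM :: "nat \<Rightarrow> nat \<Rightarrow> (complex \<times> complex) set set \<Rightarrow>
    ((complex \<times> complex) set framed_link set \<Rightarrow>\<^sub>0 laurent) set set" where
  "KBSM p q L = {skein_class (lens_pr p q) F | F n \<gamma> \<epsilon>.
     punctured_disk_diagram n \<gamma> \<and> 0 < \<epsilon> \<and> (\<forall>(c, h)\<in>blackboard_band n \<gamma> \<epsilon>. c \<noteq> 0) \<and>
     F = (surgery_embed p q ` diagram_core n \<gamma>, surgery_embed p q ` blackboard_band n \<gamma> \<epsilon>) \<and>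
     F \<in> framed_links (lens_pr p q) \<and>
     equivalent (lens_pr p q) (surgery_embed p q ` diagram_core n \<gamma>) L}"

lemma KBSM_subset_skein_module: "KBSM p q L \<subseteq> skein_module (lens_pr p q)"
  by (auto simp: KBSM_def intro: skein_class_in_skein_module)

end

theory Submission
  imports Defs
begin

text \<open>
  The value of the Kauffman bracket at \<open>A = -1\<close> only counts components.  There the skein relation
  reads \<open>L + L\<^sub>0 + L\<^sub>\<infinity> = 0\<close> and a full twist of the framing acts trivially, and
  \<open>L \<mapsto> (-2)\<^sup>n\<close>, with \<open>n\<close> the number of components of \<open>L\<close>, satisfies both: the part of a link
  outside of a crossing joins the four ends of the crossing in pairs, the three links of a skein
  triple realise the three pairings inside, and so one of them has one component more than the
  other two, which gives \<open>4 - 2 - 2 = 0\<close> up to a common factor (\<open>three_pairings_sum\<close>,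
  \<open>skein_triple_components\<close>).  Links with \<open>1\<close> and \<open>2\<close> components in one lens space therefore have
  disjoint sets of values \<^const>\<open>KBSM\<close>, whatever the framings (\<open>skein_class_eq_weight\<close>).

  It remains to find two such links with the same lift.  In \<open>L(4, 1)\<close>, the quotient of the sphere
  by \<open>(z, w) \<mapsto> (\<i> z, - \<i> w)\<close>, the Hopf link \<open>w = \<plusminus> z\<close> is the lift of a knot, because the
  generator exchanges its components, whereas the Hopf link \<open>w = \<plusminus> \<i> cnj z\<close> is the lift of a link
  with two components, because the generator preserves both circles.  A rotation of the sphere
  takes the first Hopf link to the second (\<open>equivalent_lifts\<close>).  In the punctured plane, the link
  consists of two concentric circles, and the knot is a curve which winds twice around the puncture
  and has a single crossing.  The bulk of the work on these two links is to show that their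
  blackboard bands are embedded, so that they have values at all; the only delicate
  point is the band of the knot near its highest and lowest points (\<open>knot_band_aux\<close>).

  As links in a lens space are sets of orbits, there is no topology in which to count components.
  The manifold is embedded into a Euclidean space by invariant functions on the sphere
  (\<open>euclidean_quotient\<close>); for \<open>L(4, 1)\<close> these are \<open>z\<^sup>4\<close>, \<open>w\<^sup>4\<close> and \<open>z w\<close>.

  That \<^const>\<open>KBSM\<close> is an invariant amounts to \<^const>\<open>equivalent\<close> being symmetric and
  transitive, which rests on the stability of \<open>C\<^sup>k\<close> maps under composition
  (\<open>Ck_on_compose\<close>).
\<close>


section \<open>Smooth maps\<close>

lemma Ck_on_cong:
  assumes "open S" and "\<And>x. x \<in> S \<Longrightarrow> f x = g x" and "Ck_on k S f"
  shows "Ck_on k S g"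
  using assms(2,3)
proof (induction k arbitrary: f g)
  case 0
  then show ?case using continuous_on_eq by fastforce
next
  case (Suc k)
  have d: "(g has_derivative frechet_derivative f (at x)) (at x)" if "x \<in> S" for x
  proof (rule has_derivative_transform_within_open[OF _ assms(1) that])
    show "(f has_derivative frechet_derivative f (at x)) (at x)"
      using Suc.prems(2) that by (simp add: frechet_derivative_works)
  qed (use Suc.prems(1) in auto)
  show ?case unfolding Ck_on.simps
  proof (intro conjI ballI allI)
    fix x assume "x \<in> S" thus "g differentiable (at x)"
      using d differentiable_def by blast
  next
    fix v show "Ck_on k S (\<lambda>x. frechet_derivative g (at x) v)"
      by (rule Suc.IH[of "\<lambda>x. frechet_derivative f (at x) v"])
        (use Suc.prems(2) d frechet_derivative_at in \<open>fastforce+\<close>)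
  qed
qed

lemma Ck_on_SucI:
  assumes "open S" and "\<And>x. x \<in> S \<Longrightarrow> (f has_derivative f' x) (at x)"
    and "\<And>v. Ck_on k S (\<lambda>x. f' x v)"
  shows "Ck_on (Suc k) S f"
  unfolding Ck_on.simps
proof (intro conjI ballI allI)
  fix x assume "x \<in> S" thus "f differentiable (at x)"
    using assms(2) differentiable_def by blast
next
  fix v show "Ck_on k S (\<lambda>x. frechet_derivative f (at x) v)"
    by (rule Ck_on_cong[OF assms(1) _ assms(3)[of v]])
      (use assms(2) frechet_derivative_at in fastforce)
qed

lemma Ck_on_SucD:
  assumes "Ck_on (Suc k) S f"
  shows "\<And>x. x \<in> S \<Longrightarrow> (f has_derivative frechet_derivative f (at x)) (at x)"
    and "\<And>v. Ck_on k S (\<lambda>x. frechet_derivative f (at x) v)"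
  using assms by (auto simp: frechet_derivative_works)

lemma Ck_on_subset: "Ck_on k S f \<Longrightarrow> T \<subseteq> S \<Longrightarrow> Ck_on k T f"
  by (induction k arbitrary: f) (auto intro: continuous_on_subset)

lemma Ck_on_Suc_imp: "Ck_on (Suc k) S f \<Longrightarrow> Ck_on k S f"
proof (induction k arbitrary: f)
  case 0
  then show ?case
    by (auto simp: differentiable_imp_continuous_within
        intro!: continuous_at_imp_continuous_on)
next
  case (Suc k)
  then show ?case by (subst Ck_on.simps) auto
qed

lemma Ck_on_const: "Ck_on k S (\<lambda>x. c)"
  by (induction k arbitrary: c) auto

lemma Ck_on_add:
  "open S \<Longrightarrow> Ck_on k S f \<Longrightarrow> Ck_on k S g \<Longrightarrow> Ck_on k S (\<lambda>x. f x + g x)"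
proof (induction k arbitrary: f g)
  case 0
  then show ?case by (auto intro: continuous_on_add)
next
  case (Suc k)
  note f = Ck_on_SucD[OF Suc.prems(2)] and g = Ck_on_SucD[OF Suc.prems(3)]
  show ?case
    by (rule Ck_on_SucI[OF Suc.prems(1) has_derivative_add[OF f(1) g(1)]])
      (use Suc.IH Suc.prems(1) f(2) g(2) in auto)
qed

lemma Ck_on_sum:
  assumes "open S" and "\<And>i. i \<in> I \<Longrightarrow> Ck_on k S (f i)"
  shows "Ck_on k S (\<lambda>x. \<Sum>i\<in>I. f i x)"
  using assms(2)
  by (induction I rule: infinite_finite_induct) (auto intro: Ck_on_const Ck_on_add[OF assms(1)])

lemma Ck_on_bilinear:
  fixes f :: "'a::euclidean_space \<Rightarrow> 'b::euclidean_space" and g :: "'a \<Rightarrow> 'c::euclidean_space"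
    and prod :: "'b \<Rightarrow> 'c \<Rightarrow> 'd::euclidean_space"
  assumes "bounded_bilinear prod" and "open S"
  shows "Ck_on k S f \<Longrightarrow> Ck_on k S g \<Longrightarrow> Ck_on k S (\<lambda>x. prod (f x) (g x))"
proof (induction k arbitrary: f g)
  case 0
  then show ?case using bounded_bilinear.continuous_on[OF assms(1)] by auto
next
  case (Suc k)
  note f = Ck_on_SucD[OF Suc.prems(1)] and g = Ck_on_SucD[OF Suc.prems(2)]
  show ?case
    by (rule Ck_on_SucI[OF assms(2) bounded_bilinear.FDERIV[OF assms(1) f(1) g(1)]])
      (assumption | intro Ck_on_add assms(2) Suc.IH f(2) g(2) Ck_on_Suc_imp[OF Suc.prems(1)]
        Ck_on_Suc_imp[OF Suc.prems(2)])+
qed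

lemma Ck_on_bounded_linear:
  assumes "bounded_linear l" and "open S"
  shows "Ck_on k S f \<Longrightarrow> Ck_on k S (\<lambda>x. l (f x))"
proof (induction k arbitrary: f)
  case 0
  then show ?case using linear_continuous_on_compose[of S f l] bounded_linear.linear[OF assms(1)]
    by auto
next
  case (Suc k)
  note f = Ck_on_SucD[OF Suc.prems]
  show ?case
    by (rule Ck_on_SucI[OF assms(2) bounded_linear.has_derivative[OF assms(1) f(1)]])
      (use f Suc.IH in auto)
qed

lemma Ck_on_id: "open S \<Longrightarrow> Ck_on k S (\<lambda>x. x)"
proof (cases k)
  case (Suc k)
  assume "open S"
  thus ?thesis unfolding Suc by (rule Ck_on_SucI) (auto intro!: Ck_on_const derivative_eq_intros)
qed auto

text \<open>The chain rule expands \<open>Df(g x)(Dg(x) v)\<close> in an orthonormal basis, so that the first factor is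
  again a composition, with one derivative less.\<close>

lemma Ck_on_compose:
  assumes "open S" and "open T"
  shows "Ck_on k T f \<Longrightarrow> Ck_on k S g \<Longrightarrow> g ` S \<subseteq> T \<Longrightarrow> Ck_on k S (\<lambda>x. f (g x))"
proof (induction k arbitrary: f)
  case 0
  then show ?case using continuous_on_compose2[of T f S g] by auto
next
  case (Suc k)
  note f = Ck_on_SucD[OF Suc.prems(1)] and g = Ck_on_SucD[OF Suc.prems(2)]
  have gk: "Ck_on k S g" by (rule Ck_on_Suc_imp[OF Suc.prems(2)])
  have T: "g x \<in> T" if "x \<in> S" for x using that Suc.prems(3) by auto
  show ?case
  proof (rule Ck_on_SucI[OF assms(1)])
    fix x assume x: "x \<in> S"
    show "((\<lambda>x. f (g x)) has_derivative
        (\<lambda>v. frechet_derivative f (at (g x)) (frechet_derivative g (at x) v))) (at x)"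
      using diff_chain_at[OF g(1)[OF x] f(1)[OF T[OF x]]] by (simp add: o_def)
  next
    fix v
    have "Ck_on k S (\<lambda>x. \<Sum>b\<in>Basis. (frechet_derivative g (at x) v \<bullet> b) *\<^sub>R
        frechet_derivative f (at (g x)) b)"
    proof (intro Ck_on_sum assms Ck_on_bilinear[OF bounded_bilinear_scaleR])
      fix b :: 'b assume "b \<in> Basis"
      show "Ck_on k S (\<lambda>x. frechet_derivative g (at x) v \<bullet> b)"
        by (rule Ck_on_bilinear[OF bounded_bilinear_inner assms(1) g(2) Ck_on_const])
      show "Ck_on k S (\<lambda>x. frechet_derivative f (at (g x)) b)"
        by (rule Suc.IH[OF f(2) gk Suc.prems(3)])
    qed
    moreover have "(\<Sum>b\<in>Basis. (w \<bullet> b) *\<^sub>R frechet_derivative f (at (g x)) b) =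
        frechet_derivative f (at (g x)) w" if "x \<in> S" for x w
    proof -
      have "linear (frechet_derivative f (at (g x)))"
        using f(1)[OF T[OF that]] has_derivative_linear by blast
      from linear_sum[OF this, of "\<lambda>b. (w \<bullet> b) *\<^sub>R b" Basis] show ?thesis
        by (simp add: euclidean_representation linear_scale[OF \<open>linear _\<close>])
    qed
    ultimately show "Ck_on k S (\<lambda>x. frechet_derivative f (at (g x)) (frechet_derivative g (at x) v))"
      by (rule Ck_on_cong[OF assms(1), rotated]) auto
  qed
qed

text \<open>The induction needs the whole sequence of derivatives: the derivative of \<open>D n\<close> is expressed by
  \<open>D (Suc n)\<close>, for which the induction hypothesis must hold as well.\<close>

lemma Ck_on_field:
  fixes D :: "nat \<Rightarrow> 'a::{real_normed_field, euclidean_space} \<Rightarrow> 'a"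
  assumes "open S" and "\<And>n x. x \<in> S \<Longrightarrow> (D n has_field_derivative D (Suc n) x) (at x)"
  shows "Ck_on k S (D n)"
proof (induction k arbitrary: n)
  case 0
  show ?case using assms by (auto intro!: continuous_at_imp_continuous_on DERIV_isCont)
next
  case (Suc k)
  show ?case
    by (rule Ck_on_SucI[OF assms(1) assms(2)[unfolded has_field_derivative_def]])
      (auto intro!: Ck_on_bilinear[OF bounded_bilinear_mult assms(1)] Suc Ck_on_const)
qed


named_theorems smooth_intros

lemma smooth_on_open: "open S \<Longrightarrow> smooth_on S f \<longleftrightarrow> (\<forall>k. Ck_on k S f)"
proof
  assume S: "open S" and "smooth_on S f"
  then obtain U F where F: "S \<subseteq> U" "\<And>k. Ck_on k U F" "\<And>x. x \<in> S \<Longrightarrow> F x = f x"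
    unfolding smooth_on_def by blast
  show "\<forall>k. Ck_on k S f"
    using Ck_on_cong[OF S F(3) Ck_on_subset[OF F(2,1)]] by blast
qed (auto simp: smooth_on_def)

lemma smooth_on_UNIV_imp: "smooth_on UNIV f \<Longrightarrow> smooth_on S f"
  unfolding smooth_on_def by blast

lemma smooth_on_subset: "smooth_on S f \<Longrightarrow> T \<subseteq> S \<Longrightarrow> smooth_on T f"
  unfolding smooth_on_def by blast

lemma smooth_on_cong: "smooth_on S f \<Longrightarrow> (\<And>x. x \<in> S \<Longrightarrow> f x = g x) \<Longrightarrow> smooth_on S g"
  unfolding smooth_on_def by metis

lemma smooth_on_imp_continuous_on: "smooth_on S f \<Longrightarrow> continuous_on S f"
  unfolding smooth_on_def
  by (metis Ck_on.simps(1) continuous_on_cong continuous_on_subset)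

lemma smooth_on_has_derivative:
  assumes "smooth_on S f" and "open S" and "x \<in> S"
  shows "(f has_derivative frechet_derivative f (at x)) (at x)"
  using assms Ck_on_SucD(1) smooth_on_open by blast

lemma smooth_on_const [smooth_intros]: "smooth_on S (\<lambda>x. c)"
  by (rule smooth_on_UNIV_imp) (simp add: smooth_on_open Ck_on_const)

lemma smooth_on_id [smooth_intros]: "smooth_on S (\<lambda>x. x)"
  by (rule smooth_on_UNIV_imp) (simp add: smooth_on_open Ck_on_id)

lemma smooth_on_compose:
  assumes "smooth_on T f" and "smooth_on S g" and "g ` S \<subseteq> T"
  shows "smooth_on S (\<lambda>x. f (g x))"
proof -
  obtain V F where F: "open V" "T \<subseteq> V" "\<And>k. Ck_on k V F" "\<And>x. x \<in> T \<Longrightarrow> F x = f x"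
    using assms(1) unfolding smooth_on_def by blast
  obtain U G where G: "open U" "S \<subseteq> U" "\<And>k. Ck_on k U G" "\<And>x. x \<in> S \<Longrightarrow> G x = g x"
    using assms(2) unfolding smooth_on_def by blast
  have "continuous_on U G" using G(3)[of 0] by simp
  hence o: "open (U \<inter> G -` V)"
    by (metis F(1) G(1) continuous_on_open_vimage inf_commute)
  have "Ck_on k (U \<inter> G -` V) (\<lambda>x. F (G x))" for k
    by (rule Ck_on_compose[OF o F(1) F(3)]) (auto intro: Ck_on_subset[OF G(3)])
  moreover have "S \<subseteq> U \<inter> G -` V" using G(2,4) F(2) assms(3) by fastforce
  moreover have "F (G x) = f (g x)" if "x \<in> S" for x
    using that G(4) F(4) assms(3) by auto
  ultimately show ?thesis using o unfolding smooth_on_def by blast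
qed

lemma smooth_on_bounded_linear:
  "bounded_linear l \<Longrightarrow> smooth_on S f \<Longrightarrow> smooth_on S (\<lambda>x. l (f x))"
  by (rule smooth_on_compose[of UNIV l])
    (auto simp: smooth_on_open Ck_on_bounded_linear[OF _ open_UNIV Ck_on_id[OF open_UNIV]])

lemma smooth_on_Pair [smooth_intros]:
  fixes f :: "'a::euclidean_space \<Rightarrow> 'b::euclidean_space" and g :: "'a \<Rightarrow> 'c::euclidean_space"
  assumes "smooth_on S f" and "smooth_on S g"
  shows "smooth_on S (\<lambda>x. (f x, g x))"
proof -
  obtain V F where F: "open V" "S \<subseteq> V" "\<And>k. Ck_on k V F" "\<And>x. x \<in> S \<Longrightarrow> F x = f x"
    using assms(1) unfolding smooth_on_def by blast
  obtain U G where G: "open U" "S \<subseteq> U" "\<And>k. Ck_on k U G" "\<And>x. x \<in> S \<Longrightarrow> G x = g x"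
    using assms(2) unfolding smooth_on_def by blast
  have lin: "bounded_linear (\<lambda>x::'b. (x, 0::'c))" "bounded_linear (\<lambda>x::'c. (0::'b, x))"
    by (auto intro!: bounded_linear_Pair bounded_linear_ident bounded_linear_zero)
  have o: "open (U \<inter> V)" using F G by auto
  have "Ck_on k (U \<inter> V) (\<lambda>x. (F x, 0) + (0, G x))" for k
    by (intro Ck_on_add o Ck_on_bounded_linear[OF lin(1)] Ck_on_bounded_linear[OF lin(2)])
      (auto intro: Ck_on_subset[OF F(3)] Ck_on_subset[OF G(3)])
  thus ?thesis
    unfolding smooth_on_def using o F G by (intro exI[of _ "U \<inter> V"] exI) auto
qed

lemma smooth_on_bilinear:
  fixes f :: "'a::euclidean_space \<Rightarrow> 'b::euclidean_space" and g :: "'a \<Rightarrow> 'c::euclidean_space"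
    and prod :: "'b \<Rightarrow> 'c \<Rightarrow> 'd::euclidean_space"
  assumes "bounded_bilinear prod" and "smooth_on S f" and "smooth_on S g"
  shows "smooth_on S (\<lambda>x. prod (f x) (g x))"
proof -
  have "Ck_on k UNIV (\<lambda>z. prod (fst z) (snd z))" for k
    by (intro Ck_on_bilinear[OF assms(1)] Ck_on_bounded_linear[OF bounded_linear_fst]
        Ck_on_bounded_linear[OF bounded_linear_snd] Ck_on_id open_UNIV)
  hence "smooth_on UNIV (\<lambda>z. prod (fst z) (snd z))" by (simp add: smooth_on_open)
  from smooth_on_compose[OF this smooth_on_Pair[OF assms(2,3)]] show ?thesis by simp
qed

lemma smooth_on_add [smooth_intros]:
  assumes "smooth_on S f" and "smooth_on S g"
  shows "smooth_on S (\<lambda>x. f x + g x)"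
proof -
  have "smooth_on S (\<lambda>x. (\<lambda>z. fst z + snd z) (f x, g x))"
    by (rule smooth_on_bounded_linear[OF _ smooth_on_Pair[OF assms]])
      (intro bounded_linear_add bounded_linear_fst bounded_linear_snd)
  thus ?thesis by simp
qed

lemmas smooth_on_linear_intros [smooth_intros] =
  smooth_on_bounded_linear[OF bounded_linear_fst]
  smooth_on_bounded_linear[OF bounded_linear_snd]
  smooth_on_bounded_linear[OF bounded_linear_Re]
  smooth_on_bounded_linear[OF bounded_linear_Im]
  smooth_on_bounded_linear[OF bounded_linear_cnj]
  smooth_on_bounded_linear[OF bounded_linear_of_real]
  smooth_on_bounded_linear[OF bounded_linear_minus[OF bounded_linear_ident]]

lemmas smooth_on_bilinear_intros [smooth_intros] =
  smooth_on_bilinear[OF bounded_bilinear_mult]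
  smooth_on_bilinear[OF bounded_bilinear_scaleR]
  smooth_on_bilinear[OF bounded_bilinear_inner]

lemma smooth_on_diff [smooth_intros]:
  "smooth_on S f \<Longrightarrow> smooth_on S g \<Longrightarrow> smooth_on S (\<lambda>x. f x - g x)"
  using smooth_on_add[of S f "\<lambda>x. - g x"]
    smooth_on_bounded_linear[OF bounded_linear_minus[OF bounded_linear_ident], of S g] by simp

lemma smooth_on_power [smooth_intros]:
  fixes f :: "_ \<Rightarrow> 'a::{real_normed_field, euclidean_space}"
  shows "smooth_on S f \<Longrightarrow> smooth_on S (\<lambda>x. f x ^ n)"
  by (induction n) (auto intro: smooth_intros)

lemma smooth_on_Complex [smooth_intros]:
  "smooth_on S f \<Longrightarrow> smooth_on S g \<Longrightarrow> smooth_on S (\<lambda>x. Complex (f x) (g x))"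
  unfolding Complex_eq by (intro smooth_intros)

lemma smooth_on_exp [smooth_intros]:
  fixes f :: "_ \<Rightarrow> 'a::{real_normed_field, banach, euclidean_space}"
  assumes "smooth_on S f"
  shows "smooth_on S (\<lambda>x. exp (f x))"
proof (rule smooth_on_compose[OF _ assms subset_UNIV])
  show "smooth_on UNIV (exp :: 'a \<Rightarrow> 'a)"
    using Ck_on_field[of UNIV "\<lambda>_. exp :: 'a \<Rightarrow> 'a"] by (auto simp: smooth_on_open)
qed

lemma smooth_on_inverse [smooth_intros]:
  fixes f :: "_ \<Rightarrow> 'a::{real_normed_field, euclidean_space}"
  assumes "smooth_on S f" and nz: "\<And>x. x \<in> S \<Longrightarrow> f x \<noteq> 0"
  shows "smooth_on S (\<lambda>x. inverse (f x))"
proof (rule smooth_on_compose[OF _ assms(1), of "- {0}"])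
  define D where "D = (\<lambda>n (x::'a). (- 1) ^ n * fact n * inverse x ^ Suc n)"
  have "Ck_on k (- {0}) (D 0)" for k
  proof (rule Ck_on_field)
    fix n and x :: 'a assume "x \<in> - {0}"
    hence x: "x \<noteq> 0" by simp
    show "(D n has_field_derivative D (Suc n) x) (at x)"
      unfolding D_def
      by (rule DERIV_cong[OF DERIV_cmult[OF DERIV_power[OF DERIV_inverse[OF x]]]])
        (simp add: algebra_simps)
  qed auto
  thus "smooth_on (- {0}) (inverse :: 'a \<Rightarrow> 'a)"
    by (subst smooth_on_open) (auto simp: D_def)
qed (use nz in auto)

lemma smooth_on_divide [smooth_intros]:
  fixes f :: "_ \<Rightarrow> 'a::{real_normed_field, euclidean_space}"
  assumes "smooth_on S f" and "smooth_on S g" and "\<And>x. x \<in> S \<Longrightarrow> g x \<noteq> 0"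
  shows "smooth_on S (\<lambda>x. f x / g x)"
  unfolding divide_inverse by (intro smooth_intros assms)

lemma smooth_on_Ln [smooth_intros]:
  assumes "smooth_on S f" and "\<And>x. x \<in> S \<Longrightarrow> Re (f x) > 0"
  shows "smooth_on S (\<lambda>x. Ln (f x))"
proof (rule smooth_on_compose[OF _ assms(1), of "{z. Re z > 0}"])
  have o: "open {z. Re z > 0}" by (rule open_halfspace_Re_gt)
  have nz: "z \<noteq> 0" if "Re z > 0" for z using that by auto
  have "smooth_on {z. Re z > 0} (\<lambda>z. inverse z)" by (intro smooth_intros) (auto simp: nz)
  hence inv: "Ck_on k {z. Re z > 0} inverse" for k using smooth_on_open[OF o] by auto
  have "Ck_on k {z. Re z > 0} Ln" for k
  proof (cases k)
    case 0
    thus ?thesis by (auto intro!: continuous_at_imp_continuous_on continuous_at_Ln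
        simp: complex_nonpos_Reals_iff)
  next
    case (Suc k)
    show ?thesis unfolding Suc
    proof (rule Ck_on_SucI[OF o])
      fix z assume "z \<in> {z. Re z > 0}"
      hence "z \<notin> \<real>\<^sub>\<le>\<^sub>0" by (auto simp: complex_nonpos_Reals_iff)
      thus "(Ln has_derivative (\<lambda>v. inverse z * v)) (at z)"
        using has_field_derivative_Ln unfolding has_field_derivative_def by blast
    qed (intro Ck_on_bilinear[OF bounded_bilinear_mult o] inv Ck_on_const)
  qed
  thus "smooth_on {z. Re z > 0} Ln" using smooth_on_open[OF o] by auto
qed (use assms in auto)

lemma smooth_on_powr [smooth_intros]:
  fixes f :: "_ \<Rightarrow> real"
  assumes "smooth_on S f" and "\<And>x. x \<in> S \<Longrightarrow> f x > 0"
  shows "smooth_on S (\<lambda>x. f x powr a)"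
proof (rule smooth_on_compose[OF _ assms(1), of "{0<..}"])
  define D where "D = (\<lambda>n (x::real). (\<Prod>i<n. a - real i) * x powr (a - real n))"
  have "Ck_on k {0<..} (D 0)" for k
  proof (rule Ck_on_field)
    fix n and x :: real assume "x \<in> {0<..}"
    hence "x > 0" by simp
    thus "(D n has_field_derivative D (Suc n) x) (at x)"
      unfolding D_def by (auto intro!: derivative_eq_intros simp: algebra_simps)
  qed auto
  thus "smooth_on {0<..} (\<lambda>x::real. x powr a)"
    by (subst smooth_on_open) (auto simp: D_def)
qed (use assms in auto)

lemma smooth_on_cis [smooth_intros]: "smooth_on S f \<Longrightarrow> smooth_on S (\<lambda>x. cis (f x))"
  unfolding cis_conv_exp by (intro smooth_intros)

lemma smooth_on_cos [smooth_intros]: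
  fixes f :: "_ \<Rightarrow> real"
  shows "smooth_on S f \<Longrightarrow> smooth_on S (\<lambda>x. cos (f x))"
  using smooth_on_bounded_linear[OF bounded_linear_Re smooth_on_cis, of S f] by simp

lemma smooth_on_sin [smooth_intros]:
  fixes f :: "_ \<Rightarrow> real"
  shows "smooth_on S f \<Longrightarrow> smooth_on S (\<lambda>x. sin (f x))"
  using smooth_on_bounded_linear[OF bounded_linear_Im smooth_on_cis, of S f] by simp


section \<open>Ambient isotopies\<close>

lemma smooth_to_I:
  assumes "smooth_on S g" and "\<And>x. x \<in> S \<Longrightarrow> g x \<in> S3 \<and> f x = pr (g x)"
  shows "smooth_to pr S f"
  unfolding smooth_to_def using assms
  by (auto intro!: exI[of _ UNIV] exI[of _ g])

text \<open>Smoothness into the manifold can be tested after replacing the argument by a local lift of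
  it: this is what makes maps defined through the covering composable.\<close>

lemma smooth_to_compose:
  assumes k: "smooth_to pr T k"
    and f: "\<And>x. x \<in> S \<Longrightarrow> \<exists>U g. open U \<and> x \<in> U \<and> smooth_on (S \<inter> U) g \<and>
      (\<forall>y\<in>S \<inter> U. g y \<in> T \<and> f y = k (g y))"
  shows "smooth_to pr S f"
  unfolding smooth_to_def
proof
  fix x assume x: "x \<in> S"
  obtain U g where U: "open U" "x \<in> U" "smooth_on (S \<inter> U) g"
    and g: "\<And>y. y \<in> S \<inter> U \<Longrightarrow> g y \<in> T \<and> f y = k (g y)"
    using f[OF x] by meson
  obtain V h where V: "open V" "g x \<in> V" "smooth_on (T \<inter> V) h"
    and h: "\<And>y. y \<in> T \<inter> V \<Longrightarrow> h y \<in> S3 \<and> k y = pr (h y)"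
  proof -
    have "g x \<in> T" using g[of x] x U(2) by auto
    from k[unfolded smooth_to_def, rule_format, OF this] show ?thesis using that by meson
  qed
  obtain W where W: "open W" "W \<inter> (S \<inter> U) = g -` V \<inter> (S \<inter> U)"
    using smooth_on_imp_continuous_on[OF U(3)] V(1)
    unfolding continuous_on_open_invariant by metis
  have sub: "g ` (S \<inter> (U \<inter> W)) \<subseteq> T \<inter> V" using W(2) g by auto
  have "smooth_on (S \<inter> (U \<inter> W)) (\<lambda>y. h (g y))"
    by (rule smooth_on_compose[OF V(3) smooth_on_subset[OF U(3)] sub]) auto
  moreover have "open (U \<inter> W)" "x \<in> U \<inter> W" using U W V(2) x by auto
  moreover have "h (g y) \<in> S3 \<and> f y = pr (h (g y))" if "y \<in> S \<inter> (U \<inter> W)" for y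
    using that sub h[of "g y"] g[of y] by auto
  ultimately show "\<exists>U g. open U \<and> x \<in> U \<and> smooth_on (S \<inter> U) g \<and>
      (\<forall>y\<in>S \<inter> U. g y \<in> S3 \<and> f y = pr (g y))"
    by (intro exI[of _ "U \<inter> W"] exI[of _ "\<lambda>y. h (g y)"]) auto
qed

lemma smooth_to_compose_global:
  assumes "smooth_to pr T k" and "smooth_on S g" and "g ` S \<subseteq> T"
  shows "smooth_to pr S (\<lambda>x. k (g x))"
  by (rule smooth_to_compose[OF assms(1)])
    (use assms(2,3) in \<open>auto intro!: exI[of _ UNIV] exI[of _ g]\<close>)

lemma smooth_to_cong:
  assumes "smooth_to pr S f" and "\<And>x. x \<in> S \<Longrightarrow> f x = f' x"
  shows "smooth_to pr S f'"
  by (rule smooth_to_compose[OF assms(1)])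
    (use assms(2) in \<open>auto intro!: exI[of _ UNIV] exI[of _ "\<lambda>x. x"] smooth_intros\<close>)

lemma smooth_to_diffeo:
  assumes "smooth_to pr S3 (\<lambda>x. h (pr x))" and f: "smooth_to pr S f"
  shows "smooth_to pr S (\<lambda>x. h (f x))"
proof (rule smooth_to_compose[OF assms(1)])
  fix x assume "x \<in> S"
  then obtain U g where "open U" "x \<in> U" "smooth_on (S \<inter> U) g"
      "\<forall>y\<in>S \<inter> U. g y \<in> S3 \<and> f y = pr (g y)"
    using f unfolding smooth_to_def by blast
  thus "\<exists>U g. open U \<and> x \<in> U \<and> smooth_on (S \<inter> U) g \<and>
      (\<forall>y\<in>S \<inter> U. g y \<in> S3 \<and> h (f y) = h (pr (g y)))" by metis
qed

lemma smooth_to_isotopy: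
  assumes H: "smooth_to pr ({0..1} \<times> S3) (\<lambda>(t, x). H t (pr x))"
    and f: "smooth_to pr S f" and a: "smooth_on S a" "a ` S \<subseteq> {0..1}"
  shows "smooth_to pr S (\<lambda>x. H (a x) (f x))"
proof (rule smooth_to_compose[OF H])
  fix x assume "x \<in> S"
  then obtain U g where U: "open U" "x \<in> U" "smooth_on (S \<inter> U) g"
      "\<forall>y\<in>S \<inter> U. g y \<in> S3 \<and> f y = pr (g y)"
    using f unfolding smooth_to_def by blast
  have "smooth_on (S \<inter> U) (\<lambda>y. (a y, g y))"
    by (intro smooth_on_Pair U smooth_on_subset[OF a(1)]) auto
  thus "\<exists>U g. open U \<and> x \<in> U \<and> smooth_on (S \<inter> U) g \<and>
      (\<forall>y\<in>S \<inter> U. g y \<in> {0..1} \<times> S3 \<and> H (a y) (f y) = (case g y of (t, x) \<Rightarrow> H t (pr x)))"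
    using U a(2) by (intro exI[of _ U] exI[of _ "\<lambda>y. (a y, g y)"]) (auto simp: image_subset_iff)
qed

lemma smooth_to_pr: "smooth_to pr S3 pr"
  by (rule smooth_to_I[of _ "\<lambda>x. x"]) (auto intro: smooth_intros)

lemma diffeo_bij: "diffeo pr h \<Longrightarrow> bij_betw h (manifold pr) (manifold pr)"
  by (simp add: diffeo_def)

lemma diffeo_compose:
  assumes "diffeo pr h" and "diffeo pr k"
  shows "diffeo pr (\<lambda>m. h (k m))"
proof -
  note b = diffeo_bij[OF assms(1)] diffeo_bij[OF assms(2)]
  have bc: "bij_betw (\<lambda>m. h (k m)) (manifold pr) (manifold pr)"
    using bij_betw_trans[OF b(2,1)] by (simp add: o_def)
  have inv: "inv_into (manifold pr) (\<lambda>m. h (k m)) (pr x) =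
      inv_into (manifold pr) k (inv_into (manifold pr) h (pr x))" if "x \<in> S3" for x
    using that inv_into_comp[of h k "manifold pr" "pr x"] b
    by (auto simp: o_def bij_betw_def manifold_def)
  have "smooth_to pr S3 (\<lambda>x. inv_into (manifold pr) k (inv_into (manifold pr) h (pr x)))"
    by (rule smooth_to_diffeo) (use assms in \<open>auto simp: diffeo_def\<close>)
  hence "smooth_to pr S3 (\<lambda>x. inv_into (manifold pr) (\<lambda>m. h (k m)) (pr x))"
    by (rule smooth_to_cong) (simp add: inv)
  moreover have "smooth_to pr S3 (\<lambda>x. h (k (pr x)))"
    by (rule smooth_to_diffeo) (use assms in \<open>auto simp: diffeo_def\<close>)
  ultimately show ?thesis using bc by (simp add: diffeo_def)
qed

lemma diffeo_inv:
  assumes "diffeo pr h"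
  shows "diffeo pr (inv_into (manifold pr) h)"
proof -
  note b = diffeo_bij[OF assms]
  have "inv_into (manifold pr) (inv_into (manifold pr) h) (pr x) = h (pr x)" if "x \<in> S3" for x
    using b that by (simp add: inv_into_inv_into_eq manifold_def)
  hence "smooth_to pr S3 (\<lambda>x. inv_into (manifold pr) (inv_into (manifold pr) h) (pr x))"
    using assms smooth_to_cong[of pr S3 "\<lambda>x. h (pr x)"] by (simp add: diffeo_def)
  thus ?thesis using assms b by (simp add: diffeo_def bij_betw_inv_into)
qed

lemma diffeo_id: "diffeo pr (\<lambda>m. m)"
proof -
  have "inv_into (manifold pr) (\<lambda>m. m) (pr x) = pr x" if "x \<in> S3" for x
    using that inv_into_f_f[of "\<lambda>m. m" "manifold pr" "pr x"] by (auto simp: manifold_def)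
  hence "smooth_to pr S3 (\<lambda>x. inv_into (manifold pr) (\<lambda>m. m) (pr x))"
    by (metis smooth_to_cong smooth_to_pr)
  thus ?thesis by (auto simp: diffeo_def smooth_to_pr bij_betw_def)
qed

lemma ambient_isotopy_const: "ambient_isotopy pr (\<lambda>t m. m)"
proof -
  have "smooth_to pr ({0..1} \<times> S3) (\<lambda>z. pr (snd z))"
    by (rule smooth_to_compose_global[OF smooth_to_pr]) (auto intro: smooth_intros)
  thus ?thesis by (auto simp: ambient_isotopy_def diffeo_id case_prod_unfold)
qed

lemma smooth_to_isotopy_compose:
  assumes H: "smooth_to pr ({0..1} \<times> S3) (\<lambda>(t, x). H t (pr x))"
    and G: "smooth_to pr ({0..1} \<times> S3) (\<lambda>(t, x). G t (pr x))"
    and a: "smooth_on ({0..1} \<times> S3) a" "a ` ({0..1} \<times> S3) \<subseteq> {0..1}"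
  shows "smooth_to pr ({0..1} \<times> S3) (\<lambda>(t, x). H (a (t, x)) (G t (pr x)))"
  using smooth_to_isotopy[OF H G a] by (simp add: case_prod_unfold)

lemma ambient_isotopy_compose:
  assumes "ambient_isotopy pr H" and "ambient_isotopy pr G"
  shows "ambient_isotopy pr (\<lambda>t m. H t (G t m))"
proof -
  have "smooth_on ({0..1} \<times> S3) (fst :: real \<times> complex \<times> complex \<Rightarrow> real)"
    by (intro smooth_intros)
  hence "smooth_to pr ({0..1} \<times> S3) (\<lambda>(t, x). H t (G t (pr x)))"
    using smooth_to_isotopy_compose[of pr H G fst] assms by (auto simp: ambient_isotopy_def)
  thus ?thesis
    using assms diffeo_compose unfolding ambient_isotopy_def by fastforce
qed

text \<open>The inverse isotopy is \<open>H (1 - t) \<circ> (H 1)\<inverse>\<close>: running time backwards only uses the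
  smoothness of the inverse of the single diffeomorphism \<open>H 1\<close>, whereas that of
  \<open>(t, m) \<mapsto> (H t)\<inverse> m\<close> would need the inverse function theorem.\<close>

lemma ambient_isotopy_reverse:
  assumes "ambient_isotopy pr H"
  shows "ambient_isotopy pr (\<lambda>t m. H (1 - t) (inv_into (manifold pr) (H 1) m))"
proof -
  let ?k = "inv_into (manifold pr) (H 1)"
  have H: "smooth_to pr ({0..1} \<times> S3) (\<lambda>(t, x). H t (pr x))" "diffeo pr (H t)" if "t \<in> {0..1}" for t
    using assms that by (auto simp: ambient_isotopy_def)
  have H1: "diffeo pr (H 1)" using H(2)[of 1] by simp
  have k: "diffeo pr ?k" by (rule diffeo_inv[OF H1])
  have "smooth_to pr ({0..1} \<times> S3) (\<lambda>z. ?k (pr (snd z)))"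
    by (rule smooth_to_compose_global[of pr S3 "\<lambda>x. ?k (pr x)"])
      (use k in \<open>auto simp: diffeo_def intro: smooth_intros\<close>)
  moreover have "smooth_on ({0..1} \<times> S3) (\<lambda>z::real \<times> complex \<times> complex. 1 - fst z)"
    by (intro smooth_intros)
  moreover have "(\<lambda>z::real \<times> complex \<times> complex. 1 - fst z) ` ({0..1} \<times> S3) \<subseteq> {0..1}" by auto
  ultimately have "smooth_to pr ({0..1} \<times> S3) (\<lambda>(t, x). H (1 - t) (?k (pr x)))"
    using smooth_to_isotopy[OF H(1), of 0 "{0..1} \<times> S3" "\<lambda>z. ?k (pr (snd z))" "\<lambda>z. 1 - fst z"]
    by (auto simp: case_prod_unfold)
  moreover have "\<forall>t\<in>{0..1}. diffeo pr (\<lambda>m. H (1 - t) (?k m))"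
    using diffeo_compose[OF H(2) k] by auto
  moreover have "H 1 (?k m) = m" if "m \<in> manifold pr" for m
    using diffeo_bij[OF H1] that by (meson bij_betw_inv_into_right)
  ultimately show ?thesis by (simp add: ambient_isotopy_def)
qed

lemma is_link_subset_manifold:
  assumes "is_link pr L"
  shows "L \<subseteq> manifold pr"
proof -
  have "f t \<in> manifold pr" if "immersion_to pr f" for f :: "real \<Rightarrow> 'a" and t
    using that unfolding immersion_to_def manifold_def by blast
  thus ?thesis using assms unfolding is_link_def by blast
qed

lemma equivalent_refl: "equivalent pr L L"
  using ambient_isotopy_const[of pr] by (auto simp: equivalent_def intro!: exI[of _ "\<lambda>t m. m"])

lemma equivalent_trans:
  assumes "equivalent pr L L'" and "equivalent pr L' L''"
  shows "equivalent pr L L''"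
proof -
  obtain G H where "ambient_isotopy pr G" "G 1 ` L = L'" "ambient_isotopy pr H" "H 1 ` L' = L''"
    using assms by (auto simp: equivalent_def)
  thus ?thesis unfolding equivalent_def
    by (intro exI[of _ "\<lambda>t m. H t (G t m)"]) (auto intro: ambient_isotopy_compose)
qed

lemma equivalent_sym:
  assumes "equivalent pr L L'" and "L \<subseteq> manifold pr"
  shows "equivalent pr L' L"
proof -
  obtain H where H: "ambient_isotopy pr H" "H 1 ` L = L'"
    using assms(1) by (auto simp: equivalent_def)
  let ?k = "inv_into (manifold pr) (H 1)"
  have b: "bij_betw (H 1) (manifold pr) (manifold pr)" and 0: "\<And>m. m \<in> manifold pr \<Longrightarrow> H 0 m = m"
    using H(1) by (auto simp: ambient_isotopy_def diffeo_bij)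
  have "H (1 - 1) (?k (H 1 m)) = m" if "m \<in> L" for m
    using b 0 that assms(2) by (simp add: bij_betw_def subset_iff)
  hence "(\<lambda>m. H (1 - 1) (?k m)) ` L' = L"
    unfolding H(2)[symmetric] image_image by force
  thus ?thesis
    using ambient_isotopy_reverse[OF H(1)] unfolding equivalent_def by blast
qed

lemma KBSM_equivalent:
  assumes "is_link (lens_pr p q) L" and "equivalent (lens_pr p q) L L'"
  shows "KBSM p q L = KBSM p q L'"
proof -
  have "equivalent (lens_pr p q) X L \<longleftrightarrow> equivalent (lens_pr p q) X L'" for X
    using equivalent_trans assms(2) equivalent_sym[OF assms(2) is_link_subset_manifold[OF assms(1)]]
    by metis
  thus ?thesis unfolding KBSM_def by simp
qed


section \<open>Counting components of unions of closed curves\<close>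

text \<open>Such a family consists of the components of its union (\<open>components_closed_partition\<close>); this is
  how components are counted below.\<close>

definition closed_partition :: "'a::topological_space set set \<Rightarrow> bool" where
  "closed_partition \<U> \<longleftrightarrow> finite \<U> \<and> pairwise disjnt \<U> \<and>
     (\<forall>U\<in>\<U>. closed U \<and> connected U \<and> U \<noteq> {})"

lemma closed_partition_subset:
  "closed_partition \<U> \<Longrightarrow> \<V> \<subseteq> \<U> \<Longrightarrow> closed_partition \<V>"
  unfolding closed_partition_def by (meson finite_subset pairwise_subset subset_iff)

lemma closed_partition_insert:
  "closed_partition (insert U \<U>) \<and> U \<notin> \<U> \<longleftrightarrow>
     closed_partition \<U> \<and> closed U \<and> connected U \<and> U \<noteq> {} \<and> U \<inter> \<Union>\<U> = {}"
  unfolding closed_partition_def pairwise_insert by (auto simp: disjnt_def)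

lemma closed_partition_connected_subset:
  assumes "closed_partition \<U>" and "connected A" and "A \<subseteq> \<Union>\<U>" and "U \<in> \<U>" and "A \<inter> U \<noteq> {}"
  shows "A \<subseteq> U"
proof -
  have U: "\<U> = insert U (\<U> - {U})" using assms(4) by auto
  have p: "closed_partition (\<U> - {U})" "closed U" "U \<inter> \<Union>(\<U> - {U}) = {}"
    using closed_partition_insert[of U "\<U> - {U}"] assms(1) U by auto
  have "closed (\<Union>(\<U> - {U}))"
    using p(1) unfolding closed_partition_def by (intro closed_Union) auto
  moreover have "A \<subseteq> U \<union> \<Union>(\<U> - {U})" using assms(3) by auto
  moreover have "U \<inter> \<Union>(\<U> - {U}) \<inter> A = {}" using p(3) by auto
  ultimately have "U \<inter> A = {} \<or> \<Union>(\<U> - {U}) \<inter> A = {}"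
    using connected_closedD[OF assms(2)] p(2) by metis
  thus ?thesis using assms(3,5) by blast
qed

lemma closed_partition_connected_obtain:
  assumes "closed_partition \<U>" and "connected A" and "A \<subseteq> \<Union>\<U>" and "A \<noteq> {}"
  obtains U where "U \<in> \<U>" "A \<subseteq> U"
proof -
  obtain x U where "x \<in> A" "x \<in> U" "U \<in> \<U>" using assms(3,4) by blast
  thus ?thesis
    using closed_partition_connected_subset[OF assms(1-3), of U] that by blast
qed

lemma components_closed_partition:
  assumes "closed_partition \<U>"
  shows "components (\<Union>\<U>) = \<U>"
proof -
  have mem: "U \<in> components (\<Union>\<U>)" if "U \<in> \<U>" for U
    unfolding in_components_maximal
  proof (intro conjI allI impI)
    show "U \<noteq> {}" "U \<subseteq> \<Union>\<U>" "connected U"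
      using that assms by (auto simp: closed_partition_def)
    fix D assume D: "D \<noteq> {} \<and> U \<subseteq> D \<and> D \<subseteq> \<Union>\<U> \<and> connected D"
    have "U \<noteq> {}" using that assms by (auto simp: closed_partition_def)
    hence "D \<subseteq> U" using closed_partition_connected_subset[OF assms _ _ that, of D] D by blast
    thus "D = U" using D by blast
  qed
  moreover have "C \<in> \<U>" if "C \<in> components (\<Union>\<U>)" for C
  proof -
    note C = that
    obtain x where "x \<in> C" using in_components_nonempty[OF C] by blast
    then obtain U where "U \<in> \<U>" "x \<in> U" using in_components_subset[OF C] by blast
    hence "C = U" using components_eq[OF C mem[of U]] \<open>x \<in> C\<close> by blast
    thus ?thesis using \<open>U \<in> \<U>\<close> by simp
  qed
  ultimately show ?thesis by blast
qed

definition interior_of_arc :: "(real \<Rightarrow> 'a::topological_space) \<Rightarrow> 'a set" where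
  "interior_of_arc a = path_image a - {pathstart a, pathfinish a}"

lemma interior_of_arc_reversepath [simp]: "interior_of_arc (reversepath a) = interior_of_arc a"
  by (auto simp: interior_of_arc_def)

text \<open>An arc is homeomorphic to an interval, and connected subsets of an interval are convex.\<close>

lemma connected_subset_of_arc:
  fixes g :: "real \<Rightarrow> 'a::t2_space"
  assumes "arc g" and "connected A" and "A \<subseteq> path_image g"
    and "g x \<in> A" and "g y \<in> A" and "x \<in> {0..1}" and "y \<in> {0..1}"
  shows "g ` {x..y} \<subseteq> A"
proof -
  obtain h where h: "homeomorphism {0..1} (path_image g) g h"
    using homeomorphism_arc[OF assms(1)] by blast
  have "connected (h ` A)"
    by (rule connected_continuous_image[OF _ assms(2)])
      (use h assms(3) in \<open>auto simp: homeomorphism_def intro: continuous_on_subset\<close>)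
  moreover have "x \<in> h ` A" "y \<in> h ` A"
    using h assms(4-7) unfolding homeomorphism_def by (metis image_eqI)+
  ultimately have "{x..y} \<subseteq> h ` A" by (rule connected_contains_Icc)
  moreover have "g ` h ` A = A"
    using h assms(3) by (auto simp: homeomorphism_def image_image subset_iff)
  ultimately show ?thesis by blast
qed

lemma arc_minimal:
  fixes g :: "real \<Rightarrow> 'a::t2_space"
  assumes "arc g" and "connected A" and "A \<subseteq> path_image g"
    and "pathstart g \<in> A" and "pathfinish g \<in> A"
  shows "A = path_image g"
  using connected_subset_of_arc[OF assms(1-3), of 0 1] assms(3-5)
  by (auto simp: path_image_def pathstart_def pathfinish_def)

text \<open>The ends of \<open>a\<close> cut the curve into two arcs.  The interior of \<open>a\<close> is connected and avoids the
  ends, so it lies on one of the two arcs, and then it fills that arc.\<close>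

lemma closed_curve_minus_arc:
  fixes c :: "real \<Rightarrow> 'a::real_normed_vector"
  assumes "simple_path c" and "pathfinish c = pathstart c"
    and "arc a" and "path_image a \<subseteq> path_image c"
  obtains d where "arc d" "pathstart d = pathstart a" "pathfinish d = pathfinish a"
    "path_image d = path_image c - interior_of_arc a"
proof -
  define p q where "p = pathstart a" and "q = pathfinish a"
  have pq: "p \<in> path_image c" "q \<in> path_image c" "p \<noteq> q" "p \<in> path_image a" "q \<in> path_image a"
    using assms(3,4) arc_distinct_ends[OF assms(3)] by (auto simp: p_def q_def)
  obtain u d where ud: "arc u" "arc d" "pathstart u = p" "pathfinish u = q"
      "pathstart d = q" "pathfinish d = p"
      "path_image u \<inter> path_image d = {p, q}" "path_image u \<union> path_image d = path_image c"
    by (rule exists_double_arc[OF assms(1,2) pq(1-3)])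
  let ?I = "path_image a - {p, q}"
  have "connected ?I"
    using connected_simple_path_endless[OF arc_imp_simple_path[OF assms(3)]]
    by (simp add: p_def q_def)
  moreover have "path_image u \<inter> path_image d \<inter> ?I = {}" "?I \<subseteq> path_image u \<union> path_image d"
    using ud assms(4) by auto
  ultimately have alt: "path_image u \<inter> ?I = {} \<or> path_image d \<inter> ?I = {}"
    by (rule connected_closedD[OF _ _ _ closed_arc_image[OF ud(1)] closed_arc_image[OF ud(2)]])
  have pqud: "{p, q} \<subseteq> path_image u" "{p, q} \<subseteq> path_image d" using ud(7) by auto
  have sub: "path_image a - {p, q} \<subseteq> path_image u \<union> path_image d" using ud(8) assms(4) by auto
  have a: "connected (path_image a)" using assms(3) by (rule connected_arc_image)
  from alt show ?thesis
  proof
    assume "path_image u \<inter> ?I = {}"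
    hence "path_image a \<subseteq> path_image d" using sub pqud by blast
    hence "path_image a = path_image d"
      using arc_minimal[OF ud(2) a] pq ud by simp
    hence "path_image u = path_image c - interior_of_arc a"
      using ud by (auto simp: interior_of_arc_def p_def q_def)
    thus ?thesis using that[of u] ud by (simp add: p_def q_def)
  next
    assume "path_image d \<inter> ?I = {}"
    hence "path_image a \<subseteq> path_image u" using sub pqud by blast
    hence "path_image a = path_image u"
      using arc_minimal[OF ud(1) a] pq ud by simp
    hence "path_image d = path_image c - interior_of_arc a"
      using ud by (auto simp: interior_of_arc_def p_def q_def)
    thus ?thesis using that[of "reversepath d"] ud by (simp add: p_def q_def arc_reversepath)
  qed
qed

text \<open>Here \<open>a\<close> is the part of \<open>d\<close> between two parameters \<open>x < y\<close>, up to the orientation of \<open>a\<close>.\<close>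

lemma arc_minus_arc:
  fixes d :: "real \<Rightarrow> 'a::t2_space"
  assumes "arc d" and "arc a" and "path_image a \<subseteq> interior_of_arc d"
  obtains C D where "closed_partition {C, D}" "C \<noteq> D" "C \<union> D = path_image d - interior_of_arc a"
    "pathstart d \<in> C" "pathfinish d \<in> D"
    "pathstart a \<in> C \<and> pathfinish a \<in> D \<or> pathfinish a \<in> C \<and> pathstart a \<in> D"
proof -
  have inj: "inj_on d {0..1}" and cont: "continuous_on {0..1} d"
    using assms(1) by (auto simp: arc_def path_def)
  have main: "\<exists>C D. closed_partition {C, D} \<and> C \<noteq> D \<and> C \<union> D = path_image d - interior_of_arc b \<and>
      pathstart d \<in> C \<and> pathfinish d \<in> D \<and> pathstart b \<in> C \<and> pathfinish b \<in> D"
    if b: "arc b" "path_image b \<subseteq> interior_of_arc d" and xy: "x \<in> {0..1}" "y \<in> {0..1}"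
      "d x = pathstart b" "d y = pathfinish b" "x < y" for b x y
  proof -
    have bd: "path_image b \<subseteq> path_image d" using b(2) by (auto simp: interior_of_arc_def)
    have "d ` {x..y} \<subseteq> path_image b"
      by (rule connected_subset_of_arc[OF assms(1) connected_arc_image[OF b(1)] bd])
        (use xy in auto)
    moreover have "connected (d ` {x..y})"
      by (rule connected_continuous_image) (use xy cont in \<open>auto intro: continuous_on_subset\<close>)
    moreover have "pathstart b \<in> d ` {x..y}" "pathfinish b \<in> d ` {x..y}"
      unfolding xy(3,4)[symmetric] using xy(5) by auto
    ultimately have img: "path_image b = d ` {x..y}"
      using arc_minimal[OF b(1)] by metis
    have disj: "d ` I \<inter> d ` J = {}" if "I \<subseteq> {0..1}" "J \<subseteq> {0..1}" "I \<inter> J = {}" for I J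
      using inj_on_image_Int[OF inj that(1,2)] that(3) by simp
    have "d ` ({x..y} - {x, y}) = d ` {x..y} - d ` {x, y}"
      by (rule inj_on_image_set_diff[OF inj]) (use xy in auto)
    hence int: "interior_of_arc b = d ` ({x..y} - {x, y})"
      using xy by (simp add: interior_of_arc_def img)
    have "d ` ({0..1} - ({x..y} - {x, y})) = d ` {0..1} - d ` ({x..y} - {x, y})"
      by (rule inj_on_image_set_diff[OF inj]) (use xy in auto)
    hence "path_image d - interior_of_arc b = d ` ({0..1} - ({x..y} - {x, y}))"
      by (simp add: int path_image_def)
    also have "{0..1} - ({x..y} - {x, y}) = {0..x} \<union> {y..1}" using xy by auto
    finally have U: "d ` {0..x} \<union> d ` {y..1} = path_image d - interior_of_arc b"
      by (simp add: image_Un)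
    have d0: "d ` {0..x} \<inter> d ` {y..1} = {}" by (rule disj) (use xy in auto)
    have cl: "closed (d ` {u..v})" "connected (d ` {u..v})" if "0 \<le> u" "v \<le> 1" for u v
    proof -
      have c: "continuous_on {u..v} d" using that by (auto intro: continuous_on_subset[OF cont])
      show "closed (d ` {u..v})" "connected (d ` {u..v})"
        using c compact_continuous_image[OF c] connected_continuous_image[OF c]
        by (auto intro: compact_imp_closed)
    qed
    have ne: "d ` {0..x} \<noteq> {}" "d ` {y..1} \<noteq> {}" using xy by auto
    have "closed_partition {d ` {0..x}, d ` {y..1}}"
      using d0 cl[of 0 x] cl[of y 1] xy ne
      by (auto simp: closed_partition_def pairwise_insert disjnt_def)
    moreover have "d ` {0..x} \<noteq> d ` {y..1}" using d0 ne by auto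
    moreover have "pathstart d \<in> d ` {0..x}" "pathfinish d \<in> d ` {y..1}"
        "pathstart b \<in> d ` {0..x}" "pathfinish b \<in> d ` {y..1}"
      using xy unfolding pathstart_def pathfinish_def xy(3,4)[symmetric, unfolded pathstart_def pathfinish_def]
      by force+
    ultimately show ?thesis using U by blast
  qed
  have "pathstart a \<in> path_image d" "pathfinish a \<in> path_image d"
    using assms(3) unfolding interior_of_arc_def by auto
  then obtain x y where xy: "x \<in> {0..1}" "y \<in> {0..1}" "d x = pathstart a" "d y = pathfinish a"
    unfolding path_image_def by (metis imageE)
  have "x \<noteq> y" using xy arc_distinct_ends[OF assms(2)] by auto
  then consider "x < y" | "y < x" by linarith
  thus ?thesis
  proof cases
    case 1
    from main[OF assms(2,3) xy 1] show ?thesis using that by blast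
  next
    case 2
    from main[OF arc_reversepath[OF assms(2)] _ xy(2,1) _ _ 2] xy assms(3)
    have "\<exists>C D. closed_partition {C, D} \<and> C \<noteq> D \<and> C \<union> D = path_image d - interior_of_arc a \<and>
      pathstart d \<in> C \<and> pathfinish d \<in> D \<and> pathfinish a \<in> C \<and> pathstart a \<in> D" by simp
    thus ?thesis using that by blast
  qed
qed

text \<open>Removing two open arcs from a union of circles leaves a set whose four ends are joined in
  pairs: two arcs of one circle if the removed arcs lie on the same circle, and one arc of each of
  two circles otherwise.\<close>

lemma closed_curves_minus_two_arcs:
  fixes a b :: "real \<Rightarrow> 'a::real_normed_vector"
  assumes part: "closed_partition \<U>"
    and circ: "\<And>U. U \<in> \<U> \<Longrightarrow> \<exists>c. simple_path c \<and> pathfinish c = pathstart c \<and> path_image c = U"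
    and arcs: "arc a" "arc b" "path_image a \<inter> path_image b = {}"
    and sub: "path_image a \<subseteq> \<Union>\<U>" "path_image b \<subseteq> \<Union>\<U>"
  obtains \<X> C D where "closed_partition (insert C (insert D \<X>))" "C \<notin> insert D \<X>" "D \<notin> \<X>"
    "\<Union>\<U> - (interior_of_arc a \<union> interior_of_arc b) = C \<union> D \<union> \<Union>\<X>"
    "(pathstart a \<in> C \<and> pathfinish a \<in> C \<and> pathstart b \<in> D \<and> pathfinish b \<in> D) \<or>
     (pathstart a \<in> C \<and> pathstart b \<in> C \<and> pathfinish a \<in> D \<and> pathfinish b \<in> D) \<or>
     (pathstart a \<in> C \<and> pathfinish b \<in> C \<and> pathfinish a \<in> D \<and> pathstart b \<in> D)"
proof -
  obtain U where U: "U \<in> \<U>" "path_image a \<subseteq> U"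
    using closed_partition_connected_obtain[OF part connected_arc_image[OF arcs(1)] sub(1)]
      path_image_nonempty[of a] by metis
  obtain V where V: "V \<in> \<U>" "path_image b \<subseteq> V"
    using closed_partition_connected_obtain[OF part connected_arc_image[OF arcs(2)] sub(2)]
      path_image_nonempty[of b] by metis
  obtain c where c: "simple_path c" "pathfinish c = pathstart c" "path_image c = U"
    using circ[OF U(1)] by blast
  obtain d where d: "arc d" "pathstart d = pathstart a" "pathfinish d = pathfinish a"
      "path_image d = U - interior_of_arc a"
    using closed_curve_minus_arc[OF c(1,2) arcs(1)] U(2) c(3) by metis
  have ab: "interior_of_arc a \<subseteq> path_image a" "interior_of_arc b \<subseteq> path_image b"
    by (auto simp: interior_of_arc_def)
  have dprop: "closed (path_image d)" "connected (path_image d)"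
    "pathstart a \<in> path_image d" "pathfinish a \<in> path_image d"
    using closed_arc_image[OF d(1)] connected_arc_image[OF d(1)] pathstart_in_path_image[of d]
      pathfinish_in_path_image[of d]
    by (simp_all add: d(2,3))
  have disj: "X \<inter> Y = {}" if "X \<in> \<U>" "Y \<in> \<U>" "X \<noteq> Y" for X Y
    using part that by (auto simp: closed_partition_def pairwise_def disjnt_def)
  show ?thesis
  proof (cases "U = V")
    case True
    have "path_image b \<subseteq> interior_of_arc d"
      using V True arcs(3) ab pathstart_in_path_image[of a] pathfinish_in_path_image[of a]
      unfolding interior_of_arc_def[of d] d by blast
    then obtain C D where CD: "closed_partition {C, D}" "C \<noteq> D"
      "C \<union> D = path_image d - interior_of_arc b" "pathstart d \<in> C" "pathfinish d \<in> D"
      "pathstart b \<in> C \<and> pathfinish b \<in> D \<or> pathfinish b \<in> C \<and> pathstart b \<in> D"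
      using arc_minus_arc[OF d(1) arcs(2)] by metis
    let ?X = "\<U> - {U}"
    have X: "closed_partition ?X" by (rule closed_partition_subset[OF part]) auto
    have "C \<union> D \<subseteq> U" using CD(3) d(4) by auto
    moreover have "U \<inter> \<Union>?X = {}" using disj[OF U(1)] by auto
    ultimately have CX: "C \<inter> \<Union>?X = {}" "D \<inter> \<Union>?X = {}" by blast+
    have CD': "closed C" "connected C" "C \<noteq> {}" "closed D" "connected D" "D \<noteq> {}" "C \<inter> D = {}"
      using CD(1,2) by (auto simp: closed_partition_def pairwise_insert disjnt_def)
    have PD: "closed_partition (insert D ?X) \<and> D \<notin> ?X"
      using closed_partition_insert[of D ?X] X CD'(4-6) CX(2) by metis
    have "C \<inter> \<Union>(insert D ?X) = {}" using CX(1) CD'(7) by auto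
    hence "closed_partition (insert C (insert D ?X)) \<and> C \<notin> insert D ?X"
      using closed_partition_insert[of C "insert D ?X"] PD CD'(1-3) by metis
    hence P: "closed_partition (insert C (insert D ?X))" "C \<notin> insert D ?X" "D \<notin> ?X"
      using PD by blast+
    have UX: "\<Union>\<U> = U \<union> \<Union>?X" "U \<inter> \<Union>?X = {}" using U(1) disj by blast+
    have "U \<union> W - (P \<union> Q) = U - P - Q \<union> W" if "P \<subseteq> U" "Q \<subseteq> U" "U \<inter> W = {}" for P Q W
      using that by auto
    from this[OF _ _ UX(2), of "interior_of_arc a" "interior_of_arc b"]
    have "\<Union>\<U> - (interior_of_arc a \<union> interior_of_arc b) = C \<union> D \<union> \<Union>?X"
      unfolding CD(3) d(4) UX(1) using subset_trans[OF ab(1) U(2)]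
        subset_trans[OF ab(2) V(2)[folded True]] by metis
    thus ?thesis using that[OF P] CD d by auto
  next
    case False
    obtain c' where c': "simple_path c'" "pathfinish c' = pathstart c'" "path_image c' = V"
      using circ[OF V(1)] by blast
    obtain e where e: "arc e" "pathstart e = pathstart b" "pathfinish e = pathfinish b"
        "path_image e = V - interior_of_arc b"
      using closed_curve_minus_arc[OF c'(1,2) arcs(2)] V(2) c'(3) by metis
    have eprop: "closed (path_image e)" "connected (path_image e)"
      "pathstart b \<in> path_image e" "pathfinish b \<in> path_image e"
      using closed_arc_image[OF e(1)] connected_arc_image[OF e(1)] pathstart_in_path_image[of e]
      pathfinish_in_path_image[of e]
      by (simp_all add: e(2,3))
    let ?X = "\<U> - {U, V}"
    have X: "closed_partition ?X" by (rule closed_partition_subset[OF part]) auto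
    have UV: "U \<inter> V = {}" "U \<inter> \<Union>?X = {}" "V \<inter> \<Union>?X = {}" using disj U V False by blast+
    have "path_image e \<inter> \<Union>?X = {}" using UV(3) e(4) by auto
    hence PD: "closed_partition (insert (path_image e) ?X) \<and> path_image e \<notin> ?X"
      using closed_partition_insert[of "path_image e" ?X] X eprop(1,2) path_image_nonempty by metis
    have "path_image d \<inter> \<Union>(insert (path_image e) ?X) = {}" using UV(1,2) d(4) e(4) by auto
    hence P: "closed_partition (insert (path_image d) (insert (path_image e) ?X)) \<and>
        path_image d \<notin> insert (path_image e) ?X" "path_image e \<notin> ?X"
      using closed_partition_insert[of "path_image d" "insert (path_image e) ?X"] PD
        dprop(1,2) path_image_nonempty by metis+
    have UX: "\<Union>\<U> = U \<union> V \<union> \<Union>?X" using U(1) V(1) by blast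
    have "U \<union> V \<union> W - (P \<union> Q) = U - P \<union> (V - Q) \<union> W"
      if "P \<subseteq> U" "Q \<subseteq> V" "U \<inter> W = {}" "V \<inter> W = {}" for P Q W
      using that UV(1) by auto
    from this[OF _ _ UV(2,3), of "interior_of_arc a" "interior_of_arc b"]
    have "\<Union>\<U> - (interior_of_arc a \<union> interior_of_arc b) = path_image d \<union> path_image e \<union> \<Union>?X"
      unfolding e(4) d(4) UX using subset_trans[OF ab(1) U(2)]
        subset_trans[OF ab(2) V(2)] by metis
    thus ?thesis using that[of "path_image d" "path_image e" ?X] P dprop eprop by auto
  qed
qed

text \<open>\<open>C\<close> and \<open>D\<close> are the components of the exterior which contain the four ends, \<open>\<X>\<close> is the family of
  those which contain none.\<close>

lemma card_components_two_strands:
  assumes part: "closed_partition (insert C (insert D \<X>))" "C \<notin> insert D \<X>" "D \<notin> \<X>"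
    and AB: "closed A" "connected A" "closed B" "connected B" "A \<inter> B = {}"
    and ends: "A \<inter> (C \<union> D \<union> \<Union>\<X>) = {u, v}" "B \<inter> (C \<union> D \<union> \<Union>\<X>) = {u', v'}"
  shows "u \<in> C \<Longrightarrow> v \<in> C \<Longrightarrow> u' \<in> D \<Longrightarrow> v' \<in> D \<Longrightarrow>
      card (components (C \<union> D \<union> \<Union>\<X> \<union> A \<union> B)) = card \<X> + 2"
    and "u \<in> C \<Longrightarrow> v \<in> D \<Longrightarrow> u' \<in> C \<union> D \<Longrightarrow> v' \<in> C \<union> D \<Longrightarrow>
      card (components (C \<union> D \<union> \<Union>\<X> \<union> A \<union> B)) = card \<X> + 1"
proof -
  have CD: "closed_partition \<X>" "closed C" "connected C" "C \<noteq> {}" "C \<inter> \<Union>(insert D \<X>) = {}"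
     "closed D" "connected D" "D \<noteq> {}" "D \<inter> \<Union>\<X> = {}"
    using part closed_partition_insert[of C "insert D \<X>"] closed_partition_insert[of D \<X>] by auto
  have fin: "finite \<X>" using CD(1) by (simp add: closed_partition_def)
  have disj: "C \<inter> D = {}" "C \<inter> \<Union>\<X> = {}" using CD(5) by auto
  have A': "x = u \<or> x = v" if "x \<in> A" "x \<in> C \<union> D \<union> \<Union>\<X>" for x
    using ends(1) that by auto
  have B': "x = u' \<or> x = v'" if "x \<in> B" "x \<in> C \<union> D \<union> \<Union>\<X>" for x
    using ends(2) that by auto
  have un: "u \<in> A" "u' \<in> B" using ends by auto
  {
    assume uv: "u \<in> C" "v \<in> C" "u' \<in> D" "v' \<in> D"
    have conn: "connected (C \<union> A)" "connected (D \<union> B)"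
      using CD AB uv un by (auto intro!: connected_Un)
    have "A \<inter> D = {}" "A \<inter> \<Union>\<X> = {}"
      using A' uv(1,2) disj by blast+
    moreover have "B \<inter> C = {}" "B \<inter> \<Union>\<X> = {}"
      using B' uv(3,4) disj(1) CD(9) by blast+
    ultimately have "(C \<union> A) \<inter> \<Union>(insert (D \<union> B) \<X>) = {}" "(D \<union> B) \<inter> \<Union>\<X> = {}"
      using CD(5,9) AB(5) by (simp_all add: Int_Un_distrib Int_Un_distrib2 Int_commute)
    hence "closed_partition (insert (C \<union> A) (insert (D \<union> B) \<X>)) \<and>
        C \<union> A \<notin> insert (D \<union> B) \<X> \<and> D \<union> B \<notin> \<X>"
      using closed_partition_insert[of "C \<union> A" "insert (D \<union> B) \<X>"]
        closed_partition_insert[of "D \<union> B" \<X>] CD(1,4,8) closed_Un[OF CD(2) AB(1)]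
        closed_Un[OF CD(6) AB(3)] conn by blast
    moreover have "\<Union>(insert (C \<union> A) (insert (D \<union> B) \<X>)) = C \<union> D \<union> \<Union>\<X> \<union> A \<union> B" by auto
    ultimately show "card (components (C \<union> D \<union> \<Union>\<X> \<union> A \<union> B)) = card \<X> + 2"
      using components_closed_partition fin by (metis card_insert_disjoint finite_insert add_2_eq_Suc')
  next
    assume uv: "u \<in> C" "v \<in> D" "u' \<in> C \<union> D" "v' \<in> C \<union> D"
    have vA: "v \<in> A" using ends by auto
    have "connected (C \<union> A)" using CD AB uv un by (auto intro!: connected_Un)
    hence "connected (C \<union> A \<union> D)" using CD uv vA by (auto intro!: connected_Un)
    hence conn: "connected (C \<union> A \<union> D \<union> B)"
      by (rule connected_Un) (use AB uv un in auto)
    have "A \<inter> \<Union>\<X> = {}"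
      using A' uv(1,2) disj CD(9) by blast
    moreover have "B \<inter> \<Union>\<X> = {}"
      using B' uv(3,4) disj CD(9) by blast
    ultimately have "(C \<union> A \<union> D \<union> B) \<inter> \<Union>\<X> = {}"
      using disj CD(9) by (simp add: Int_Un_distrib2)
    hence "closed_partition (insert (C \<union> A \<union> D \<union> B) \<X>) \<and> C \<union> A \<union> D \<union> B \<notin> \<X>"
      using closed_partition_insert[of "C \<union> A \<union> D \<union> B" \<X>] CD(1,4)
        closed_Un[OF closed_Un[OF closed_Un[OF CD(2) AB(1)] CD(6)] AB(3)] conn by blast
    moreover have "\<Union>(insert (C \<union> A \<union> D \<union> B) \<X>) = C \<union> D \<union> \<Union>\<X> \<union> A \<union> B" by auto
    ultimately show "card (components (C \<union> D \<union> \<Union>\<X> \<union> A \<union> B)) = card \<X> + 1"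
      using components_closed_partition fin by (metis card_insert_disjoint Suc_eq_plus1)
  }
qed

text \<open>The exterior \<open>K\<close> joins the ends \<open>p, r, q, s\<close> in one of the three possible pairings, and each of
  the three tangles realises one pairing: the tangle with the same pairing as \<open>K\<close> closes up to two
  circles, the other two to one circle, and \<open>4 - 2 - 2 = 0\<close>.\<close>

lemma three_pairings_sum:
  fixes K :: "'a::topological_space set"
  assumes part: "closed_partition (insert C (insert D \<X>))" "C \<notin> insert D \<X>" "D \<notin> \<X>"
    and K: "K = C \<union> D \<union> \<Union>\<X>"
    and pairing: "(p \<in> C \<and> r \<in> C \<and> q \<in> D \<and> s \<in> D) \<or> (p \<in> C \<and> q \<in> C \<and> r \<in> D \<and> s \<in> D) \<or>
      (p \<in> C \<and> s \<in> C \<and> r \<in> D \<and> q \<in> D)"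
    and AB: "closed A" "connected A" "closed B" "connected B" "A \<inter> B = {}"
      "A \<inter> K = {p, r}" "B \<inter> K = {q, s}"
    and AB0: "closed A0" "connected A0" "closed B0" "connected B0" "A0 \<inter> B0 = {}"
      "A0 \<inter> K = {p, s}" "B0 \<inter> K = {q, r}"
    and AB1: "closed A1" "connected A1" "closed B1" "connected B1" "A1 \<inter> B1 = {}"
      "A1 \<inter> K = {p, q}" "B1 \<inter> K = {r, s}"
  shows "(- 2) ^ card (components (K \<union> A \<union> B)) + (- 2) ^ card (components (K \<union> A0 \<union> B0)) +
    (- 2) ^ card (components (K \<union> A1 \<union> B1)) = (0::int)"
proof -
  note c = card_components_two_strands[OF part AB[unfolded K]]
  note c0 = card_components_two_strands[OF part AB0[unfolded K]]
  note c1 = card_components_two_strands[OF part AB1[unfolded K]]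
  from pairing show ?thesis
  proof (elim disjE)
    assume "p \<in> C \<and> r \<in> C \<and> q \<in> D \<and> s \<in> D"
    thus ?thesis using c(1) c0(2) c1(2) by (simp add: K)
  next
    assume "p \<in> C \<and> q \<in> C \<and> r \<in> D \<and> s \<in> D"
    thus ?thesis using c(2) c0(2) c1(1) by (simp add: K)
  next
    assume "p \<in> C \<and> s \<in> C \<and> r \<in> D \<and> q \<in> D"
    thus ?thesis using c(2) c0(1) c1(2) by (simp add: K)
  qed
qed


section \<open>The Kauffman bracket at A = -1\<close>

lemma image_inverse_image: "(\<And>x. x \<in> C \<Longrightarrow> g (f x) = x) \<Longrightarrow> g ` f ` C = C"
  by (simp add: image_image)

lemma homeomorphism_component:
  assumes "homeomorphism S T f g" and "C \<in> components S"
  shows "f ` C \<in> components T"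
proof -
  have C: "C \<noteq> {}" "C \<subseteq> S" "connected C"
    and max: "\<And>D. D \<noteq> {} \<Longrightarrow> C \<subseteq> D \<Longrightarrow> D \<subseteq> S \<Longrightarrow> connected D \<Longrightarrow> D = C"
    using assms(2)[unfolded in_components_maximal] by simp_all
  have f: "continuous_on S f" "f ` S = T" "\<And>x. x \<in> S \<Longrightarrow> g (f x) = x"
    and g: "continuous_on T g" "g ` T = S" "\<And>y. y \<in> T \<Longrightarrow> f (g y) = y"
    using assms(1) by (auto simp: homeomorphism_def)
  show ?thesis unfolding in_components_maximal
  proof (intro conjI allI impI)
    show "f ` C \<noteq> {}" "f ` C \<subseteq> T" using C f(2) by auto
    show "connected (f ` C)"
      by (rule connected_continuous_image[OF continuous_on_subset[OF f(1) C(2)] C(3)])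
    fix D assume D: "D \<noteq> {} \<and> f ` C \<subseteq> D \<and> D \<subseteq> T \<and> connected D"
    have "connected (g ` D)"
      using D by (intro connected_continuous_image continuous_on_subset[OF g(1)]) auto
    moreover have "C \<subseteq> g ` D"
    proof
      fix x assume "x \<in> C"
      hence "f x \<in> D" "g (f x) = x" using D C(2) f(3) by auto
      thus "x \<in> g ` D" by (metis imageI)
    qed
    moreover have "g ` D \<subseteq> S" using D g(2) by auto
    ultimately have "g ` D = C" using max[of "g ` D"] D by simp
    moreover have "f ` g ` D = D" using D g(3) by (intro image_inverse_image) auto
    ultimately show "D = f ` C" by simp
  qed
qed

lemma homeomorphism_card_components:
  assumes "homeomorphism S T f g"
  shows "card (components S) = card (components T)"
proof (rule bij_betw_same_card)
  have inv: "\<And>x. x \<in> S \<Longrightarrow> g (f x) = x" "\<And>y. y \<in> T \<Longrightarrow> f (g y) = y"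
    using assms by (auto simp: homeomorphism_def)
  have gf: "g ` f ` C = C" if "C \<subseteq> S" for C
    using inv(1) that by (intro image_inverse_image) auto
  have fg: "f ` g ` C = C" if "C \<subseteq> T" for C
    using inv(2) that by (intro image_inverse_image) auto
  show "bij_betw ((`) f) (components S) (components T)"
    by (rule bij_betw_byWitness[where f' = "(`) g"])
      (auto simp: gf[OF in_components_subset] fg[OF in_components_subset]
        intro: homeomorphism_component[OF assms] homeomorphism_component[OF homeomorphism_symD[OF assms]])
qed

lemma immersion_to_core:
  assumes "immersion_to pr (\<beta> :: real \<times> real \<Rightarrow> 'm)"
  shows "immersion_to pr (\<lambda>t. \<beta> (t, 0))"
  unfolding immersion_to_def
proof
  fix t :: real
  obtain U g where U: "open U" "(t, 0) \<in> U" "smooth_on U g"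
    and g: "\<forall>y\<in>U. g y \<in> S3 \<and> \<beta> y = pr (g y)" and inj: "inj (frechet_derivative g (at (t, 0)))"
    using assms unfolding immersion_to_def by metis
  let ?U = "(\<lambda>t. (t, 0)) -` U"
  have o: "open ?U" using U(1) by (intro open_vimage) (auto intro: continuous_intros)
  have s: "smooth_on ?U (\<lambda>t. g (t, 0))"
    by (rule smooth_on_compose[OF U(3)]) (auto intro: smooth_intros)
  have "((\<lambda>t. (t, 0::real)) has_derivative (\<lambda>v. (v, 0))) (at t)"
    by (auto intro!: derivative_eq_intros)
  from diff_chain_at[OF this smooth_on_has_derivative[OF U(3,1,2)]]
  have "((\<lambda>t. g (t, 0)) has_derivative (\<lambda>v. frechet_derivative g (at (t, 0)) (v, 0))) (at t)"
    by (simp add: o_def)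
  hence "frechet_derivative (\<lambda>t. g (t, 0)) (at t) = (\<lambda>v. frechet_derivative g (at (t, 0)) (v, 0))"
    by (rule frechet_derivative_at[symmetric])
  moreover have "inj (\<lambda>v. frechet_derivative g (at (t, 0)) (v, 0))"
    using inj by (auto simp: inj_def)
  ultimately show "\<exists>U h. open U \<and> t \<in> U \<and> smooth_on U h \<and>
      (\<forall>y\<in>U. h y \<in> S3 \<and> \<beta> (y, 0) = pr (h y)) \<and> inj (frechet_derivative h (at t))"
    using o s g U(2) by (intro exI[of _ ?U] exI[of _ "\<lambda>t. g (t, 0)"]) auto
qed

lemma framed_links_core:
  fixes F :: "'m framed_link"
  assumes "F \<in> framed_links pr"
  shows "is_link pr (fst F)"
proof -
  obtain L B where F: "F = (L, B)" by (cases F)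
  obtain n and \<beta> :: "nat \<Rightarrow> real \<times> real \<Rightarrow> 'm" where *:
    "(\<forall>i<n. immersion_to pr (\<beta> i)) \<and>
     (\<forall>i<n. \<forall>j<n. \<forall>t s t' s'. \<beta> i (t, s) = \<beta> j (t', s') \<longleftrightarrow> i = j \<and> t - t' \<in> \<int> \<and> s = s') \<and>
     L = (\<Union>i<n. \<beta> i ` (UNIV \<times> {0})) \<and> B = (\<Union>i<n. \<beta> i ` (UNIV \<times> {-1..1}))"
    using assms unfolding framed_links_def F mem_Collect_eq prod.case by (elim exE) (rule that)
  have "immersion_to pr (\<lambda>t. \<beta> i (t, 0))" if "i < n" for i
    by (rule immersion_to_core) (use * that in simp)
  moreover have "range (\<lambda>t. \<beta> i (t, 0)) = \<beta> i ` (UNIV \<times> {0})" for i by auto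
  ultimately show ?thesis unfolding is_link_def F fst_conv
    using * by (intro exI[of _ n] exI[of _ "\<lambda>i t. \<beta> i (t, 0)"]) simp
qed

text \<open>
  Type \<open>'m\<close> carries no topology.  Continuous functions \<open>E\<close> on the sphere which separate exactly
  the fibres of the covering embed the manifold into a Euclidean space, where components can be
  counted.
\<close>

locale euclidean_quotient =
  fixes pr :: "complex \<times> complex \<Rightarrow> 'm" and E :: "complex \<times> complex \<Rightarrow> 'e::euclidean_space"
  assumes continuous_E: "continuous_on S3 E"
    and separates: "\<And>x y. x \<in> S3 \<Longrightarrow> y \<in> S3 \<Longrightarrow> E x = E y \<longleftrightarrow> pr x = pr y"
begin

definition model :: "'m \<Rightarrow> 'e" where
  "model m = E (inv_into S3 pr m)"

definition number_of_components :: "'m set \<Rightarrow> nat" where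
  "number_of_components L = card (components (model ` L))"

lemma model_pr: "x \<in> S3 \<Longrightarrow> model (pr x) = E x"
  unfolding model_def by (metis f_inv_into_f image_eqI inv_into_into separates)

lemma inj_on_model: "inj_on model (manifold pr)"
  by (auto simp: inj_on_def manifold_def model_pr separates)

lemma model_manifold: "model ` manifold pr = E ` S3"
  by (force simp: manifold_def model_pr image_image)

lemma smooth_to_continuous_on:
  assumes "smooth_to pr S f"
  shows "continuous_on S (\<lambda>x. model (f x))"
  unfolding continuous_on_eq_continuous_within
proof
  fix x assume x: "x \<in> S"
  obtain U g where U: "open U" "x \<in> U" "smooth_on (S \<inter> U) g"
    and g: "\<And>y. y \<in> S \<inter> U \<Longrightarrow> g y \<in> S3 \<and> f y = pr (g y)"
    using assms x unfolding smooth_to_def by meson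
  have "continuous_on (S \<inter> U) (\<lambda>y. E (g y))"
    by (rule continuous_on_compose2[OF continuous_E smooth_on_imp_continuous_on[OF U(3)]])
      (use g in auto)
  hence "continuous_on (S \<inter> U) (\<lambda>y. model (f y))"
    by (rule continuous_on_eq) (use g model_pr in metis)
  hence "continuous (at x within S \<inter> U) (\<lambda>y. model (f y))"
    using x U(2) by (simp add: continuous_on_eq_continuous_within)
  moreover have "at x within S \<inter> U = at x within S"
    by (rule at_within_nhd[OF U(2,1)]) auto
  ultimately show "continuous (at x within S) (\<lambda>y. model (f y))" by simp
qed

text \<open>As the sphere is compact, \<open>E\<close> is a quotient map onto the model.\<close>

lemma continuous_on_model:
  assumes "continuous_on S3 (\<lambda>x. k (E x))"
  shows "continuous_on (E ` S3) (k :: 'e \<Rightarrow> 'f::t2_space)"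
proof -
  have S3: "compact S3" by (simp add: S3_def)
  have "closed (k -` B \<inter> E ` S3)" if B: "closed B" for B
  proof -
    have "closed ((\<lambda>x. k (E x)) -` B \<inter> S3)"
      using continuous_on_closed_vimage[OF compact_imp_closed[OF S3]] assms B by blast
    hence "compact ((\<lambda>x. k (E x)) -` B \<inter> S3)"
      by (metis S3 compact_Int_closed inf.right_idem inf_commute)
    hence "compact (E ` ((\<lambda>x. k (E x)) -` B \<inter> S3))"
      by (rule compact_continuous_image[rotated])
        (auto intro: continuous_on_subset[OF continuous_E])
    moreover have "E ` ((\<lambda>x. k (E x)) -` B \<inter> S3) = k -` B \<inter> E ` S3" by auto
    ultimately show ?thesis using compact_imp_closed by metis
  qed
  thus ?thesis
    using continuous_on_closed_vimage[of "E ` S3" k]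
      compact_imp_closed[OF compact_continuous_image[OF continuous_E S3]] by blast
qed

text \<open>Diffeomorphisms become homeomorphisms of the model: conjugating \<open>h\<close> by \<open>model\<close> gives a map whose
  composition with \<open>E\<close> is the continuous map \<open>model \<circ> h \<circ> pr\<close>.\<close>

lemma diffeo_homeomorphism:
  assumes "diffeo pr h"
  obtains f g where "homeomorphism (E ` S3) (E ` S3) f g"
    "\<And>m. m \<in> manifold pr \<Longrightarrow> f (model m) = model (h m)"
proof -
  let ?M = "manifold pr"
  define conj where "conj h' y = model (h' (inv_into ?M model y))" for h' y
  have conj: "conj h' (model m) = model (h' m)" if "m \<in> ?M" for h' m
    unfolding conj_def using that by (simp add: inv_into_f_f[OF inj_on_model])
  let ?k = "inv_into ?M h"
  have b: "bij_betw h ?M ?M" using assms by (rule diffeo_bij)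
  have hM: "h m \<in> ?M" "?k m \<in> ?M" "?k (h m) = m" "h (?k m) = m" if "m \<in> ?M" for m
    using b that by (auto simp: bij_betw_def f_inv_into_f inv_into_into)
  have pM: "pr x \<in> ?M" if "x \<in> S3" for x using that by (auto simp: manifold_def)
  have cont: "continuous_on (E ` S3) (conj h')" if "smooth_to pr S3 (\<lambda>x. h' (pr x))" for h'
  proof (rule continuous_on_model)
    show "continuous_on S3 (\<lambda>x. conj h' (E x))"
      by (rule continuous_on_eq[OF smooth_to_continuous_on[OF that]])
        (use conj[OF pM] model_pr in metis)
  qed
  have "homeomorphism (model ` ?M) (model ` ?M) (conj h) (conj ?k)"
  proof (rule homeomorphismI)
    show "continuous_on (model ` ?M) (conj h)" "continuous_on (model ` ?M) (conj ?k)"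
      unfolding model_manifold using assms by (auto simp: diffeo_def intro: cont)
  qed (auto simp: conj hM)
  thus ?thesis using that conj unfolding model_manifold by blast
qed

lemma number_of_components_diffeo:
  assumes "diffeo pr h" and "L \<subseteq> manifold pr"
  shows "number_of_components (h ` L) = number_of_components L"
proof -
  obtain f g where fg: "homeomorphism (E ` S3) (E ` S3) f g"
    and f: "\<And>m. m \<in> manifold pr \<Longrightarrow> f (model m) = model (h m)"
    using diffeo_homeomorphism[OF assms(1)] by blast
  have "f ` model ` L = model ` h ` L" using f assms(2) by (force simp: image_image)
  hence "homeomorphism (model ` L) (model ` h ` L) f g"
    using homeomorphism_of_subsets[OF fg, of "model ` L" "model ` h ` L"] assms(2)
      model_manifold diffeo_bij[OF assms(1)] by (metis (no_types) image_mono bij_betw_def)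
  thus ?thesis
    unfolding number_of_components_def using homeomorphism_card_components by metis
qed

lemma number_of_components_isotopy:
  assumes "ambient_isotopy pr H" and "L \<subseteq> manifold pr"
  shows "number_of_components (H 1 ` L) = number_of_components L"
  using assms number_of_components_diffeo[of "H 1"] by (auto simp: ambient_isotopy_def)

lemma immersion_continuous:
  assumes "immersion_to pr f"
  shows "continuous_on UNIV (\<lambda>x. model (f x))" "f x \<in> manifold pr"
proof -
  have "smooth_to pr UNIV f" using assms unfolding immersion_to_def smooth_to_def
    by (metis Int_UNIV_left)
  thus "continuous_on UNIV (\<lambda>x. model (f x))" by (rule smooth_to_continuous_on)
  show "f x \<in> manifold pr" using assms unfolding immersion_to_def manifold_def by blast
qed

lemma circles_closed_partition:
  fixes \<gamma> :: "nat \<Rightarrow> real \<Rightarrow> 'm"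
  assumes imm: "\<And>i. i < n \<Longrightarrow> immersion_to pr (\<gamma> i)"
    and inj: "\<And>i j t t'. i < n \<Longrightarrow> j < n \<Longrightarrow> \<gamma> i t = \<gamma> j t' \<longleftrightarrow> i = j \<and> t - t' \<in> \<int>"
  defines "\<C> \<equiv> (\<lambda>i. model ` range (\<gamma> i)) ` {..<n}"
  shows "closed_partition \<C>" and "card \<C> = n"
    and "\<And>U. U \<in> \<C> \<Longrightarrow> \<exists>c. simple_path c \<and> pathfinish c = pathstart c \<and> path_image c = U"
proof -
  define c where "c i t = model (\<gamma> i t)" for i t
  have cinj: "c i t = c j t' \<longleftrightarrow> i = j \<and> t - t' \<in> \<int>" if "i < n" "j < n" for i j t t'
    using that inj_onD[OF inj_on_model, of "\<gamma> i t" "\<gamma> j t'"] immersion_continuous(2)[OF imm] inj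
    unfolding c_def by metis
  have cont: "continuous_on S (c i)" if "i < n" for S i
    using immersion_continuous(1)[OF imm[OF that]] continuous_on_subset unfolding c_def by blast
  have img: "path_image (c i) = model ` range (\<gamma> i)" if "i < n" for i
  proof -
    have "c i t \<in> path_image (c i)" for t
    proof -
      have "c i t = c i (frac t)" using cinj[OF that that] by (simp add: frac_def)
      moreover have "frac t \<in> {0..1}" by (simp add: frac_lt_1 less_imp_le)
      ultimately show ?thesis by (simp add: path_image_def)
    qed
    thus ?thesis by (auto simp: path_image_def c_def)
  qed
  have loop: "simple_path (c i)" "pathfinish (c i) = pathstart (c i)" if i: "i < n" for i
  proof -
    show "pathfinish (c i) = pathstart (c i)"
      using cinj[OF i i] by (simp add: pathfinish_def pathstart_def)
    show "simple_path (c i)"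
    proof
      show "path (c i)" using cont[OF i] by (simp add: path_def)
      fix x y :: real assume xy: "0 \<le> x" "x < y" "y \<le> 1" "c i x = c i y"
      hence "x - y \<in> \<int>" using cinj[OF i i] by blast
      then obtain k :: int where k: "x - y = of_int k" by (elim Ints_cases)
      have "- 1 \<le> x - y" "x - y < 0" using xy by auto
      hence "k = - 1" unfolding k by linarith
      hence "x - y = - 1" using k by simp
      thus "x = 0 \<and> y = 1" using xy by linarith
    qed
  qed
  have disj: "path_image (c i) \<inter> path_image (c j) = {}" if "i < n" "j < n" "i \<noteq> j" for i j
    using that cinj[of i j] by (auto simp: path_image_def)
  have C: "\<C> = (\<lambda>i. path_image (c i)) ` {..<n}" unfolding \<C>_def using img by auto
  show "closed_partition \<C>"
    unfolding closed_partition_def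
  proof (intro conjI ballI)
    show "finite \<C>" by (simp add: C)
    show "pairwise disjnt \<C>"
      unfolding pairwise_def C disjnt_def using disj by blast
    fix U assume "U \<in> \<C>"
    then obtain i where i: "i < n" "U = path_image (c i)" by (auto simp: C)
    thus "closed U" "connected U" "U \<noteq> {}"
      using simple_path_imp_path[OF loop(1)[OF i(1)]]
      by (auto simp: closed_path_image connected_path_image)
  qed
  have "inj_on (\<lambda>i. path_image (c i)) {..<n}"
    unfolding inj_on_def using disj path_image_nonempty by (metis Int_absorb lessThan_iff)
  thus "card \<C> = n" by (simp add: C card_image)
  show "\<exists>c. simple_path c \<and> pathfinish c = pathstart c \<and> path_image c = U" if "U \<in> \<C>" for U
    using that loop unfolding C by blast
qed

lemma number_of_components_link:
  fixes \<gamma> :: "nat \<Rightarrow> real \<Rightarrow> 'm"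
  assumes imm: "\<And>i. i < n \<Longrightarrow> immersion_to pr (\<gamma> i)"
    and inj: "\<And>i j t t'. i < n \<Longrightarrow> j < n \<Longrightarrow> \<gamma> i t = \<gamma> j t' \<longleftrightarrow> i = j \<and> t - t' \<in> \<int>"
  shows "number_of_components (\<Union>i<n. range (\<gamma> i)) = n"
proof -
  have "model ` (\<Union>i<n. range (\<gamma> i)) = \<Union>((\<lambda>i. model ` range (\<gamma> i)) ` {..<n})" by auto
  thus ?thesis
    unfolding number_of_components_def
    using components_closed_partition circles_closed_partition[OF imm inj] by metis
qed

lemma link_circles:
  assumes "is_link pr L"
  obtains \<U> where "closed_partition \<U>" "\<Union>\<U> = model ` L"
    "\<And>U. U \<in> \<U> \<Longrightarrow> \<exists>c. simple_path c \<and> pathfinish c = pathstart c \<and> path_image c = U"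
proof -
  obtain n and \<gamma> :: "nat \<Rightarrow> real \<Rightarrow> 'm" where *:
    "(\<forall>i<n. immersion_to pr (\<gamma> i)) \<and>
     (\<forall>i<n. \<forall>j<n. \<forall>t t'. \<gamma> i t = \<gamma> j t' \<longleftrightarrow> i = j \<and> t - t' \<in> \<int>) \<and>
     L = (\<Union>i<n. range (\<gamma> i))"
    using assms unfolding is_link_def by (elim exE) (rule that)
  have imm: "\<And>i. i < n \<Longrightarrow> immersion_to pr (\<gamma> i)"
    and inj: "\<And>i j t t'. i < n \<Longrightarrow> j < n \<Longrightarrow> \<gamma> i t = \<gamma> j t' \<longleftrightarrow> i = j \<and> t - t' \<in> \<int>"
    and L: "L = (\<Union>i<n. range (\<gamma> i))"
    using * by simp_all
  have "\<Union>((\<lambda>i. model ` range (\<gamma> i)) ` {..<n}) = model ` L" unfolding L by auto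
  thus ?thesis
    using that[OF circles_closed_partition(1)[OF imm inj]] circles_closed_partition(3)[OF imm inj]
    by metis
qed

lemma chart_continuous:
  assumes "oriented_chart pr \<phi>"
  shows "continuous_on cube (\<lambda>x. model (\<phi> x))" "inj_on (\<lambda>x. model (\<phi> x)) cube"
    "\<phi> ` cube \<subseteq> manifold pr"
proof -
  have loc: "\<exists>U g. open U \<and> x \<in> U \<and> U \<subseteq> cube \<and> smooth_on U g \<and>
      (\<forall>y\<in>U. g y \<in> S3 \<and> \<phi> y = pr (g y))" if "x \<in> cube" for x
    using assms that unfolding oriented_chart_def by metis
  have "smooth_to pr cube \<phi>" unfolding smooth_to_def
    using loc by (metis inf.absorb2)
  thus "continuous_on cube (\<lambda>x. model (\<phi> x))" by (rule smooth_to_continuous_on)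
  show M: "\<phi> ` cube \<subseteq> manifold pr"
  proof
    fix m assume "m \<in> \<phi> ` cube"
    then obtain x where "x \<in> cube" "m = \<phi> x" by blast
    thus "m \<in> manifold pr" using loc[of x] unfolding manifold_def by blast
  qed
  have "inj_on \<phi> cube" using assms by (simp add: oriented_chart_def)
  thus "inj_on (\<lambda>x. model (\<phi> x)) cube"
    using comp_inj_on[of \<phi> cube model] inj_on_subset[OF inj_on_model M] by (simp add: o_def)
qed


text \<open>The three links of a skein triple agree in \<open>K\<close>, the exterior of the chart together with the
  parts of the diagonals outside of the square \<open>\<bar>x\<bar>, \<bar>y\<bar> < 1/2\<close>.\<close>

lemma skein_triple_components:
  assumes "skein_triple pr F F0 Finf" and "is_link pr (fst F)"
  shows "(- 2) ^ number_of_components (fst F) + (- 2) ^ number_of_components (fst F0) +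
    (- 2) ^ number_of_components (fst Finf) = (0::int)"
proof -
  obtain \<phi> \<eta> \<sigma> where chart: "oriented_chart pr \<phi>" and \<eta>: "bump \<eta>" and \<sigma>: "smoothed_abs \<sigma>"
    and out: "agree_outside \<phi> F F0" "agree_outside \<phi> F Finf"
    and look: "looks_like \<phi> F (crossing \<eta>)" "looks_like \<phi> F0 (resolution_0 \<sigma>)"
      "looks_like \<phi> Finf (resolution_inf \<sigma>)"
    using assms(1) unfolding skein_triple_def by metis
  define \<Phi> where "\<Phi> x = model (\<phi> x)" for x
  note \<Phi> = chart_continuous(1,2)[OF chart, folded \<Phi>_def]
  define Kout where "Kout = fst F - \<phi> ` cube"
  define I where "I = {- 1 / 2..1 / 2::real}"
  define Q where "Q = cube \<inter> {(c, h::real). \<bar>Re c\<bar> = \<bar>Im c\<bar> \<and> 1 / 2 \<le> \<bar>Re c\<bar> \<and> h = 0}"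
  define K where "K = model ` Kout \<union> \<Phi> ` Q"
  define p q r s where "p = \<Phi> (Complex (- 1 / 2) (- 1 / 2), 0)" and "q = \<Phi> (Complex (- 1 / 2) (1 / 2), 0)"
    and "r = \<Phi> (Complex (1 / 2) (1 / 2), 0)" and "s = \<Phi> (Complex (1 / 2) (- 1 / 2), 0)"
  define a where "a u = (Complex u u, \<eta> u)" for u
  define b where "b u = (Complex u (- u), 0::real)" for u
  define a0 where "a0 u = (Complex u (- \<sigma> u), 0::real)" for u
  define b0 where "b0 u = (Complex u (\<sigma> u), 0::real)" for u
  define a1 where "a1 u = (Complex (- \<sigma> u) u, 0::real)" for u
  define b1 where "b1 u = (Complex (\<sigma> u) u, 0::real)" for u
  note defs = a_def b_def a0_def b0_def a1_def b1_def
  have \<eta>': "0 \<le> \<eta> u" "\<eta> u \<le> 1 / 2" "\<bar>u\<bar> \<le> 1 / 4 \<Longrightarrow> 0 < \<eta> u" "1 / 2 \<le> \<bar>u\<bar> \<Longrightarrow> \<eta> u = 0"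
    "continuous_on S \<eta>" for u S
    using \<eta> smooth_on_imp_continuous_on[OF smooth_on_UNIV_imp] unfolding bump_def by auto
  have \<sigma>': "1 / 2 \<le> \<bar>u\<bar> \<Longrightarrow> \<sigma> u = \<bar>u\<bar>" "\<bar>u\<bar> \<le> 1 / 2 \<Longrightarrow> 1 / 4 \<le> \<sigma> u"
    "\<bar>u\<bar> \<le> 1 / 2 \<Longrightarrow> \<sigma> u \<le> 1 / 2" "continuous_on S \<sigma>" for u S
    using \<sigma> smooth_on_imp_continuous_on[OF smooth_on_UNIV_imp] unfolding smoothed_abs_def by auto
  have I: "u \<in> I \<longleftrightarrow> \<bar>u\<bar> \<le> 1 / 2" for u unfolding I_def by auto
  have cube: "a ` I \<subseteq> cube" "b ` I \<subseteq> cube" "a0 ` I \<subseteq> cube" "b0 ` I \<subseteq> cube" "a1 ` I \<subseteq> cube" "b1 ` I \<subseteq> cube"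
    "Q \<subseteq> cube"
  proof -
    have "\<bar>\<eta> u\<bar> < 1 \<and> \<bar>\<sigma> u\<bar> < 1" if "u \<in> I" for u
      using \<eta>'(1,2)[of u] \<sigma>'(2,3)[of u] that I[of u] by linarith
    thus "a ` I \<subseteq> cube" "b ` I \<subseteq> cube" "a0 ` I \<subseteq> cube" "b0 ` I \<subseteq> cube" "a1 ` I \<subseteq> cube" "b1 ` I \<subseteq> cube"
      by (auto simp: defs cube_def I)
  qed (simp add: Q_def)
  have mem: "(c, h) \<in> a ` I \<longleftrightarrow> \<bar>Re c\<bar> \<le> 1 / 2 \<and> Im c = Re c \<and> h = \<eta> (Re c)"
    "(c, h) \<in> b ` I \<longleftrightarrow> \<bar>Re c\<bar> \<le> 1 / 2 \<and> Im c = - Re c \<and> h = 0"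
    "(c, h) \<in> a0 ` I \<longleftrightarrow> \<bar>Re c\<bar> \<le> 1 / 2 \<and> Im c = - \<sigma> (Re c) \<and> h = 0"
    "(c, h) \<in> b0 ` I \<longleftrightarrow> \<bar>Re c\<bar> \<le> 1 / 2 \<and> Im c = \<sigma> (Re c) \<and> h = 0"
    "(c, h) \<in> a1 ` I \<longleftrightarrow> \<bar>Im c\<bar> \<le> 1 / 2 \<and> Re c = - \<sigma> (Im c) \<and> h = 0"
    "(c, h) \<in> b1 ` I \<longleftrightarrow> \<bar>Im c\<bar> \<le> 1 / 2 \<and> Re c = \<sigma> (Im c) \<and> h = 0" for c h
    by (auto simp: image_iff defs I complex_eq_iff)
  have memQ: "(c, h) \<in> Q \<longleftrightarrow> \<bar>Re c\<bar> < 1 \<and> \<bar>Re c\<bar> = \<bar>Im c\<bar> \<and> 1 / 2 \<le> \<bar>Re c\<bar> \<and> h = 0" for c h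
    by (auto simp: Q_def cube_def)
  have memc: "(c, h) \<in> cube \<longleftrightarrow> \<bar>Re c\<bar> < 1 \<and> \<bar>Im c\<bar> < 1 \<and> \<bar>h\<bar> < 1" for c h
    by (auto simp: cube_def)
  have cont: "continuous_on I a" "continuous_on I b" "continuous_on I a0" "continuous_on I b0"
    "continuous_on I a1" "continuous_on I b1"
    unfolding defs Complex_eq by (intro continuous_intros \<eta>' \<sigma>')+
  have img: "closed (\<Phi> ` f ` I)" "connected (\<Phi> ` f ` I)"
    if "continuous_on I f" "f ` I \<subseteq> cube" for f
  proof -
    have c: "continuous_on (f ` I) \<Phi>" by (rule continuous_on_subset[OF \<Phi>(1) that(2)])
    have f: "compact (f ` I)" "connected (f ` I)"
      unfolding I_def
      by (intro compact_continuous_image connected_continuous_image that(1)[unfolded I_def]; simp)+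
    show "closed (\<Phi> ` f ` I)" "connected (\<Phi> ` f ` I)"
      using compact_continuous_image[OF c f(1)] connected_continuous_image[OF c f(2)]
      by (auto intro: compact_imp_closed)
  qed
  note imgs = img[OF cont(1) cube(1)] img[OF cont(2) cube(2)] img[OF cont(3) cube(3)]
    img[OF cont(4) cube(4)] img[OF cont(5) cube(5)] img[OF cont(6) cube(6)]
  have link: "fst F \<subseteq> manifold pr" using is_link_subset_manifold[OF assms(2)] .
  have outside: "model ` Kout \<inter> \<Phi> ` cube = {}"
  proof -
    have "model ` Kout \<inter> model ` (\<phi> ` cube) = model ` (Kout \<inter> \<phi> ` cube)"
      by (rule inj_on_image_Int[OF inj_on_model, symmetric])
        (use link chart_continuous(3)[OF chart] in \<open>auto simp: Kout_def\<close>)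
    thus ?thesis by (auto simp: \<Phi>_def Kout_def image_image)
  qed
  have \<Phi>Int: "\<Phi> ` A \<inter> \<Phi> ` B = \<Phi> ` (A \<inter> B)" if "A \<subseteq> cube" "B \<subseteq> cube" for A B
    using inj_on_image_Int[OF \<Phi>(2) that] by simp
  have KInt: "\<Phi> ` A \<inter> K = \<Phi> ` (A \<inter> Q)" if "A \<subseteq> cube" for A
  proof -
    have "\<Phi> ` A \<inter> model ` Kout = {}" using outside image_mono[OF that, of \<Phi>] by blast
    thus ?thesis unfolding K_def by (simp add: Int_Un_distrib \<Phi>Int[OF that cube(7)])
  qed
  have decomp: "model ` fst G = K \<union> \<Phi> ` A \<union> \<Phi> ` B"
    if "agree_outside \<phi> F G" "looks_like \<phi> G T" "cube \<inter> T 0 = Q \<union> A \<union> B" for G T A B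
  proof -
    have "fst G - \<phi> ` cube = Kout" "fst G \<inter> \<phi> ` cube = \<phi> ` (Q \<union> A \<union> B)"
      using that unfolding agree_outside_def looks_like_def Kout_def by simp_all
    moreover have "fst G = (fst G - \<phi> ` cube) \<union> (fst G \<inter> \<phi> ` cube)" by auto
    ultimately have "fst G = Kout \<union> \<phi> ` (Q \<union> A \<union> B)" by simp
    thus ?thesis by (auto simp: K_def \<Phi>_def)
  qed
  have tangle: "cube \<inter> crossing \<eta> 0 = Q \<union> a ` I \<union> b ` I"
  proof (rule set_eqI, clarify)
    fix c h
    show "(c, h) \<in> cube \<inter> crossing \<eta> 0 \<longleftrightarrow> (c, h) \<in> Q \<union> a ` I \<union> b ` I"
      unfolding Un_iff Int_iff mem memQ memc crossing_def mem_Collect_eq prod.case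
      using \<eta>'(1,2,4)[of "Re c"] by (cases "1 / 2 \<le> \<bar>Re c\<bar>"; cases "h = 0") (auto simp: abs_if split: if_splits)
  qed
  have tangle0: "cube \<inter> resolution_inf \<sigma> 0 = Q \<union> a0 ` I \<union> b0 ` I"
  proof (rule set_eqI, clarify)
    fix c h
    show "(c, h) \<in> cube \<inter> resolution_inf \<sigma> 0 \<longleftrightarrow> (c, h) \<in> Q \<union> a0 ` I \<union> b0 ` I"
      unfolding Un_iff Int_iff mem memQ memc resolution_inf_def mem_Collect_eq prod.case
      using \<sigma>'(1-3)[of "Re c"]
      by (cases "1 / 2 \<le> \<bar>Re c\<bar>"; cases "h = 0") (auto simp: abs_if split: if_splits)
  qed
  have tangle1: "cube \<inter> resolution_0 \<sigma> 0 = Q \<union> a1 ` I \<union> b1 ` I"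
  proof (rule set_eqI, clarify)
    fix c h
    show "(c, h) \<in> cube \<inter> resolution_0 \<sigma> 0 \<longleftrightarrow> (c, h) \<in> Q \<union> a1 ` I \<union> b1 ` I"
      unfolding Un_iff Int_iff mem memQ memc resolution_0_def mem_Collect_eq prod.case
      using \<sigma>'(1-3)[of "Im c"]
      by (cases "1 / 2 \<le> \<bar>Im c\<bar>"; cases "h = 0") (auto simp: abs_if split: if_splits)
  qed
  have ends: "a ` I \<inter> Q = {a (- 1 / 2), a (1 / 2)}" "b ` I \<inter> Q = {b (- 1 / 2), b (1 / 2)}"
    "a0 ` I \<inter> Q = {a0 (- 1 / 2), a0 (1 / 2)}" "b0 ` I \<inter> Q = {b0 (- 1 / 2), b0 (1 / 2)}"
    "a1 ` I \<inter> Q = {a1 (- 1 / 2), a1 (1 / 2)}" "b1 ` I \<inter> Q = {b1 (- 1 / 2), b1 (1 / 2)}"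
  proof -
    have half: "u \<in> I \<and> 1 / 2 \<le> \<bar>u\<bar> \<longleftrightarrow> u = - 1 / 2 \<or> u = 1 / 2" for u by (auto simp: I)
    have "f ` I \<inter> Q = {f (- 1 / 2), f (1 / 2)}"
      if "\<And>u. u \<in> I \<Longrightarrow> f u \<in> Q \<longleftrightarrow> 1 / 2 \<le> \<bar>u\<bar>" for f :: "real \<Rightarrow> complex \<times> real"
    proof -
      have "{u \<in> I. 1 / 2 \<le> \<bar>u\<bar>} = {- 1 / 2, 1 / 2}" using half by blast
      hence "f ` {u \<in> I. 1 / 2 \<le> \<bar>u\<bar>} = {f (- 1 / 2), f (1 / 2)}" by simp
      moreover have "f ` I \<inter> Q = f ` {u \<in> I. 1 / 2 \<le> \<bar>u\<bar>}" using that by blast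
      ultimately show ?thesis by simp
    qed
    note * = this
    show "a ` I \<inter> Q = {a (- 1 / 2), a (1 / 2)}" "b ` I \<inter> Q = {b (- 1 / 2), b (1 / 2)}"
      by (rule *; use \<eta>'(4) in \<open>auto simp: defs memQ I\<close>)+
    have "\<bar>\<sigma> u\<bar> = \<bar>u\<bar> \<and> 1 / 2 \<le> \<bar>\<sigma> u\<bar> \<and> \<bar>\<sigma> u\<bar> < 1 \<longleftrightarrow> 1 / 2 \<le> \<bar>u\<bar>" if "u \<in> I" for u
      using \<sigma>'(1-3)[of u] that[unfolded I] by auto
    thus "a0 ` I \<inter> Q = {a0 (- 1 / 2), a0 (1 / 2)}" "b0 ` I \<inter> Q = {b0 (- 1 / 2), b0 (1 / 2)}"
      "a1 ` I \<inter> Q = {a1 (- 1 / 2), a1 (1 / 2)}" "b1 ` I \<inter> Q = {b1 (- 1 / 2), b1 (1 / 2)}"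
      by (intro *; (simp add: defs memQ I; smt (verit)))+
  qed
  have disj: "a ` I \<inter> b ` I = {}" "a0 ` I \<inter> b0 ` I = {}" "a1 ` I \<inter> b1 ` I = {}"
  proof -
    have "a u \<noteq> b v" for u v using \<eta>'(3)[of 0] by (auto simp: defs)
    thus "a ` I \<inter> b ` I = {}" by (metis disjoint_iff imageE)
    have "0 < \<sigma> u" if "u \<in> I" for u using \<sigma>'(2)[of u] that[unfolded I] by linarith
    thus "a0 ` I \<inter> b0 ` I = {}" "a1 ` I \<inter> b1 ` I = {}" by (force simp: defs)+
  qed
  have pts: "\<Phi> (a (- 1 / 2)) = p" "\<Phi> (a (1 / 2)) = r" "\<Phi> (b (- 1 / 2)) = q" "\<Phi> (b (1 / 2)) = s"
    "\<Phi> (a0 (- 1 / 2)) = p" "\<Phi> (a0 (1 / 2)) = s" "\<Phi> (b0 (- 1 / 2)) = q" "\<Phi> (b0 (1 / 2)) = r"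
    "\<Phi> (a1 (- 1 / 2)) = p" "\<Phi> (a1 (1 / 2)) = q" "\<Phi> (b1 (- 1 / 2)) = s" "\<Phi> (b1 (1 / 2)) = r"
    unfolding defs p_def q_def r_def s_def by (simp_all add: \<eta>' \<sigma>')
  have K: "\<Phi> ` a ` I \<inter> K = {p, r}" "\<Phi> ` b ` I \<inter> K = {q, s}" "\<Phi> ` a0 ` I \<inter> K = {p, s}"
    "\<Phi> ` b0 ` I \<inter> K = {q, r}" "\<Phi> ` a1 ` I \<inter> K = {p, q}" "\<Phi> ` b1 ` I \<inter> K = {r, s}"
    unfolding KInt[OF cube(1)] KInt[OF cube(2)] KInt[OF cube(3)] KInt[OF cube(4)] KInt[OF cube(5)]
      KInt[OF cube(6)] ends image_insert image_empty pts by (simp_all only: insert_commute)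
  have AB: "\<Phi> ` a ` I \<inter> \<Phi> ` b ` I = {}" "\<Phi> ` a0 ` I \<inter> \<Phi> ` b0 ` I = {}" "\<Phi> ` a1 ` I \<inter> \<Phi> ` b1 ` I = {}"
    unfolding \<Phi>Int[OF cube(1,2)] \<Phi>Int[OF cube(3,4)] \<Phi>Int[OF cube(5,6)] disj by simp_all
  have "agree_outside \<phi> F F" by (simp add: agree_outside_def)
  note L = decomp[OF this look(1) tangle] decomp[OF out(2) look(3) tangle0] decomp[OF out(1) look(2) tangle1]
  obtain \<U> where \<U>: "closed_partition \<U>" "\<Union>\<U> = model ` fst F"
    "\<And>U. U \<in> \<U> \<Longrightarrow> \<exists>c. simple_path c \<and> pathfinish c = pathstart c \<and> path_image c = U"
    using link_circles[OF assms(2)] by metis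
  define \<alpha> where "\<alpha> t = \<Phi> (a (t - 1 / 2))" for t
  define \<beta> where "\<beta> t = \<Phi> (b (t - 1 / 2))" for t
  have arc: "arc (\<lambda>t. \<Phi> (f (t - 1 / 2)))" "path_image (\<lambda>t. \<Phi> (f (t - 1 / 2))) = \<Phi> ` f ` I"
    if f: "continuous_on I f" "f ` I \<subseteq> cube" "inj_on f I" for f
  proof -
    have sh: "(\<lambda>t. t - 1 / 2) ` {0..1} = I" unfolding I_def by (simp add: image_diff_atLeastAtMost)
    show "path_image (\<lambda>t. \<Phi> (f (t - 1 / 2))) = \<Phi> ` f ` I"
      unfolding path_image_def sh[symmetric] image_image ..
    have "inj_on (\<lambda>u. \<Phi> (f u)) I"
      using comp_inj_on[OF f(3) inj_on_subset[OF \<Phi>(2) f(2)]] by (simp add: o_def)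
    hence "inj_on (\<lambda>t. \<Phi> (f (t - 1 / 2))) {0..1}"
      unfolding inj_on_def sh[symmetric] by fastforce
    moreover have "continuous_on {0..1} (\<lambda>t. \<Phi> (f (t - 1 / 2)))"
      by (intro continuous_on_compose2[OF \<Phi>(1)] continuous_on_compose2[OF f(1)] continuous_intros)
        (use sh f(2) in auto)
    ultimately show "arc (\<lambda>t. \<Phi> (f (t - 1 / 2)))" by (simp add: arc_def path_def)
  qed
  have inj: "inj_on a I" "inj_on b I" by (auto simp: inj_on_def a_def b_def)
  note \<alpha> = arc[OF cont(1) cube(1) inj(1), folded \<alpha>_def] and \<beta> = arc[OF cont(2) cube(2) inj(2), folded \<beta>_def]
  have ends\<alpha>: "pathstart \<alpha> = p" "pathfinish \<alpha> = r" "pathstart \<beta> = q" "pathfinish \<beta> = s"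
    by (simp_all add: pathstart_def pathfinish_def \<alpha>_def \<beta>_def flip: pts(1-4))
  obtain \<X> C D where CD: "closed_partition (insert C (insert D \<X>))" "C \<notin> insert D \<X>" "D \<notin> \<X>"
    "\<Union>\<U> - (interior_of_arc \<alpha> \<union> interior_of_arc \<beta>) = C \<union> D \<union> \<Union>\<X>"
    and pairing: "(p \<in> C \<and> r \<in> C \<and> q \<in> D \<and> s \<in> D) \<or> (p \<in> C \<and> q \<in> C \<and> r \<in> D \<and> s \<in> D) \<or>
     (p \<in> C \<and> s \<in> C \<and> r \<in> D \<and> q \<in> D)"
  proof (rule closed_curves_minus_two_arcs[OF \<U>(1) \<U>(3) \<alpha>(1) \<beta>(1)])
    show "path_image \<alpha> \<inter> path_image \<beta> = {}" using AB(1) by (simp add: \<alpha> \<beta>)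
    show "path_image \<alpha> \<subseteq> \<Union>\<U>" "path_image \<beta> \<subseteq> \<Union>\<U>" unfolding \<U>(2) L(1) \<alpha> \<beta> by auto
  qed (auto simp: ends\<alpha> intro: that)
  have "K = \<Union>\<U> - (interior_of_arc \<alpha> \<union> interior_of_arc \<beta>)"
    unfolding \<U>(2) L(1) interior_of_arc_def ends\<alpha> \<alpha>(2) \<beta>(2)
  proof -
    have "P \<union> A \<union> B - ((A - Y) \<union> (B - Z)) = P" if "A \<inter> P = Y" "B \<inter> P = Z" "A \<inter> B = {}"
      for P A B Y Z :: "'e set"
      using that by auto
    from this[OF K(1,2) AB(1)] show "K = K \<union> \<Phi> ` a ` I \<union> \<Phi> ` b ` I -
        ((\<Phi> ` a ` I - {p, r}) \<union> (\<Phi> ` b ` I - {q, s}))" by simp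
  qed
  hence "K = C \<union> D \<union> \<Union>\<X>" using CD(4) by simp
  from three_pairings_sum[OF CD(1-3) this pairing
      imgs(1-4) AB(1) K(1,2) imgs(5-8) AB(2) K(3,4) imgs(9-12) AB(3) K(5,6)]
  show ?thesis unfolding number_of_components_def L by simp
qed


end

text \<open>This makes functionals on finitely supported functions additive, both for Laurent polynomials and
  for combinations of links.\<close>

lemma sum_keys_add:
  fixes f :: "'k \<Rightarrow> 'b::comm_monoid_add \<Rightarrow> 'c::ab_group_add"
  assumes "\<And>k a b. f k (a + b) = f k a + f k b"
  shows "(\<Sum>k\<in>Poly_Mapping.keys (x + y). f k (Poly_Mapping.lookup (x + y) k)) =
    (\<Sum>k\<in>Poly_Mapping.keys x. f k (Poly_Mapping.lookup x k)) +
    (\<Sum>k\<in>Poly_Mapping.keys y. f k (Poly_Mapping.lookup y k))"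
proof -
  let ?K = "Poly_Mapping.keys x \<union> Poly_Mapping.keys y"
  have f0: "f k 0 = 0" for k using assms[of k 0 0] by simp
  have ext: "(\<Sum>k\<in>Poly_Mapping.keys z. f k (Poly_Mapping.lookup z k)) =
      (\<Sum>k\<in>?K. f k (Poly_Mapping.lookup z k))" if "Poly_Mapping.keys z \<subseteq> ?K" for z
    by (rule sum.mono_neutral_left) (use that f0 in \<open>auto simp: in_keys_iff\<close>)
  show ?thesis
    using ext[of "x + y"] ext[of x] ext[of y] Poly_Mapping.keys_add[of x y]
    by (simp add: lookup_add assms sum.distrib)
qed

text \<open>The specialisation \<open>A = -1\<close>.\<close>

definition at_minus_1 :: "laurent \<Rightarrow> int" where
  "at_minus_1 a = (\<Sum>k\<in>Poly_Mapping.keys a. Poly_Mapping.lookup a k * (if even k then 1 else - 1))"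

lemma at_minus_1_add: "at_minus_1 (a + b) = at_minus_1 a + at_minus_1 b"
  unfolding at_minus_1_def by (rule sum_keys_add) (simp add: algebra_simps)

lemma at_minus_1_zero: "at_minus_1 0 = 0"
  by (simp add: at_minus_1_def)

lemma at_minus_1_A_pow: "at_minus_1 (a * A_pow k) = (if even k then 1 else - 1) * at_minus_1 a"
proof (induction a rule: Poly_Mapping.update_induct)
  case (update f n v)
  have "Poly_Mapping.update n v f = f + Poly_Mapping.single n v"
    using update.hyps(1)
    by (intro poly_mapping_eqI) (auto simp: lookup_update lookup_add lookup_single in_keys_iff when_def)
  moreover have "at_minus_1 (Poly_Mapping.single n v * A_pow k) =
      (if even k then 1 else - 1) * at_minus_1 (Poly_Mapping.single n v)"
    by (auto simp: A_pow_def mult_single at_minus_1_def)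
  ultimately show ?case using update.IH by (simp add: algebra_simps at_minus_1_add)
qed (simp add: at_minus_1_zero)

context euclidean_quotient
begin

definition weight :: "'m framed_link \<Rightarrow> int" where
  "weight F = (- 2) ^ number_of_components (fst F)"

definition class_weight :: "'m framed_link set \<Rightarrow> int" where
  "class_weight c = weight (SOME F. F \<in> c)"

text \<open>The functional on the free module which separates the two links of the theorem.  It is well
  defined on classes because isotopies preserve the number of components.\<close>

definition trace_at_minus_1 :: "('m framed_link set \<Rightarrow>\<^sub>0 laurent) \<Rightarrow> int" where
  "trace_at_minus_1 x = (\<Sum>c\<in>Poly_Mapping.keys x. at_minus_1 (Poly_Mapping.lookup x c) * class_weight c)"

lemma trace_add: "trace_at_minus_1 (x + y) = trace_at_minus_1 x + trace_at_minus_1 y"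
  unfolding trace_at_minus_1_def by (rule sum_keys_add) (simp add: at_minus_1_add algebra_simps)

lemma trace_diff: "trace_at_minus_1 (x - y) = trace_at_minus_1 x - trace_at_minus_1 y"
  using trace_add[of "x - y" y] by simp

lemma trace_scale_gen:
  "trace_at_minus_1 (lscale a (gen pr F)) = at_minus_1 a * class_weight (framed_isotopy pr `` {F})"
proof -
  have "lscale a (gen pr F) = Poly_Mapping.single (framed_isotopy pr `` {F}) a"
    by (rule poly_mapping_eqI) (simp add: lookup_lscale gen_def lookup_single when_def)
  thus ?thesis by (simp add: trace_at_minus_1_def at_minus_1_zero)
qed

lemma class_weight_class:
  assumes "F \<in> framed_links pr"
  shows "class_weight (framed_isotopy pr `` {F}) = weight F"
proof -
  let ?c = "framed_isotopy pr `` {F}"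
  have "F \<in> ?c"
    using assms ambient_isotopy_const[of pr]
    by (auto simp: framed_isotopy_def intro!: exI[of _ "\<lambda>t m. m"])
  hence "(SOME G. G \<in> ?c) \<in> ?c" by (rule someI)
  then obtain H where "ambient_isotopy pr H" "H 1 ` fst F = fst (SOME G. G \<in> ?c)"
    by (auto simp: framed_isotopy_def)
  thus ?thesis
    using number_of_components_isotopy[of H "fst F"]
      is_link_subset_manifold[OF framed_links_core[OF assms]]
    by (simp add: class_weight_def weight_def)
qed

text \<open>A framing twist does not move the core, and \<open>-A\<^sup>3\<close> specialises to \<open>1\<close>.\<close>

lemma framing_twist_weight:
  assumes "framing_twist pr F F1"
  shows "weight F1 = weight F"
proof -
  obtain \<phi> \<theta> where "agree_outside \<phi> F F1" "looks_like \<phi> F (twisted_strand (\<lambda>_. 0))"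
    "looks_like \<phi> F1 (twisted_strand \<theta>)"
    using assms unfolding framing_twist_def by metis
  moreover have "twisted_strand \<theta> 0 = twisted_strand (\<lambda>_. 0) 0"
    unfolding twisted_strand_def by auto
  ultimately have "fst F - \<phi> ` cube = fst F1 - \<phi> ` cube" "fst F \<inter> \<phi> ` cube = fst F1 \<inter> \<phi> ` cube"
    unfolding agree_outside_def looks_like_def by simp_all
  hence "fst F1 = fst F" by blast
  thus ?thesis by (simp add: weight_def)
qed

lemma trace_relator:
  assumes "x \<in> skein_relators pr"
  shows "trace_at_minus_1 (lscale a x) = 0"
proof -
  consider F F0 Finf where "skein_triple pr F F0 Finf"
      "x = gen pr F - lscale (A_pow 1) (gen pr F0) - lscale (A_pow (- 1)) (gen pr Finf)"
    | F F1 where "framing_twist pr F F1" "x = gen pr F1 + lscale (A_pow 3) (gen pr F)"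
    using assms unfolding skein_relators_def by blast
  thus ?thesis
  proof cases
    case 1
    have fl: "F \<in> framed_links pr" "F0 \<in> framed_links pr" "Finf \<in> framed_links pr"
      using 1(1) by (auto simp: skein_triple_def)
    have "weight F + weight F0 + weight Finf = 0"
      using skein_triple_components[OF 1(1) framed_links_core[OF fl(1)]] by (simp add: weight_def)
    hence "at_minus_1 a * (weight F + weight F0 + weight Finf) = 0" by simp
    moreover have "trace_at_minus_1 (lscale a x) =
        at_minus_1 a * weight F + at_minus_1 a * weight F0 + at_minus_1 a * weight Finf"
      unfolding 1(2) lmod.scale_right_diff_distrib lmod.scale_scale trace_diff trace_scale_gen
      by (simp add: at_minus_1_A_pow class_weight_class fl)
    ultimately show ?thesis by (simp add: algebra_simps)
  next
    case 2
    have fl: "F \<in> framed_links pr" "F1 \<in> framed_links pr"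
      using 2(1) by (auto simp: framing_twist_def)
    show ?thesis unfolding 2(2)
      by (simp add: lmod.scale_right_distrib lmod.scale_scale trace_add trace_scale_gen
          at_minus_1_A_pow class_weight_class fl framing_twist_weight[OF 2(1)])
  qed
qed

lemma trace_skein_submodule:
  assumes "x \<in> skein_submodule pr"
  shows "trace_at_minus_1 x = 0"
proof -
  (* With all multiples in the induction, additivity of the functional suffices; its linearity
     over Laurent polynomials is only needed for the powers of A in the relators. *)
  have "trace_at_minus_1 (lscale a x) = 0" for a
    using assms unfolding skein_submodule_def
  proof (induction arbitrary: a rule: lmod.span_induct_alt)
    case base
    show ?case by (simp add: trace_at_minus_1_def)
  next
    case (step c x y)
    thus ?case
      by (simp add: lmod.scale_right_distrib lmod.scale_scale trace_add trace_relator)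
  qed
  from this[of 1] show ?thesis by simp
qed

lemma skein_class_eq_weight:
  assumes "F \<in> framed_links pr" and "G \<in> framed_links pr" and "skein_class pr F = skein_class pr G"
  shows "weight F = weight G"
proof -
  have free: "gen pr H \<in> free_module pr" if "H \<in> framed_links pr" for H
    using that by (auto simp: gen_def free_module_def framed_link_classes_def intro: quotientI)
  have "gen pr G \<in> skein_class pr G"
    using free[OF assms(2)]
    by (simp add: skein_class_def skein_rel_def skein_submodule_def lmod.span_zero)
  hence "gen pr F - gen pr G \<in> skein_submodule pr"
    unfolding assms(3)[symmetric] by (simp add: skein_class_def skein_rel_def)
  hence "trace_at_minus_1 (lscale 1 (gen pr F)) - trace_at_minus_1 (lscale 1 (gen pr G)) = 0"
    using trace_skein_submodule[of "gen pr F - gen pr G"] by (simp add: trace_diff)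
  moreover have "at_minus_1 1 = 1" by (simp add: at_minus_1_def flip: single_one)
  ultimately show ?thesis
    unfolding trace_scale_gen by (simp add: class_weight_class assms)
qed

end


section \<open>The surgery description of lens spaces\<close>

lemma smooth_on_arctan [smooth_intros]:
  assumes "smooth_on S f"
  shows "smooth_on S (\<lambda>x. arctan (f x))"
proof (rule smooth_on_compose[OF _ assms subset_UNIV])
  have nz: "1 + x\<^sup>2 \<noteq> 0" for x :: real using zero_le_power2[of x] by linarith
  have "smooth_on UNIV (\<lambda>x::real. inverse (1 + x\<^sup>2))"
    by (intro smooth_intros) (rule nz)
  hence inv: "Ck_on k UNIV (\<lambda>x::real. inverse (1 + x\<^sup>2))" for k by (simp add: smooth_on_open)
  have "Ck_on k UNIV arctan" for k
  proof (cases k)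
    case 0
    thus ?thesis by (simp add: continuous_on_arctan)
  next
    case (Suc k)
    show ?thesis unfolding Suc
      by (rule Ck_on_SucI[OF open_UNIV DERIV_arctan[unfolded has_field_derivative_def]])
        (intro Ck_on_bilinear[OF bounded_bilinear_mult open_UNIV] inv Ck_on_const)
  qed
  thus "smooth_on UNIV arctan" by (simp add: smooth_on_open)
qed

text \<open>The inverse of \<^const>\<open>surgery_embed\<close>, written as a function on the sphere which is
  constant on orbits.\<close>

definition torus_coords :: "nat \<Rightarrow> nat \<Rightarrow> complex \<times> complex \<Rightarrow> complex \<times> real" where
  "torus_coords p q x = (let u = fst x / of_real (cmod (fst x)); v = snd x * u ^ q / of_real (cmod (fst x))
     in (u ^ p * exp (of_real (Im v)), Re v))"

lemma torus_coords_eq: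
  assumes "u = fst x / of_real (cmod (fst x))" and "v = snd x * u ^ q / of_real (cmod (fst x))"
  shows "torus_coords p q x = (u ^ p * exp (of_real (Im v)), Re v)"
  unfolding torus_coords_def Let_def assms ..

lemma torus_point_S3: "torus_point p q \<alpha> v \<in> S3"
proof -
  have "0 < 1 + (cmod v)\<^sup>2" by (rule add_pos_nonneg) auto
  hence "norm (torus_point p q \<alpha> v) = 1"
    unfolding torus_point_def norm_scaleR norm_Pair
    by (simp add: norm_mult)
  thus ?thesis by (simp add: S3_def)
qed

lemma torus_coords_torus_point:
  assumes "0 < p"
  shows "torus_coords p q (torus_point p q \<alpha> v) = (cis \<alpha> * exp (of_real (Im v)), Re v)"
proof -
  define N where "N = 1 / sqrt (1 + (cmod v)\<^sup>2)"
  have N: "0 < N" unfolding N_def by (simp add: add_pos_nonneg)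
  let ?x = "torus_point p q \<alpha> v"
  have x: "?x = (of_real N * cis (\<alpha> / of_nat p), of_real N * (v * cis (- (of_nat q * \<alpha> / of_nat p))))"
    unfolding torus_point_def N_def[symmetric] by (simp add: scaleR_conv_of_real)
  have cm: "cmod (fst ?x) = N" using N by (simp add: x norm_mult)
  have u: "fst ?x / of_real (cmod (fst ?x)) = cis (\<alpha> / of_nat p)"
    using N unfolding cm by (simp add: x)
  have "cis (\<alpha> / of_nat p) ^ p = cis \<alpha>" using assms by (simp add: Complex.DeMoivre)
  moreover have "snd ?x * cis (\<alpha> / of_nat p) ^ q / of_real N = v"
    using N by (simp add: x Complex.DeMoivre cis_mult)
  ultimately show ?thesis
    using torus_coords_eq[OF u[symmetric], of v q p, unfolded cm] by metis
qed

lemma torus_coords_lens_pr: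
  assumes "lens_pr p q x = lens_pr p q y" and "0 < p"
  shows "torus_coords p q x = torus_coords p q y"
proof -
  have "y = (cis (2 * pi * of_int 0 / of_nat p) * fst y,
     cis (- (2 * pi * of_int 0 * of_nat q / of_nat p)) * snd y)" by simp
  hence "y \<in> lens_pr p q y" unfolding lens_pr_def by blast
  hence "y \<in> lens_pr p q x" by (simp add: assms(1))
  then obtain k :: int where y: "y = (cis (2 * pi * of_int k / of_nat p) * fst x,
     cis (- (2 * pi * of_int k * of_nat q / of_nat p)) * snd x)"
    unfolding lens_pr_def by blast
  define c where "c = cis (2 * pi * of_int k / of_nat p)"
  have cm: "cmod (fst y) = cmod (fst x)" by (simp add: y norm_mult)
  have u: "fst y / of_real (cmod (fst y)) = c * (fst x / of_real (cmod (fst x)))"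
    unfolding cm by (simp add: y c_def)
  have cp: "c ^ p = 1"
  proof -
    have "c ^ p = cis (2 * pi * of_int k)" using assms(2) by (simp add: c_def Complex.DeMoivre)
    also have "\<dots> = 1" by (rule cis_multiple_2pi) auto
    finally show ?thesis .
  qed
  have cq: "cis (- (2 * pi * of_int k * of_nat q / of_nat p)) * c ^ q = 1"
    by (simp add: c_def Complex.DeMoivre cis_mult algebra_simps)
  have "snd y * (c * (fst x / of_real (cmod (fst x)))) ^ q =
      (cis (- (2 * pi * of_int k * of_nat q / of_nat p)) * c ^ q) *
        (snd x * (fst x / of_real (cmod (fst x))) ^ q)"
    by (simp only: y snd_conv power_mult_distrib ac_simps)
  hence "snd y * (c * (fst x / of_real (cmod (fst x)))) ^ q = snd x * (fst x / of_real (cmod (fst x))) ^ q"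
    unfolding cq by simp
  hence v: "snd x * (fst x / of_real (cmod (fst x))) ^ q / of_real (cmod (fst x)) =
      snd y * (c * (fst x / of_real (cmod (fst x)))) ^ q / of_real (cmod (fst y))"
    unfolding cm by simp
  show ?thesis
    unfolding torus_coords_eq[OF u[symmetric] v] torus_coords_eq[OF refl refl, of p q x]
    by (simp only: power_mult_distrib cp mult_1_left)
qed

lemma inverse_sqrt_powr:
  assumes "0 \<le> r"
  shows "1 / sqrt r = r powr (- 1 / 2)"
proof -
  have "- 1 / 2 = - (1 / 2 :: real)" by simp
  thus ?thesis by (simp only: powr_minus powr_half_sqrt[OF assms] inverse_eq_divide)
qed

lemma smooth_on_torus_coords: "smooth_on {x. fst x \<noteq> 0} (torus_coords p q)"
proof -
  let ?S = "{x :: complex \<times> complex. fst x \<noteq> 0}"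
  have eq: "1 / of_real (cmod z) = (of_real ((z \<bullet> z) powr (- 1 / 2)) :: complex)" for z
    using inverse_sqrt_powr[of "z \<bullet> z"] inner_ge_zero[of z]
    unfolding norm_eq_sqrt_inner by (metis of_real_1 of_real_divide)
  have "smooth_on ?S (\<lambda>x. complex_of_real ((fst x \<bullet> fst x) powr (- 1 / 2)))"
    by (intro smooth_intros) auto
  hence inv: "smooth_on ?S (\<lambda>x. 1 / of_real (cmod (fst x)) :: complex)" unfolding eq .
  have u: "smooth_on ?S (\<lambda>x. fst x * (1 / of_real (cmod (fst x))))"
    by (intro smooth_intros inv)
  have "smooth_on ?S (\<lambda>x. snd x * (fst x * (1 / of_real (cmod (fst x)))) ^ q * (1 / of_real (cmod (fst x))))"
    by (intro smooth_intros u inv)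
  note v = this
  have "smooth_on ?S (\<lambda>x. ((fst x * (1 / of_real (cmod (fst x)))) ^ p *
      exp (of_real (Im (snd x * (fst x * (1 / of_real (cmod (fst x)))) ^ q * (1 / of_real (cmod (fst x)))))),
      Re (snd x * (fst x * (1 / of_real (cmod (fst x)))) ^ q * (1 / of_real (cmod (fst x))))))"
    by (intro smooth_intros u v)
  thus ?thesis
    by (rule smooth_on_cong) (simp only: torus_coords_eq[OF refl refl] times_divide_eq_right mult_1_right)
qed

text \<open>Local lifts of \<^const>\<open>surgery_embed\<close> to the sphere, by the branch of the logarithm of \<open>c\<close>
  that is continuous in the half-plane around \<open>c\<^sub>0\<close>.\<close>

definition surgery_lift :: "nat \<Rightarrow> nat \<Rightarrow> complex \<Rightarrow> complex \<times> real \<Rightarrow> complex \<times> complex" where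
  "surgery_lift p q c\<^sub>0 y = (let l = Ln (fst y / c\<^sub>0) + Ln c\<^sub>0 in
     torus_point p q (Im l) (Complex (snd y) (Re l)))"

lemma smooth_on_torus_point:
  assumes "smooth_on S \<alpha>" and "smooth_on S v"
  shows "smooth_on S (\<lambda>x. torus_point p q (\<alpha> x) (v x))"
proof -
  have pos: "0 < 1 + v x \<bullet> v x" for x by (simp add: add_pos_nonneg)
  have eq: "1 / sqrt (1 + (cmod z)\<^sup>2) = (1 + z \<bullet> z) powr (- 1 / 2)" for z
    unfolding power2_norm_eq_inner by (rule inverse_sqrt_powr) simp
  have a: "\<alpha> x / of_nat p = \<alpha> x * (1 / of_nat p)" "of_nat q * \<alpha> x / of_nat p = \<alpha> x * (of_nat q / of_nat p)"
    for x by simp_all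
  show ?thesis
    unfolding torus_point_def eq a
    by (intro smooth_intros assms pos)
qed

lemma surgery_lift:
  assumes "c\<^sub>0 \<noteq> 0" and "0 < p"
  shows "smooth_on {y. Re (fst y / c\<^sub>0) > 0} (surgery_lift p q c\<^sub>0)"
    and "surgery_lift p q c\<^sub>0 y \<in> S3"
    and "Re (fst y / c\<^sub>0) > 0 \<Longrightarrow> surgery_embed p q y = lens_pr p q (surgery_lift p q c\<^sub>0 y)"
    and "Re (fst y / c\<^sub>0) > 0 \<Longrightarrow> torus_coords p q (surgery_lift p q c\<^sub>0 y) = y"
proof -
  have "smooth_on {y :: complex \<times> real. Re (fst y / c\<^sub>0) > 0} (\<lambda>y. Ln (fst y / c\<^sub>0) + Ln c\<^sub>0)"
    by (intro smooth_intros) (use assms in auto)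
  note l = this
  show "smooth_on {y. Re (fst y / c\<^sub>0) > 0} (surgery_lift p q c\<^sub>0)"
    unfolding surgery_lift_def Let_def
    by (intro smooth_on_torus_point smooth_on_Complex smooth_on_bounded_linear[OF bounded_linear_Im l]
        smooth_on_bounded_linear[OF bounded_linear_Re l]
        smooth_on_bounded_linear[OF bounded_linear_snd smooth_on_id])
  show "surgery_lift p q c\<^sub>0 y \<in> S3" by (simp add: surgery_lift_def Let_def torus_point_S3)
  assume pos: "Re (fst y / c\<^sub>0) > 0"
  define l where "l = Ln (fst y / c\<^sub>0) + Ln c\<^sub>0"
  have "fst y / c\<^sub>0 \<noteq> 0" using pos by auto
  hence "exp l = fst y" using assms(1) by (simp add: l_def exp_add)
  hence y: "fst y = cis (Im l) * exp (of_real (Re l))" by (simp add: exp_eq_polar exp_of_real mult.commute)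
  have nz: "fst y \<noteq> 0" using \<open>exp l = fst y\<close> by (metis exp_not_eq_zero)
  have cm: "cmod (fst y) = exp (Re l)" unfolding y by (simp add: norm_mult)
  have "sgn (fst y) = cis (Im l)"
    unfolding sgn_eq cm unfolding y exp_of_real by simp
  hence "cis (Arg (fst y)) = cis (Im l)" using cis_Arg[OF nz] by simp
  hence "lens_pr p q (torus_point p q (Arg (fst y)) (Complex (snd y) (Re l))) =
      lens_pr p q (torus_point p q (Im l) (Complex (snd y) (Re l)))"
    by (rule lens_pr_torus_point_cong)
  thus "surgery_embed p q y = lens_pr p q (surgery_lift p q c\<^sub>0 y)"
    unfolding surgery_embed_def surgery_lift_def l_def[symmetric] Let_def case_prod_unfold cm by simp
  show "torus_coords p q (surgery_lift p q c\<^sub>0 y) = y"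
    unfolding surgery_lift_def l_def[symmetric] Let_def torus_coords_torus_point[OF assms(2)]
    by (simp add: y prod_eq_iff)
qed

lemma surgery_embed_inject:
  assumes "0 < p" and "fst x \<noteq> 0" and "fst y \<noteq> 0"
  shows "surgery_embed p q x = surgery_embed p q y \<longleftrightarrow> x = y"
proof
  assume "surgery_embed p q x = surgery_embed p q y"
  hence "lens_pr p q (surgery_lift p q (fst x) x) = lens_pr p q (surgery_lift p q (fst y) y)"
    using surgery_lift(3)[of "fst x" p x q] surgery_lift(3)[of "fst y" p y q] assms by simp
  from torus_coords_lens_pr[OF this assms(1)] show "x = y"
    using surgery_lift(4)[of "fst x" p x q] surgery_lift(4)[of "fst y" p y q] assms by simp
qed simp

text \<open>The left inverse \<^const>\<open>torus_coords\<close> shows that the lifts have injective derivatives.\<close>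

lemma immersion_surgery_embed:
  fixes b :: "'a::euclidean_space \<Rightarrow> complex \<times> real"
  assumes "0 < p" and b: "smooth_on UNIV b" and nz: "\<And>x. fst (b x) \<noteq> 0"
    and inj: "\<And>x. inj (frechet_derivative b (at x))"
  shows "immersion_to (lens_pr p q) (\<lambda>x. surgery_embed p q (b x))"
  unfolding immersion_to_def
proof
  fix x
  let ?c = "fst (b x)"
  let ?H = "{y :: complex \<times> real. Re (fst y / ?c) > 0}"
  let ?U = "b -` ?H"
  have oH: "open ?H" by (intro open_Collect_less continuous_intros) (use nz in auto)
  have oU: "open ?U"
    using open_vimage[OF oH smooth_on_imp_continuous_on[OF b]] .
  have xU: "x \<in> ?U" using nz[of x] by simp
  note lift = surgery_lift[OF nz[of x] assms(1), where q = q]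
  let ?g = "\<lambda>y. surgery_lift p q ?c (b y)"
  have g: "smooth_on ?U ?g"
    by (rule smooth_on_compose[OF lift(1) smooth_on_UNIV_imp[OF b]]) auto
  have gx: "fst (?g x) \<noteq> 0"
    unfolding surgery_lift_def torus_point_def Let_def
    by (simp add: add_pos_nonneg less_imp_neq[symmetric])
  have o: "open {x :: complex \<times> complex. fst x \<noteq> 0}"
    by (intro open_Collect_neq continuous_intros)
  have d1: "(torus_coords p q has_derivative frechet_derivative (torus_coords p q) (at (?g x))) (at (?g x))"
    by (rule smooth_on_has_derivative[OF smooth_on_torus_coords o]) (use gx in simp)
  have d2: "(?g has_derivative frechet_derivative ?g (at x)) (at x)"
    by (rule smooth_on_has_derivative[OF g oU xU])
  have "((\<lambda>y. torus_coords p q (?g y)) has_derivative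
      (\<lambda>v. frechet_derivative (torus_coords p q) (at (?g x)) (frechet_derivative ?g (at x) v))) (at x)"
    using diff_chain_at[OF d2 d1] by (simp add: o_def)
  hence "(b has_derivative
      (\<lambda>v. frechet_derivative (torus_coords p q) (at (?g x)) (frechet_derivative ?g (at x) v))) (at x)"
    by (rule has_derivative_transform_within_open[OF _ oU xU]) (simp add: lift(4))
  hence Db: "frechet_derivative b (at x) =
      (\<lambda>v. frechet_derivative (torus_coords p q) (at (?g x)) (frechet_derivative ?g (at x) v))"
    by (rule frechet_derivative_at[symmetric])
  have "inj (frechet_derivative ?g (at x))"
  proof (rule injI)
    fix v w assume "frechet_derivative ?g (at x) v = frechet_derivative ?g (at x) w"
    hence "frechet_derivative b (at x) v = frechet_derivative b (at x) w" unfolding Db by simp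
    thus "v = w" by (rule injD[OF inj])
  qed
  thus "\<exists>U g. open U \<and> x \<in> U \<and> smooth_on U g \<and>
      (\<forall>y\<in>U. g y \<in> S3 \<and> surgery_embed p q (b y) = lens_pr p q (g y)) \<and>
      inj (frechet_derivative g (at x))"
    using oU xU g lift(2,3) by (intro exI[of _ ?U] exI[of _ ?g]) auto
qed

text \<open>An open collar of the bands is obtained by rescaling \<open>\<real>\<close> to the interval \<open>(-2, 2)\<close> in
  such a way that \<open>[-1, 1]\<close> is preserved.\<close>

definition collar :: "real \<Rightarrow> real" where
  "collar s = 4 / pi * arctan s"

lemma collar:
  shows "\<bar>collar s\<bar> < 2" and "collar s = collar s' \<longleftrightarrow> s = s'" and "collar 0 = 0"
    and "collar ` {- 1..1} = {- 1..1}" and "smooth_on S collar"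
    and "\<exists>d\<noteq>0. (collar has_real_derivative d) (at s)"
proof -
  show "\<bar>collar s\<bar> < 2"
    using arctan_lbound[of s] arctan_ubound[of s] pi_gt_zero
    by (auto simp: collar_def abs_if field_simps)
  show "collar s = collar s' \<longleftrightarrow> s = s'" by (simp add: collar_def arctan_eq_iff)
  show "collar 0 = 0" by (simp add: collar_def)
  have mono: "collar s \<le> collar t \<longleftrightarrow> s \<le> t" for s t
    by (simp add: collar_def arctan_le_iff divide_le_cancel)
  have one: "collar 1 = 1" "collar (- 1) = - 1"
    by (simp_all add: collar_def arctan_one arctan_minus)
  show "collar ` {- 1..1} = {- 1..1}"
  proof
    show "collar ` {- 1..1} \<subseteq> {- 1..1}" using mono[of "- 1"] mono[of _ 1] by (auto simp: one)
    show "{- 1..1} \<subseteq> collar ` {- 1..1}"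
    proof
      fix y :: real assume y: "y \<in> {- 1..1}"
      have "pi * y \<le> pi * 1" "pi * (- 1) \<le> pi * y" by (rule mult_left_mono; use y in simp)+
      hence "- (pi / 2) < pi * y / 4" "pi * y / 4 < pi / 2" using pi_gt_zero by linarith+
      hence c: "collar (tan (pi * y / 4)) = y" by (simp add: collar_def arctan_tan)
      have "tan (pi * y / 4) \<in> {- 1..1}" using y mono[of "- 1" "tan (pi * y / 4)"] mono[of "tan (pi * y / 4)" 1]
        by (simp add: one c)
      thus "y \<in> collar ` {- 1..1}" using c by (metis imageI)
    qed
  qed
  show "smooth_on S collar" unfolding collar_def by (intro smooth_intros)
  have "(collar has_real_derivative 4 / pi * inverse (1 + s\<^sup>2)) (at s)"
    unfolding collar_def by (auto intro!: derivative_eq_intros)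
  moreover have "1 + s\<^sup>2 \<noteq> 0" using zero_le_power2[of s] by linarith
  ultimately show "\<exists>d\<noteq>0. (collar has_real_derivative d) (at s)"
    by (intro exI[of _ "4 / pi * inverse (1 + s\<^sup>2)"]) auto
qed

lemma framed_link_surgery_embed:
  fixes B :: "nat \<Rightarrow> real \<times> real \<Rightarrow> complex \<times> real"
  assumes p: "0 < p" and smooth: "\<And>i. i < n \<Longrightarrow> smooth_on UNIV (B i)"
    and nz: "\<And>i t s. i < n \<Longrightarrow> \<bar>s\<bar> < 2 \<Longrightarrow> fst (B i (t, s)) \<noteq> 0"
    and imm: "\<And>i t s. i < n \<Longrightarrow> \<bar>s\<bar> < 2 \<Longrightarrow> inj (frechet_derivative (B i) (at (t, s)))"
    and inj: "\<And>i j t t' s s'. i < n \<Longrightarrow> j < n \<Longrightarrow> \<bar>s\<bar> < 2 \<Longrightarrow> \<bar>s'\<bar> < 2 \<Longrightarrow>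
      B i (t, s) = B j (t', s') \<longleftrightarrow> i = j \<and> t - t' \<in> \<int> \<and> s = s'"
  shows "(surgery_embed p q ` (\<Union>i<n. B i ` (UNIV \<times> {0})),
      surgery_embed p q ` (\<Union>i<n. B i ` (UNIV \<times> {- 1..1}))) \<in> framed_links (lens_pr p q)"
proof -
  define b where "b i x = B i (fst x, collar (snd x))" for i x
  have immersion: "immersion_to (lens_pr p q) (\<lambda>x. surgery_embed p q (b i x))" if i: "i < n" for i
  proof (rule immersion_surgery_embed[OF p])
    have "smooth_on UNIV (\<lambda>x. collar (snd x))"
      by (rule smooth_on_compose[OF collar(5)]) (auto intro: smooth_intros)
    thus "smooth_on UNIV (b i)" unfolding b_def
      by (intro smooth_on_compose[OF smooth[OF i]] smooth_intros) auto
    show "fst (b i x) \<noteq> 0" for x unfolding b_def using nz[OF i] collar(1) by blast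
    fix x :: "real \<times> real"
    obtain d where d: "d \<noteq> 0" "(collar has_real_derivative d) (at (snd x))" using collar(6) by blast
    have "((\<lambda>x. collar (snd x)) has_derivative (\<lambda>v. d * snd v)) (at x)"
      using has_derivative_compose[OF has_derivative_snd[OF has_derivative_ident]
          d(2)[unfolded has_field_derivative_def]] .
    hence 1: "((\<lambda>x. (fst x, collar (snd x))) has_derivative (\<lambda>v. (fst v, d * snd v))) (at x)"
      by (auto intro!: derivative_eq_intros)
    have 2: "(B i has_derivative frechet_derivative (B i) (at (fst x, collar (snd x)))) (at (fst x, collar (snd x)))"
      by (rule smooth_on_has_derivative[OF smooth[OF i]]) auto
    have "(b i has_derivative (\<lambda>v. frechet_derivative (B i) (at (fst x, collar (snd x))) (fst v, d * snd v))) (at x)"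
      using diff_chain_at[OF 1 2] by (simp add: b_def[abs_def] o_def)
    hence Db: "frechet_derivative (b i) (at x) =
        (\<lambda>v. frechet_derivative (B i) (at (fst x, collar (snd x))) (fst v, d * snd v))"
      by (rule frechet_derivative_at[symmetric])
    show "inj (frechet_derivative (b i) (at x))"
    proof (rule injI)
      fix v w assume "frechet_derivative (b i) (at x) v = frechet_derivative (b i) (at x) w"
      hence "(fst v, d * snd v) = (fst w, d * snd w)"
        unfolding Db by (rule injD[OF imm[OF i collar(1)]])
      thus "v = w" using d(1) by (simp add: prod_eq_iff)
    qed
  qed
  have "surgery_embed p q (b i (t, s)) = surgery_embed p q (b j (t', s')) \<longleftrightarrow>
      i = j \<and> t - t' \<in> \<int> \<and> s = s'" if "i < n" "j < n" for i j t s t' s'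
    using that nz inj collar(1,2) by (simp add: surgery_embed_inject[OF p] b_def)
  moreover have "surgery_embed p q ` (\<Union>i<n. B i ` (UNIV \<times> {0})) =
      (\<Union>i<n. (\<lambda>x. surgery_embed p q (b i x)) ` (UNIV \<times> {0}))"
  proof -
    have "b i ` (UNIV \<times> {0}) = B i ` (UNIV \<times> {0})" for i
      by (rule image_cong) (auto simp: b_def collar(3))
    thus ?thesis by (simp add: image_UN image_image[symmetric])
  qed
  moreover have "surgery_embed p q ` (\<Union>i<n. B i ` (UNIV \<times> {- 1..1})) =
      (\<Union>i<n. (\<lambda>x. surgery_embed p q (b i x)) ` (UNIV \<times> {- 1..1}))"
  proof -
    have "(\<lambda>x. (fst x, collar (snd x))) ` (UNIV \<times> {- 1..1}) = (UNIV :: real set) \<times> collar ` {- 1..1}"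
      by force
    hence "b i ` (UNIV \<times> {- 1..1}) = B i ` (UNIV \<times> {- 1..1})" for i
      unfolding b_def[abs_def] collar(4) by (metis image_image)
    thus ?thesis by (simp add: image_UN image_image[symmetric])
  qed
  ultimately show ?thesis
    unfolding framed_links_def mem_Collect_eq prod.case using immersion
    by (intro exI[of _ n] exI[of _ "\<lambda>i x. surgery_embed p q (b i x)"] conjI) simp_all
qed


section \<open>Diagrams and blackboard bands\<close>

lemma cis_2pi_eq_iff: "cis (2 * pi * t) = cis (2 * pi * t') \<longleftrightarrow> t - t' \<in> \<int>"
proof -
  have "\<i> * complex_of_real (2 * pi * t) = \<i> * complex_of_real (2 * pi * t') + of_real (of_int (2 * n) * pi) * \<i>
      \<longleftrightarrow> t - t' = of_int n" for n :: int
  proof -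
    have "2 * pi * t' + of_int (2 * n) * pi = 2 * pi * (t' + of_int n)" by (simp add: algebra_simps)
    hence "2 * pi * t = 2 * pi * t' + of_int (2 * n) * pi \<longleftrightarrow> t = t' + of_int n"
      using mult_left_cancel[of "2 * pi" t "t' + of_int n"] by simp
    thus ?thesis by (auto simp: complex_eq_iff)
  qed
  thus ?thesis unfolding cis_conv_exp exp_eq Ints_def by auto
qed

lemma diagram_immersion:
  assumes "0 < p" and "punctured_disk_diagram n \<gamma>" and "i < n"
  shows "immersion_to (lens_pr p q) (\<lambda>t. surgery_embed p q (\<gamma> i t))"
proof (rule immersion_surgery_embed[OF assms(1)])
  show s: "smooth_on UNIV (\<gamma> i)" and "fst (\<gamma> i t) \<noteq> 0" for t
    using assms(2,3) by (auto simp: punctured_disk_diagram_def)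
  fix t
  let ?D = "frechet_derivative (\<gamma> i) (at t)"
  have D: "(\<gamma> i has_derivative ?D) (at t)" by (rule smooth_on_has_derivative[OF s]) auto
  have lin: "linear ?D" by (rule has_derivative_linear[OF D])
  have scale: "?D v = v *\<^sub>R ?D 1" for v using linear_scale[OF lin, of v 1] by simp
  have "((\<lambda>u. fst (\<gamma> i u)) has_derivative (\<lambda>v. fst (?D v))) (at t)"
    using D by (rule has_derivative_fst)
  hence "((\<lambda>u. fst (\<gamma> i u)) has_vector_derivative fst (?D 1)) (at t)"
    unfolding has_vector_derivative_def by (subst (asm) scale) simp
  hence "vector_derivative (\<lambda>u. fst (\<gamma> i u)) (at t) = fst (?D 1)" by (rule vector_derivative_at)
  hence "fst (?D 1) \<noteq> 0"
    using assms(2,3) unfolding punctured_disk_diagram_def Let_def by metis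
  hence "?D v = 0 \<Longrightarrow> v = 0" for v using scale[of v] by auto
  thus "inj ?D" using linear_injective_0[OF lin] by blast
qed

lemma diagram_inj:
  assumes "0 < p" and "punctured_disk_diagram n \<gamma>" and "i < n" and "j < n"
  shows "surgery_embed p q (\<gamma> i t) = surgery_embed p q (\<gamma> j t') \<longleftrightarrow> i = j \<and> t - t' \<in> \<int>"
proof -
  have "fst (\<gamma> i t) \<noteq> 0" "fst (\<gamma> j t') \<noteq> 0" "\<gamma> i t = \<gamma> j t' \<longleftrightarrow> i = j \<and> t - t' \<in> \<int>"
    using assms(2-4) by (auto simp: punctured_disk_diagram_def)
  thus ?thesis using surgery_embed_inject[OF assms(1)] by simp
qed

lemma surgery_diagram_core:
  "surgery_embed p q ` diagram_core n \<gamma> = (\<Union>i<n. range (\<lambda>t. surgery_embed p q (\<gamma> i t)))"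
  by (auto simp: diagram_core_def)

lemma diagram_is_link:
  assumes "0 < p" and "punctured_disk_diagram n \<gamma>"
  shows "is_link (lens_pr p q) (surgery_embed p q ` diagram_core n \<gamma>)"
  unfolding is_link_def surgery_diagram_core
  using diagram_immersion[OF assms] diagram_inj[OF assms]
  by (intro exI[of _ n] exI[of _ "\<lambda>i t. surgery_embed p q (\<gamma> i t)"]) auto

text \<open>For a curve \<open>k\<close> with velocity \<open>2 \<pi> c k\<close> and height \<open>h\<close>, the following is the blackboard band of
  width \<open>1 / (40 \<pi>)\<close>, so that the collar parameter \<open>s\<close> changes \<open>k\<close> by the factor
  \<open>1 + s \<i> c / 20\<close>.\<close>

definition band :: "(real \<Rightarrow> complex) \<Rightarrow> (real \<Rightarrow> complex) \<Rightarrow> (real \<Rightarrow> real) \<Rightarrow> real \<times> real \<Rightarrow> complex \<times> real" where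
  "band k c h = (\<lambda>x. (k (fst x) * (1 + of_real (snd x / 20) * (\<i> * c (fst x))), h (fst x)))"

text \<open>On a vector of the kernel of the derivative, \<open>h\<close> is stationary, and hence so is \<open>c\<close>.  After division
  by \<open>k c\<close>, the motion along the curve has a nonzero real part, the motion across the band none.\<close>

lemma band_immersive:
  fixes k c :: "real \<Rightarrow> complex"
  assumes k: "(k has_vector_derivative 2 * pi * c t * k t) (at t)"
    and c: "(c has_vector_derivative c') (at t)" and h: "(h has_real_derivative h') (at t)"
    and h0: "h' = 0 \<Longrightarrow> c' = 0" and nz: "k t \<noteq> 0" "c t \<noteq> 0" "Re (1 + of_real (s / 20) * (\<i> * c t)) \<noteq> 0"
  shows "inj (frechet_derivative (band k c h) (at (t, s)))"
proof -
  let ?x = "(t, s)"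
  have comp: "((\<lambda>x. f (fst x)) has_derivative (\<lambda>v. fst v *\<^sub>R f')) (at ?x)"
    if "(f has_vector_derivative f') (at t)" for f :: "real \<Rightarrow> complex" and f'
    using has_derivative_compose[OF has_derivative_fst[OF has_derivative_ident], of f "\<lambda>v. v *\<^sub>R f'" ?x UNIV] that
    by (simp add: has_vector_derivative_def)
  have hh: "((\<lambda>x. h (fst x)) has_derivative (\<lambda>v. h' * fst v)) (at ?x)"
    using has_derivative_compose[OF has_derivative_fst[OF has_derivative_ident], of h "\<lambda>v. h' * v" ?x UNIV] h
    by (simp add: has_field_derivative_def)
  have ss: "((\<lambda>x. complex_of_real (snd x / 20)) has_derivative (\<lambda>v. of_real (snd v / 20))) (at ?x)"
    by (auto intro!: derivative_eq_intros)
  define D where "D v = (k t * (of_real (s / 20) * (\<i> * (fst v *\<^sub>R c')) + of_real (snd v / 20) * (\<i> * c t))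
      + fst v *\<^sub>R (2 * pi * c t * k t) * (1 + of_real (s / 20) * (\<i> * c t)), h' * fst v)" for v
  have d: "(band k c h has_derivative D) (at ?x)"
    unfolding band_def D_def
    by (rule has_derivative_eq_rhs, (rule has_derivative_Pair has_derivative_mult has_derivative_add
        comp[OF k] comp[OF c] hh ss has_derivative_const)+) (auto simp: fun_eq_iff)
  have "D v = 0 \<Longrightarrow> v = 0" for v
  proof -
    assume Dv: "D v = 0"
    hence "snd (D v) = 0" by simp
    hence "fst v = 0 \<or> c' = 0" using h0 by (auto simp: D_def)
    hence c0: "fst v *\<^sub>R c' = 0" by auto
    have "k t * c t * (of_real (snd v / 20) * \<i> + of_real (2 * pi * fst v) * (1 + of_real (s / 20) * (\<i> * c t)))
        = fst (D v)"
      unfolding D_def fst_conv c0 by (simp add: algebra_simps scaleR_conv_of_real)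
    also have "\<dots> = 0" using Dv by simp
    finally have e: "of_real (snd v / 20) * \<i> + of_real (2 * pi * fst v) * (1 + of_real (s / 20) * (\<i> * c t)) = 0"
      using nz by simp
    hence "2 * pi * fst v * Re (1 + of_real (s / 20) * (\<i> * c t)) = 0"
      by (simp add: complex_eq_iff)
    hence 1: "fst v = 0" using nz(3) by simp
    with e have "snd v = 0" by simp
    with 1 show "v = 0" by (simp add: prod_eq_iff)
  qed
  hence "inj D" using linear_injective_0[OF has_derivative_linear[OF d]] by blast
  thus ?thesis using frechet_derivative_at[OF d] by simp
qed

lemma smooth_on_band:
  "smooth_on UNIV k \<Longrightarrow> smooth_on UNIV c \<Longrightarrow> smooth_on UNIV h \<Longrightarrow> smooth_on UNIV (band k c h)"
proof -
  have fst: "smooth_on UNIV (\<lambda>x::real \<times> real. f (fst x))" if "smooth_on UNIV f" for f :: "real \<Rightarrow> 'a::euclidean_space"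
    by (rule smooth_on_compose[OF that]) (auto intro: smooth_intros)
  assume "smooth_on UNIV k" "smooth_on UNIV c" "smooth_on UNIV h"
  note f = this[THEN fst]
  have e: "snd x / 20 = snd x * (1 / 20)" for x :: "real \<times> real" by simp
  show ?thesis unfolding band_def e by (intro smooth_intros f)
qed

lemma KBSM_diagram_nonempty:
  fixes k c :: "nat \<Rightarrow> real \<Rightarrow> complex"
  assumes p: "0 < p" and diag: "punctured_disk_diagram n (\<lambda>i t. (k i t, h i t))"
    and smooth: "\<And>i. i < n \<Longrightarrow> smooth_on UNIV (k i)" "\<And>i. i < n \<Longrightarrow> smooth_on UNIV (c i)"
      "\<And>i. i < n \<Longrightarrow> smooth_on UNIV (h i)"
    and k': "\<And>i t. i < n \<Longrightarrow> (k i has_vector_derivative 2 * pi * c i t * k i t) (at t)"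
    and nz: "\<And>i t s. i < n \<Longrightarrow> \<bar>s\<bar> < 2 \<Longrightarrow> fst (band (k i) (c i) (h i) (t, s)) \<noteq> 0"
    and imm: "\<And>i t s. i < n \<Longrightarrow> \<bar>s\<bar> < 2 \<Longrightarrow> inj (frechet_derivative (band (k i) (c i) (h i)) (at (t, s)))"
    and inj: "\<And>i j t t' s s'. i < n \<Longrightarrow> j < n \<Longrightarrow> \<bar>s\<bar> < 2 \<Longrightarrow> \<bar>s'\<bar> < 2 \<Longrightarrow>
      band (k i) (c i) (h i) (t, s) = band (k j) (c j) (h j) (t', s') \<longleftrightarrow> i = j \<and> t - t' \<in> \<int> \<and> s = s'"
  shows "KBSM p q (surgery_embed p q ` diagram_core n (\<lambda>i t. (k i t, h i t))) \<noteq> {}"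
proof -
  let ?\<gamma> = "\<lambda>i t. (k i t, h i t)" and ?B = "\<lambda>i. band (k i) (c i) (h i)" and ?\<epsilon> = "1 / (40 * pi)"
  have core: "diagram_core n ?\<gamma> = (\<Union>i<n. ?B i ` (UNIV \<times> {0}))"
    by (force simp: diagram_core_def band_def)
  have pt: "(k i t + of_real (?\<epsilon> * s) * \<i> * vector_derivative (k i) (at t), h i t) = ?B i (t, s)"
    if "i < n" for i t s
    unfolding vector_derivative_at[OF k'[OF that]] band_def by (simp add: field_simps)
  have band: "blackboard_band n ?\<gamma> ?\<epsilon> = (\<Union>i<n. ?B i ` (UNIV \<times> {- 1..1}))"
  proof -
    have "{(fst (?\<gamma> i t) + of_real (?\<epsilon> * s) * \<i> * vector_derivative (\<lambda>u. fst (?\<gamma> i u)) (at t),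
        snd (?\<gamma> i t)) | t s. s \<in> {- 1..1}} = ?B i ` (UNIV \<times> {- 1..1})" if "i < n" for i
      using pt[OF that] by (auto simp: image_iff) metis+
    thus ?thesis unfolding blackboard_band_def by (intro SUP_cong) auto
  qed
  have "(surgery_embed p q ` diagram_core n ?\<gamma>, surgery_embed p q ` blackboard_band n ?\<gamma> ?\<epsilon>)
      \<in> framed_links (lens_pr p q)"
    unfolding core band
    by (rule framed_link_surgery_embed[OF p]) (use nz imm inj smooth smooth_on_band in auto)
  moreover have "\<forall>(z, y)\<in>blackboard_band n ?\<gamma> ?\<epsilon>. z \<noteq> 0"
  proof -
    have "fst (?B i (t, s)) \<noteq> 0" if "i < n" "s \<in> {- 1..1}" for i t s
      by (rule nz) (use that in auto)
    hence "\<forall>y\<in>\<Union>i<n. ?B i ` (UNIV \<times> {- 1..1}). fst y \<noteq> 0" by auto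
    thus ?thesis unfolding band by (simp add: case_prod_unfold)
  qed
  moreover have "0 < ?\<epsilon>" by simp
  ultimately show ?thesis
    unfolding KBSM_def using diag equivalent_refl by blast
qed

lemma number_of_components_diagram:
  assumes "euclidean_quotient (lens_pr p q) E" and "0 < p" and "punctured_disk_diagram n \<gamma>"
  shows "euclidean_quotient.number_of_components (lens_pr p q) E
    (surgery_embed p q ` diagram_core n \<gamma>) = n"
  unfolding surgery_diagram_core
  by (rule euclidean_quotient.number_of_components_link[OF assms(1)])
    (simp_all add: diagram_immersion[OF assms(2,3)] diagram_inj[OF assms(2,3)])

text \<open>If the monomials agree at two points, their first coordinates differ by a root of unity, and the
  product \<open>z w\<close> forces its inverse upon the second coordinates.  For \<open>z = 0\<close> the product says
  nothing, but then \<open>w\<^sup>p\<close> alone separates.\<close>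

lemma euclidean_quotient_lens_space:
  assumes "0 < p"
  shows "euclidean_quotient (lens_pr p 1) (\<lambda>x. (fst x ^ p, snd x ^ p, fst x * snd x))"
proof
  show "continuous_on S3 (\<lambda>x::complex \<times> complex. (fst x ^ p, snd x ^ p, fst x * snd x))"
    by (intro continuous_intros)
next
  fix x y :: "complex \<times> complex" assume S3: "x \<in> S3" "y \<in> S3"
  define \<zeta> where "\<zeta> m = cis (2 * pi * of_int m / of_nat p)" for m
  have \<zeta>: "\<zeta> m ^ p = 1" "\<zeta> m * \<zeta> (- m) = 1" "cis (- (2 * pi * of_int m * of_nat 1 / of_nat p)) = \<zeta> (- m)" for m
  proof -
    have "\<zeta> m ^ p = cis (2 * pi * of_int m)" using assms by (simp add: \<zeta>_def Complex.DeMoivre)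
    also have "\<dots> = 1" by (rule cis_multiple_2pi) auto
    finally show "\<zeta> m ^ p = 1" .
  qed (simp_all add: \<zeta>_def cis_mult)
  have orbit: "lens_pr p 1 (\<zeta> m * fst u, \<zeta> (- m) * snd u) = lens_pr p 1 u" for m u
    using lens_pr_orbit[of p 1 m "fst u" "snd u"] unfolding \<zeta>(3) unfolding \<zeta>_def by simp
  have root: "\<exists>m. b = \<zeta> m * a" if "a ^ p = b ^ p" "a \<noteq> 0" for a b
  proof -
    have "b ^ p \<noteq> 0" using that by (metis power_not_zero)
    hence "(b / a) ^ p = 1" using that by (simp add: power_divide)
    then obtain j where "b / a = cis (2 * pi * real j / real p)"
      using bij_betw_imp_surj_on[OF Complex.bij_betw_roots_unity[OF assms]] by (metis (mono_tags, lifting) imageE mem_Collect_eq)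
    thus ?thesis using that(2) unfolding \<zeta>_def
      by (intro exI[of _ "int j"]) (simp add: field_simps)
  qed
  show "(fst x ^ p, snd x ^ p, fst x * snd x) = (fst y ^ p, snd y ^ p, fst y * snd y) \<longleftrightarrow>
      lens_pr p 1 x = lens_pr p 1 y" (is "?l \<longleftrightarrow> ?r")
  proof
    assume ?l
    hence eq: "fst x ^ p = fst y ^ p" "snd x ^ p = snd y ^ p" "fst x * snd x = fst y * snd y" by auto
    have "\<exists>m. y = (\<zeta> m * fst x, \<zeta> (- m) * snd x)"
    proof (cases "fst x = 0")
      case False
      then obtain m where m: "fst y = \<zeta> m * fst x" using root[OF eq(1)] by blast
      have "snd x = \<zeta> m * snd y" using eq(3) False unfolding m by simp
      hence "\<zeta> (- m) * snd x = snd y" using \<zeta>(2)[of m] by (simp add: mult.commute mult.left_commute)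
      thus ?thesis using m by (metis prod.collapse)
    next
      case True
      hence 0: "fst y = 0" using eq(1) assms by (simp add: zero_power power_eq_0_iff)
      have "snd x \<noteq> 0" using True S3(1) by (cases x) (auto simp: S3_def norm_Pair)
      then obtain m where "snd y = \<zeta> m * snd x" using root[OF eq(2)] by blast
      thus ?thesis using True 0 by (intro exI[of _ "- m"]) (simp add: prod_eq_iff)
    qed
    then obtain m where "y = (\<zeta> m * fst x, \<zeta> (- m) * snd x)" by blast
    thus ?r using orbit by simp
  next
    assume r: ?r
    have "y = (cis (2 * pi * of_int 0 / of_nat p) * fst y,
       cis (- (2 * pi * of_int 0 * of_nat 1 / of_nat p)) * snd y)" by simp
    hence "y \<in> lens_pr p 1 y" unfolding lens_pr_def by blast
    hence "y \<in> lens_pr p 1 x" unfolding r .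
    then obtain m where y: "y = (\<zeta> m * fst x, \<zeta> (- m) * snd x)"
      unfolding lens_pr_def \<zeta>(3) \<zeta>_def[symmetric] by blast
    have "fst y * snd y = (\<zeta> m * \<zeta> (- m)) * (fst x * snd x)" by (simp only: y fst_conv snd_conv ac_simps)
    thus ?l by (simp add: y power_mult_distrib \<zeta>)
  qed
qed

section \<open>Two links with the same lift\<close>

text \<open>The curve \<open>w = z\<close> of the sphere in the coordinates of the punctured plane: \<open>h + \<i> ln \<bar>c\<bar>\<close> runs once
  around the unit circle while the argument of \<open>c\<close> increases by \<open>4 \<pi>\<close>.  Its diagram crosses itself
  once, at \<open>c = 1\<close>.  The direction \<open>knot_c\<close> is the logarithmic derivative of \<open>knot_k\<close>, divided by \<open>2 \<pi>\<close>.\<close>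

definition knot_c :: "real \<Rightarrow> complex" where
  "knot_c t = Complex (cos (2 * pi * t)) 2"

definition knot_k :: "real \<Rightarrow> complex" where
  "knot_k t = exp (Complex (sin (2 * pi * t)) (2 * (2 * pi * t)))"

definition knot_h :: "real \<Rightarrow> real" where
  "knot_h t = cos (2 * pi * t)"

text \<open>Points of the band at the same height \<open>a\<close> have parameters \<open>\<plusminus> \<theta>\<close>, with \<open>\<plusminus> s\<close> the sine; for small
  \<open>s\<close> they are close to each other, near the highest or the lowest point of the knot.  Comparing
  absolute values shows that \<open>s\<close> is small if two such points coincide.  Eliminating \<open>K'\<close> then leaves
  a single equation \<open>E (1 + \<dots>) = 1\<close> with \<open>E > 1\<close>, in which the linear term in \<open>s\<close> is positive and
  dominates the quadratic one.\<close>

lemma knot_band_aux: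
  fixes a s K K' :: real
  assumes as: "a\<^sup>2 + s\<^sup>2 = 1" and s: "0 < s" and K: "\<bar>K\<bar> < 1 / 10" "\<bar>K'\<bar> < 1 / 10"
    and eq: "of_real (exp s) * (Complex a s)\<^sup>2 * Complex (1 - 2 * K) (K * a) =
      of_real (exp (- s)) * (Complex a (- s))\<^sup>2 * Complex (1 - 2 * K') (K' * a)"
  shows False
proof -
  define E where "E = exp (2 * s)"
  define A B where "A = a\<^sup>2 - s\<^sup>2" and "B = 2 * a * s"
  have sq: "(Complex a s)\<^sup>2 = Complex A B" "(Complex a (- s))\<^sup>2 = Complex A (- B)"
    by (simp_all add: A_def B_def power2_eq_square complex_eq_iff)
  have "exp s * exp s = E" "exp s * exp (- s) = 1"
    by (simp_all add: E_def mult_exp_exp)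
  hence "of_real (exp s) * (of_real (exp s) * z) = of_real E * z"
      "of_real (exp s) * (of_real (exp (- s)) * z) = z" for z :: complex
    by (metis mult.assoc of_real_mult, metis mult.assoc of_real_mult of_real_1 mult_1_left)
  hence eq': "of_real E * (Complex A B * Complex (1 - 2 * K) (K * a)) = Complex A (- B) * Complex (1 - 2 * K') (K' * a)"
    using arg_cong[OF eq, of "\<lambda>z. of_real (exp s) * z"] by (simp only: sq mult.assoc)
  have e1: "E * (A * (1 - 2 * K) - B * (K * a)) = A * (1 - 2 * K') + B * (K' * a)"
   and e2: "E * (A * (K * a) + B * (1 - 2 * K)) = A * (K' * a) - B * (1 - 2 * K')"
    using eq' by (auto simp: complex_eq_iff)
  have AB: "A\<^sup>2 + B\<^sup>2 = 1"
  proof -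
    have "A\<^sup>2 + B\<^sup>2 = (a\<^sup>2 + s\<^sup>2)\<^sup>2" by (simp add: A_def B_def power2_eq_square algebra_simps)
    thus ?thesis by (simp add: as)
  qed
  have a2: "a\<^sup>2 \<le> 1" "0 \<le> a\<^sup>2" using as zero_le_power2[of s] by (linarith, simp)
  have E: "1 + 2 * s \<le> E" using exp_ge_add_one_self[of "2 * s"] by (simp add: E_def)
  have norm: "E\<^sup>2 * ((1 - 2 * K)\<^sup>2 + K\<^sup>2 * a\<^sup>2) = (1 - 2 * K')\<^sup>2 + K'\<^sup>2 * a\<^sup>2"
  proof -
    have "E\<^sup>2 * ((A\<^sup>2 + B\<^sup>2) * ((1 - 2 * K)\<^sup>2 + K\<^sup>2 * a\<^sup>2)) =
        (E * (A * (1 - 2 * K) - B * (K * a)))\<^sup>2 + (E * (A * (K * a) + B * (1 - 2 * K)))\<^sup>2"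
      by algebra
    also have "\<dots> = (A\<^sup>2 + B\<^sup>2) * ((1 - 2 * K')\<^sup>2 + K'\<^sup>2 * a\<^sup>2)"
      unfolding e1 e2 by algebra
    finally show ?thesis by (simp add: AB)
  qed
  have s3: "s \<le> 1 / 3"
  proof -
    have "(4 / 5)\<^sup>2 \<le> (1 - 2 * K)\<^sup>2" by (rule power_mono) (use K in auto)
    hence X: "16 / 25 \<le> (1 - 2 * K)\<^sup>2 + K\<^sup>2 * a\<^sup>2" by (simp add: power2_eq_square add_increasing2)
    have "(1 - 2 * K')\<^sup>2 \<le> (6 / 5)\<^sup>2" by (rule power_mono) (use K in auto)
    moreover have "K'\<^sup>2 * a\<^sup>2 \<le> (1 / 10)\<^sup>2 * 1"
      by (intro mult_mono a2) (use K abs_le_square_iff[of K' "1 / 10"] in auto)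
    ultimately have Y: "(1 - 2 * K')\<^sup>2 + K'\<^sup>2 * a\<^sup>2 \<le> 145 / 100" by (simp add: power2_eq_square)
    have "E\<^sup>2 * (16 / 25) \<le> E\<^sup>2 * ((1 - 2 * K)\<^sup>2 + K\<^sup>2 * a\<^sup>2)" by (rule mult_left_mono[OF X]) simp
    hence "E\<^sup>2 * (16 / 25) \<le> 145 / 100" using norm Y by simp
    moreover have "1 + 4 * s \<le> E\<^sup>2"
      using exp_ge_add_one_self[of "4 * s"] by (simp add: E_def power2_eq_square mult_exp_exp)
    ultimately show ?thesis by linarith
  qed
  have elim: "E * (a * (A\<^sup>2 - B\<^sup>2) + 2 * A * B * (2 - 4 * K - K * a\<^sup>2)) = a"
  proof -
    have "E * (a * (A\<^sup>2 - B\<^sup>2) + 2 * A * B * (2 - 4 * K - K * a\<^sup>2)) =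
        (E * (A * (1 - 2 * K) - B * (K * a))) * (A * a + 2 * B) -
        (E * (A * (K * a) + B * (1 - 2 * K))) * (- 2 * A + B * a)"
      by algebra
    also have "\<dots> = a * (A\<^sup>2 + B\<^sup>2)" unfolding e1 e2 by algebra
    finally show ?thesis by (simp add: AB)
  qed
  have A: "A = 1 - 2 * s\<^sup>2" and C: "A\<^sup>2 - B\<^sup>2 = 1 - 8 * s\<^sup>2 * a\<^sup>2"
  proof -
    show "A = 1 - 2 * s\<^sup>2" using as by (simp add: A_def)
    have "A\<^sup>2 - B\<^sup>2 = (A\<^sup>2 + B\<^sup>2) - 2 * B\<^sup>2" by simp
    also have "\<dots> = 1 - 8 * s\<^sup>2 * a\<^sup>2" unfolding AB by (simp add: B_def power_mult_distrib)
    finally show "A\<^sup>2 - B\<^sup>2 = 1 - 8 * s\<^sup>2 * a\<^sup>2" .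
  qed
  have ss: "s\<^sup>2 \<le> s / 3" "s\<^sup>2 \<le> 1 / 9"
    using mult_left_mono[OF s3, of s] s mult_mono[OF s3 s3] by (auto simp: power2_eq_square)
  have "a \<noteq> 0" using as ss by auto
  have "a * (E * (1 - 8 * s\<^sup>2 * a\<^sup>2 + 4 * s * (1 - 2 * s\<^sup>2) * (2 - 4 * K - K * a\<^sup>2))) = a"
    using elim unfolding C unfolding A B_def by (simp add: algebra_simps)
  hence one: "E * (1 - 8 * s\<^sup>2 * a\<^sup>2 + 4 * s * (1 - 2 * s\<^sup>2) * (2 - 4 * K - K * a\<^sup>2)) = 1"
    using \<open>a \<noteq> 0\<close> by simp
  have "\<bar>K * a\<^sup>2\<bar> \<le> 1 / 10 * 1" unfolding abs_mult by (rule mult_mono) (use K a2 in auto)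
  hence "3 / 2 \<le> 2 - 4 * K - K * a\<^sup>2" using K by linarith
  moreover have "7 / 9 \<le> 1 - 2 * s\<^sup>2" using ss by simp
  ultimately have "7 / 9 * (3 / 2) \<le> (1 - 2 * s\<^sup>2) * (2 - 4 * K - K * a\<^sup>2)" by (intro mult_mono) auto
  hence "4 * s * (7 / 9 * (3 / 2)) \<le> 4 * s * ((1 - 2 * s\<^sup>2) * (2 - 4 * K - K * a\<^sup>2))"
    by (rule mult_left_mono) (use s in simp)
  hence 1: "14 / 3 * s \<le> 4 * s * (1 - 2 * s\<^sup>2) * (2 - 4 * K - K * a\<^sup>2)" by (simp add: mult.assoc)
  have "s\<^sup>2 * a\<^sup>2 \<le> s / 3 * 1" by (rule mult_mono) (use ss a2 s in auto)
  hence "1 \<le> 1 - 8 * s\<^sup>2 * a\<^sup>2 + 4 * s * (1 - 2 * s\<^sup>2) * (2 - 4 * K - K * a\<^sup>2)"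
    using 1 s by linarith
  hence "E * 1 \<le> E * (1 - 8 * s\<^sup>2 * a\<^sup>2 + 4 * s * (1 - 2 * s\<^sup>2) * (2 - 4 * K - K * a\<^sup>2))"
    by (rule mult_left_mono) (simp add: E_def)
  thus False using one E s by simp
qed

lemma knot_k_eq: "knot_k t = of_real (exp (sin (2 * pi * t))) * (Complex (cos (2 * pi * t)) (sin (2 * pi * t)))\<^sup>2"
proof -
  have "cis (2 * (2 * pi * t)) = (cis (2 * pi * t))\<^sup>2" by (simp add: Complex.DeMoivre)
  thus ?thesis unfolding knot_k_def exp_eq_polar[of "Complex _ _"] by (simp add: cis.code)
qed

lemma knot_nz: "knot_k t \<noteq> 0" "knot_c t \<noteq> 0" "\<bar>s\<bar> < 2 \<Longrightarrow> Re (1 + of_real (s / 20) * (\<i> * knot_c t)) \<noteq> 0"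
  by (simp add: knot_k_def) (auto simp: knot_c_def complex_eq_iff)

lemma knot_band_eq:
  "band knot_k knot_c knot_h (t, s) = (knot_k t * Complex (1 - 2 * (s / 20)) (s / 20 * cos (2 * pi * t)), cos (2 * pi * t))"
  unfolding band_def knot_c_def knot_h_def by (simp add: complex_eq_iff)

lemma knot_band_inj:
  assumes s: "\<bar>s\<bar> < 2" "\<bar>s'\<bar> < 2"
  shows "band knot_k knot_c knot_h (t, s) = band knot_k knot_c knot_h (t', s') \<longleftrightarrow> t - t' \<in> \<int> \<and> s = s'"
proof
  define \<theta> \<theta>' where "\<theta> = 2 * pi * t" and "\<theta>' = 2 * pi * t'"
  assume eq: "band knot_k knot_c knot_h (t, s) = band knot_k knot_c knot_h (t', s')"
  hence c: "cos \<theta>' = cos \<theta>" and e: "knot_k t * Complex (1 - 2 * (s / 20)) (s / 20 * cos \<theta>) =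
      knot_k t' * Complex (1 - 2 * (s' / 20)) (s' / 20 * cos \<theta>')"
    unfolding knot_band_eq \<theta>_def \<theta>'_def by auto
  have K: "\<bar>s / 20\<bar> < 1 / 10" "\<bar>s' / 20\<bar> < 1 / 10" using s by auto
  have as: "(cos \<theta>)\<^sup>2 + (sin \<theta>)\<^sup>2 = 1" by simp
  have "(sin \<theta>)\<^sup>2 = (sin \<theta>')\<^sup>2" unfolding sin_squared_eq c ..
  then consider "sin \<theta>' = sin \<theta>" | "sin \<theta>' = - sin \<theta>" "0 < sin \<theta>" | "sin \<theta>' = - sin \<theta>" "sin \<theta> < 0"
    by (metis power2_eq_iff linorder_neqE_linordered_idom neg_equal_zero)
  thus "t - t' \<in> \<int> \<and> s = s'"
  proof cases
    case 1
    hence "cis \<theta> = cis \<theta>'" using c by (simp add: complex_eq_iff)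
    hence "t - t' \<in> \<int>" unfolding \<theta>_def \<theta>'_def cis_2pi_eq_iff .
    moreover have "knot_k t' = knot_k t" unfolding knot_k_eq \<theta>_def[symmetric] \<theta>'_def[symmetric] 1 c ..
    hence "Complex (1 - 2 * (s / 20)) (s / 20 * cos \<theta>) = Complex (1 - 2 * (s' / 20)) (s' / 20 * cos \<theta>)"
      using e knot_nz(1)[of t] by (simp only: c mult_cancel_left) simp
    hence "s = s'" by simp
    ultimately show ?thesis by blast
  next
    case 2
    have False
      by (rule knot_band_aux[OF as 2(2) K])
        (use e in \<open>simp add: knot_k_eq \<theta>_def[symmetric] \<theta>'_def[symmetric] 2 c\<close>)
    thus ?thesis ..
  next
    case 3
    have as': "(cos \<theta>)\<^sup>2 + (- sin \<theta>)\<^sup>2 = 1" by simp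
    have False
      by (rule knot_band_aux[OF as' _ K(2,1)])
        (use 3(2) e in \<open>simp_all add: knot_k_eq \<theta>_def[symmetric] \<theta>'_def[symmetric] 3(1) c\<close>)
    thus ?thesis ..
  qed
next
  assume "t - t' \<in> \<int> \<and> s = s'"
  hence "cis (2 * pi * t) = cis (2 * pi * t')" "s = s'" using cis_2pi_eq_iff by blast+
  thus "band knot_k knot_c knot_h (t, s) = band knot_k knot_c knot_h (t', s')"
    unfolding knot_band_eq knot_k_eq by (simp add: complex_eq_iff)
qed

lemma knot_k_deriv: "(knot_k has_vector_derivative 2 * pi * knot_c t * knot_k t) (at t)"
proof -
  have "((\<lambda>t. of_real (sin (2 * pi * t)) + \<i> * of_real (2 * (2 * pi * t))) has_vector_derivative
      of_real (2 * pi * cos (2 * pi * t)) + \<i> * of_real (4 * pi)) (at t)"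
    by (intro has_vector_derivative_add has_vector_derivative_mult_right has_vector_derivative_of_real)
      (auto intro!: derivative_eq_intros simp: has_real_derivative_iff_has_vector_derivative[symmetric])
  from field_vector_diff_chain_at[OF this DERIV_exp]
  show ?thesis
    by (simp add: o_def knot_k_def[abs_def] Complex_eq knot_c_def algebra_simps)
qed

lemma knot_smooth: "smooth_on UNIV knot_k" "smooth_on UNIV knot_c" "smooth_on UNIV knot_h"
  unfolding knot_k_def knot_c_def knot_h_def by (intro smooth_intros)+

lemma knot_immersive:
  assumes "\<bar>s\<bar> < 2"
  shows "inj (frechet_derivative (band knot_k knot_c knot_h) (at (t, s)))"
proof (rule band_immersive[OF knot_k_deriv])
  have "(knot_h has_real_derivative - 2 * pi * sin (2 * pi * t)) (at t)"
    unfolding knot_h_def by (auto intro!: derivative_eq_intros)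
  thus h: "(knot_h has_real_derivative - 2 * pi * sin (2 * pi * t)) (at t)" .
  have "((\<lambda>t. of_real (knot_h t) + Complex 0 2) has_vector_derivative
      of_real (- 2 * pi * sin (2 * pi * t)) + 0) (at t)"
    by (intro has_vector_derivative_add has_vector_derivative_of_real has_vector_derivative_const)
      (use h in \<open>simp add: has_real_derivative_iff_has_vector_derivative\<close>)
  moreover have "(\<lambda>t. of_real (knot_h t) + Complex 0 2) = knot_c"
    by (auto simp: knot_h_def knot_c_def complex_eq_iff)
  ultimately show "(knot_c has_vector_derivative of_real (- 2 * pi * sin (2 * pi * t))) (at t)" by simp
qed (use knot_nz assms in auto)

lemma knot_diagram: "punctured_disk_diagram 1 (\<lambda>i t. (knot_k t, knot_h t))"
proof -
  have inj: "(knot_k t, knot_h t) = (knot_k t', knot_h t') \<longleftrightarrow> t - t' \<in> \<int>" for t t'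
    using knot_band_inj[of 0 0 t t'] by (simp add: band_def)
  have double: "t = 0 \<and> s = 1 / 2 \<or> t = 1 / 2 \<and> s = 0"
    if ts: "t \<in> {0..<1}" "s \<in> {0..<1}" "knot_k t = knot_k s" "t \<noteq> s" for t s
  proof -
    obtain n :: int where n: "Complex (sin (2 * pi * t)) (2 * (2 * pi * t)) =
        Complex (sin (2 * pi * s)) (2 * (2 * pi * s)) + (of_int (2 * n) * pi) * \<i>"
      using ts(3) unfolding knot_k_def exp_eq by blast
    hence sin: "sin (2 * pi * t) = sin (2 * pi * s)" and "2 * (2 * pi * t) = 2 * (2 * pi * s) + of_int (2 * n) * pi"
      by (auto simp: complex_eq_iff)
    hence "pi * (4 * t) = pi * (4 * s + 2 * of_int n)" by (simp add: algebra_simps)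
    hence d: "2 * (t - s) = of_int n" by simp
    hence "n \<noteq> 0" "- 2 < real_of_int n" "real_of_int n < 2" using ts by auto
    hence "n = 1 \<or> n = - 1" by linarith
    hence "t = s + 1 / 2 \<or> s = t + 1 / 2" using d by auto
    thus ?thesis
    proof
      assume t: "t = s + 1 / 2"
      hence "2 * pi * t = 2 * pi * s + pi" by (simp add: algebra_simps)
      hence "sin (2 * pi * s) = 0" using sin by simp
      moreover have "0 \<le> 2 * pi * s" "2 * pi * s < pi" using ts(1,2) t by auto
      ultimately have "2 * pi * s = 0" using sin_gt_zero[of "2 * pi * s"] by fastforce
      thus ?thesis using t by simp
    next
      assume t: "s = t + 1 / 2"
      hence "2 * pi * s = 2 * pi * t + pi" by (simp add: algebra_simps)
      hence "sin (2 * pi * t) = 0" using sin by simp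
      moreover have "0 \<le> 2 * pi * t" "2 * pi * t < pi" using ts(1,2) t by auto
      ultimately have "2 * pi * t = 0" using sin_gt_zero[of "2 * pi * t"] by fastforce
      thus ?thesis using t by simp
    qed
  qed
  define pre where "pre c = {(i::nat, t). i < 1 \<and> t \<in> {0..<1} \<and> knot_k t = c}" for c
  have small: "pre c \<subseteq> {(0, 0), (0, 1 / 2)} \<and> c = knot_k 0 \<or> (\<exists>x. pre c \<subseteq> {x})" for c
  proof (cases "\<exists>x y. x \<in> pre c \<and> y \<in> pre c \<and> x \<noteq> y")
    case True
    then obtain t s where ts: "t \<in> {0..<1}" "s \<in> {0..<1}" "knot_k t = c" "knot_k s = c" "t \<noteq> s"
      by (auto simp: pre_def)
    have "t = 0 \<and> s = 1 / 2 \<or> t = 1 / 2 \<and> s = 0" by (rule double) (use ts in auto)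
    hence c: "c = knot_k 0" "c = knot_k (1 / 2)" using ts(3,4) by metis+
    have "t = 0 \<or> t = 1 / 2" if "t \<in> {0..<1}" "knot_k t = c" for t
      using double[of t 0] that c by auto
    hence "pre c \<subseteq> {(0, 0), (0, 1 / 2)}" unfolding pre_def by blast
    thus ?thesis using c(1) by blast
  qed blast
  have fin: "finite (pre c)" "card (pre c) \<le> 2" for c
  proof -
    have "finite (pre c) \<and> card (pre c) \<le> 2" using small[of c]
    proof (elim disjE conjE exE)
      assume "pre c \<subseteq> {(0, 0), (0, 1 / 2)}"
      thus ?thesis using card_mono[of "{(0::nat, 0::real), (0, 1 / 2)}" "pre c"] finite_subset by fastforce
    next
      fix x assume "pre c \<subseteq> {x}"
      thus ?thesis using card_mono[of "{x}" "pre c"] finite_subset by fastforce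
    qed
    thus "finite (pre c)" "card (pre c) \<le> 2" by auto
  qed
  have "{c. card (pre c) = 2} \<subseteq> {knot_k 0}"
  proof clarify
    fix c assume "card (pre c) = 2"
    hence "\<not> pre c \<subseteq> {x}" for x using card_mono[of "{x}" "pre c"] by auto
    thus "c = knot_k 0" using small[of c] by blast
  qed
  hence fin2: "finite {c. card (pre c) = 2}" using finite_subset by blast
  have vd: "vector_derivative knot_k (at t) = 2 * pi * knot_c t * knot_k t" for t
    by (rule vector_derivative_at[OF knot_k_deriv])
  have trans: "Im (cnj (vector_derivative knot_k (at t)) * vector_derivative knot_k (at s)) \<noteq> 0"
    if "(i, t) \<in> pre c" "(j, s) \<in> pre c" "(i, t) \<noteq> (j, s)" for i j t s c
  proof -
    have 0: "knot_k 0 = 1" "knot_k (1 / 2) = 1" "knot_c 0 = Complex 1 2" "knot_c (1 / 2) = Complex (- 1) 2"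
      by (simp_all add: knot_k_eq knot_c_def complex_eq_iff power2_eq_square)
    have "t = 0 \<and> s = 1 / 2 \<or> t = 1 / 2 \<and> s = 0"
      by (rule double) (use that in \<open>auto simp: pre_def\<close>)
    thus ?thesis by (elim disjE conjE; hypsubst) (simp_all add: vd 0)
  qed
  show ?thesis
    unfolding punctured_disk_diagram_def Let_def fst_conv pre_def[symmetric]
    using smooth_on_Pair[OF knot_smooth(1,3)] inj fin fin2 trans knot_nz by (auto simp: vd)
qed

text \<open>The radii \<open>e\<close> and \<open>1 / e\<close> are chosen such that \<open>h + \<i> ln \<bar>c\<bar> = \<plusminus> \<i>\<close> for \<open>h = 0\<close>.\<close>

definition circle_radius :: "nat \<Rightarrow> real" where
  "circle_radius i = exp (if i = 0 then 1 else - 1)"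

definition circle_k :: "nat \<Rightarrow> real \<Rightarrow> complex" where
  "circle_k i t = of_real (circle_radius i) * cis (2 * pi * t)"

lemma circle_band_eq:
  "band (circle_k i) (\<lambda>_. \<i>) (\<lambda>_. 0) (t, s) = (of_real (circle_radius i * (1 - s / 20)) * cis (2 * pi * t), 0)"
  unfolding band_def circle_k_def by (simp add: complex_eq_iff algebra_simps)

lemma circle_band_inj:
  assumes "i < 2" "j < 2" and s: "\<bar>s\<bar> < 2" "\<bar>s'\<bar> < 2"
  shows "band (circle_k i) (\<lambda>_. \<i>) (\<lambda>_. 0) (t, s) = band (circle_k j) (\<lambda>_. \<i>) (\<lambda>_. 0) (t', s') \<longleftrightarrow>
    i = j \<and> t - t' \<in> \<int> \<and> s = s'"
proof
  have pos: "0 < circle_radius i * (1 - s / 20)" "0 < circle_radius j * (1 - s' / 20)"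
    using s by (simp_all add: circle_radius_def)
  assume "band (circle_k i) (\<lambda>_. \<i>) (\<lambda>_. 0) (t, s) = band (circle_k j) (\<lambda>_. \<i>) (\<lambda>_. 0) (t', s')"
  hence eq: "of_real (circle_radius i * (1 - s / 20)) * cis (2 * pi * t) =
      of_real (circle_radius j * (1 - s' / 20)) * cis (2 * pi * t')"
    unfolding circle_band_eq by (simp only: prod.inject)
  have r: "circle_radius i * (1 - s / 20) = circle_radius j * (1 - s' / 20)"
    using arg_cong[OF eq, of cmod] pos unfolding norm_mult norm_of_real norm_cis by simp
  have "cis (2 * pi * t) = cis (2 * pi * t')"
    using eq pos(2) unfolding r mult_cancel_left of_real_eq_0_iff by linarith
  hence t: "t - t' \<in> \<int>" by (simp only: cis_2pi_eq_iff)
  have far: "exp (- 1) * (1 - v / 20) \<noteq> exp 1 * (1 - w / 20)" if "\<bar>v\<bar> < 2" "\<bar>w\<bar> < 2" for v w :: real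
  proof -
    have "exp (- 1) * (1 - v / 20) < 1 * (11 / 10 :: real)"
      by (rule mult_strict_mono) (use that in auto)
    also have "\<dots> \<le> 2 * (9 / 10)" by simp
    also have "\<dots> \<le> exp 1 * (1 - w / 20)"
      by (rule mult_mono) (use that exp_ge_add_one_self[of 1] in auto)
    finally show ?thesis by simp
  qed
  have "i = j"
  proof (rule ccontr)
    assume "i \<noteq> j"
    hence "i = 0 \<and> j = 1 \<or> i = 1 \<and> j = 0" using assms(1,2) by auto
    thus False using r far[OF s] far[OF s(2,1)] by (auto simp: circle_radius_def)
  qed
  moreover have "s = s'" using r unfolding \<open>i = j\<close> by (simp add: circle_radius_def)
  ultimately show "i = j \<and> t - t' \<in> \<int> \<and> s = s'" using t by blast
next
  assume a: "i = j \<and> t - t' \<in> \<int> \<and> s = s'"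
  hence "cis (2 * pi * t) = cis (2 * pi * t')" by (simp only: cis_2pi_eq_iff)
  thus "band (circle_k i) (\<lambda>_. \<i>) (\<lambda>_. 0) (t, s) = band (circle_k j) (\<lambda>_. \<i>) (\<lambda>_. 0) (t', s')"
    using a unfolding circle_band_eq by simp
qed

lemma circle_k_deriv: "(circle_k i has_vector_derivative 2 * pi * \<i> * circle_k i t) (at t)"
proof -
  have "((\<lambda>t. \<i> * of_real (2 * pi * t)) has_vector_derivative \<i> * of_real (2 * pi)) (at t)"
    by (intro has_vector_derivative_mult_right has_vector_derivative_of_real)
      (auto intro!: derivative_eq_intros simp: has_real_derivative_iff_has_vector_derivative[symmetric])
  from field_vector_diff_chain_at[OF this DERIV_exp]
  have "((\<lambda>t. cis (2 * pi * t)) has_vector_derivative \<i> * of_real (2 * pi) * cis (2 * pi * t)) (at t)"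
    by (simp add: o_def cis_conv_exp)
  from has_vector_derivative_mult_right[OF this, of "of_real (circle_radius i)"]
  show ?thesis unfolding circle_k_def[abs_def] by (simp add: algebra_simps)
qed

lemma circle_k_nz: "circle_k i t \<noteq> 0"
  by (simp add: circle_k_def circle_radius_def)

lemma circle_smooth: "smooth_on UNIV (circle_k i)"
  unfolding circle_k_def by (intro smooth_intros)

lemma circles_diagram: "punctured_disk_diagram 2 (\<lambda>i t. (circle_k i t, 0))"
proof -
  have inj: "(circle_k i t, 0::real) = (circle_k j t', 0) \<longleftrightarrow> i = j \<and> t - t' \<in> \<int>" if "i < 2" "j < 2" for i j t t'
    using circle_band_inj[OF that, of 0 0 t t'] by (simp add: band_def)
  define pre where "pre c = {(i::nat, t). i < 2 \<and> t \<in> {0..<1} \<and> circle_k i t = c}" for c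
  have unique: "x = y" if "x \<in> pre c" "y \<in> pre c" for x y c
  proof -
    obtain i t j t' where xy: "x = (i, t)" "y = (j, t')" by (cases x, cases y)
    hence "i = j" "t - t' \<in> \<int>" "t \<in> {0..<1}" "t' \<in> {0..<1}"
      using inj[of i j t t'] that by (auto simp: pre_def)
    moreover from this(2) obtain n :: int where "t - t' = of_int n" by (elim Ints_cases)
    moreover have "- 1 < real_of_int n" "real_of_int n < 1" using calculation by auto
    hence "n = 0" by linarith
    ultimately show ?thesis using xy by simp
  qed
  have sub: "\<exists>x. pre c \<subseteq> {x}" for c
    using unique[of _ c] by blast
  have fin: "finite (pre c)" "card (pre c) \<le> 1" for c
  proof -
    obtain x where "pre c \<subseteq> {x}" using sub by blast
    thus "finite (pre c)" "card (pre c) \<le> 1"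
      using card_mono[of "{x}" "pre c"] finite_subset by fastforce+
  qed
  hence "{c. card (pre c) = 2} = {}" by (metis (mono_tags) Collect_empty_eq numeral_le_one_iff semiring_norm(69))
  hence fin2: "finite {c. card (pre c) = 2}" by simp
  have c2: "card (pre c) \<le> 2" for c using fin(2)[of c] by linarith
  have vd: "vector_derivative (circle_k i) (at t) = 2 * pi * \<i> * circle_k i t" for i t
    by (rule vector_derivative_at[OF circle_k_deriv])
  have trans: "\<forall>(i, t)\<in>pre c. \<forall>(j, s)\<in>pre c. (i, t) \<noteq> (j, s) \<longrightarrow> P i t j s" for c and P
    using unique[of _ c] by blast
  have sm: "smooth_on UNIV (\<lambda>t. (circle_k i t, 0::real))" for i
    by (intro smooth_on_Pair circle_smooth smooth_on_const)
  show ?thesis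
    unfolding punctured_disk_diagram_def Let_def fst_conv pre_def[symmetric]
    by (intro conjI allI impI trans fin c2 fin2 sm inj) (auto simp: vd circle_k_nz)
qed

lemma surgery_embed_exp:
  "surgery_embed p q (exp l, h) = lens_pr p q (torus_point p q (Im l) (Complex h (Re l)))"
proof -
  have "sgn (exp l) = cis (Im l)" by (subst exp_eq_polar) (simp add: sgn_eq norm_mult)
  hence "cis (Arg (exp l)) = cis (Im l)" by (subst cis_Arg) auto
  thus ?thesis
    unfolding surgery_embed_def prod.case norm_exp_eq_Re ln_exp by (rule lens_pr_torus_point_cong)
qed

definition knot :: "(complex \<times> complex) set set" where
  "knot = surgery_embed 4 1 ` diagram_core 1 (\<lambda>i t. (knot_k t, knot_h t))"

definition circles :: "(complex \<times> complex) set set" where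
  "circles = surgery_embed 4 1 ` diagram_core 2 (\<lambda>i t. (circle_k i t, 0))"

lemma knot_eq: "knot = range (\<lambda>\<alpha>. lens_pr 4 1 ((1 / sqrt 2) *\<^sub>R (cis \<alpha>, cis \<alpha>)))"
proof -
  have "surgery_embed 4 1 (knot_k t, knot_h t) = lens_pr 4 1 ((1 / sqrt 2) *\<^sub>R (cis (pi * t), cis (pi * t)))" for t
  proof -
    have "Complex (cos (2 * pi * t)) (sin (2 * pi * t)) = cis (2 * pi * t)" by (simp add: cis.code)
    thus ?thesis
      unfolding knot_k_def knot_h_def surgery_embed_exp torus_point_def
      by (simp add: cis_mult)
  qed
  hence "knot = range (\<lambda>t. lens_pr 4 1 ((1 / sqrt 2) *\<^sub>R (cis (pi * t), cis (pi * t))))"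
    by (auto simp: knot_def surgery_diagram_core)
  also have "\<dots> = (\<lambda>\<alpha>. lens_pr 4 1 ((1 / sqrt 2) *\<^sub>R (cis \<alpha>, cis \<alpha>))) ` range (\<lambda>t. pi * t)"
    by (simp only: image_image)
  also have "range (\<lambda>t. pi * t) = UNIV" by (rule surjI[of _ "\<lambda>t. t / pi"]) simp
  finally show ?thesis .
qed

lemma circles_eq:
  "circles = (\<Union>\<epsilon>\<in>{1, - 1}. range (\<lambda>\<alpha>. lens_pr 4 1 ((1 / sqrt 2) *\<^sub>R (cis \<alpha>, of_real \<epsilon> * \<i> * cis (- \<alpha>)))))"
proof -
  define \<epsilon> :: "nat \<Rightarrow> real" where "\<epsilon> i = (if i = 0 then 1 else - 1)" for i
  have "surgery_embed 4 1 (circle_k i t, 0) =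
      lens_pr 4 1 ((1 / sqrt 2) *\<^sub>R (cis (pi / 2 * t), of_real (\<epsilon> i) * \<i> * cis (- (pi / 2 * t))))" for i t
  proof -
    have k: "circle_k i t = exp (Complex (\<epsilon> i) (2 * pi * t))"
      unfolding exp_eq_polar[of "Complex _ _"] by (simp add: circle_k_def circle_radius_def \<epsilon>_def)
    have c: "Complex 0 (\<epsilon> i) = of_real (\<epsilon> i) * \<i>" "cmod (of_real (\<epsilon> i) * \<i>) = 1"
      by (auto simp: complex_eq_iff norm_mult \<epsilon>_def)
    show ?thesis
      unfolding k surgery_embed_exp torus_point_def complex.sel c by simp
  qed
  hence "circles = (\<Union>i<2. range (\<lambda>t. lens_pr 4 1 ((1 / sqrt 2) *\<^sub>R
      (cis (pi / 2 * t), of_real (\<epsilon> i) * \<i> * cis (- (pi / 2 * t))))))"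
    by (simp add: circles_def surgery_diagram_core)
  also have "\<dots> = (\<Union>i<2. (\<lambda>\<alpha>. lens_pr 4 1 ((1 / sqrt 2) *\<^sub>R
      (cis \<alpha>, of_real (\<epsilon> i) * \<i> * cis (- \<alpha>)))) ` range (\<lambda>t. pi / 2 * t))"
    by (simp only: image_image)
  also have "range (\<lambda>t. pi / 2 * t) = UNIV" by (rule surjI[of _ "\<lambda>t. t / (pi / 2)"]) simp
  also have "{..<2::nat} = {0, 1}" by auto
  finally show ?thesis by (simp add: \<epsilon>_def)
qed

lemma lens_pr_4_1: "lens_pr 4 1 (z, w) = lens_pr 4 1 (\<i> * z, - \<i> * w)"
proof -
  have "cis (2 * pi * of_int 1 / of_nat 4) = \<i>" "cis (- (2 * pi * of_int 1 * of_nat 1 / of_nat 4)) = - \<i>"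
    by (simp_all add: complex_eq_iff)
  thus ?thesis using lens_pr_orbit[of 4 1 1 z w] by simp
qed

lemma lens_pr_4_1_eqD:
  assumes "lens_pr 4 1 x = lens_pr 4 1 (z, w)"
  obtains \<zeta> where "\<zeta>\<^sup>2 = 1 \<or> \<zeta>\<^sup>2 = - 1" "cmod \<zeta> = 1" "x = (\<zeta> * z, cnj \<zeta> * w)"
proof -
  have "x = (cis (2 * pi * of_int 0 / of_nat 4) * fst x,
     cis (- (2 * pi * of_int 0 * of_nat 1 / of_nat 4)) * snd x)" by simp
  hence "x \<in> lens_pr 4 1 x" unfolding lens_pr_def by blast
  hence "x \<in> lens_pr 4 1 (z, w)" unfolding assms .
  then obtain k :: int where x: "x = (cis (2 * pi * of_int k / of_nat 4) * z,
     cis (- (2 * pi * of_int k * of_nat 1 / of_nat 4)) * w)"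
    unfolding lens_pr_def fst_conv snd_conv by blast
  let ?\<zeta> = "cis (2 * pi * of_int k / of_nat 4)"
  have "?\<zeta>\<^sup>2 = cis (pi * of_int k)" by (simp add: Complex.DeMoivre)
  moreover have "(cis (pi * of_int k))\<^sup>2 = 1"
    using cis_multiple_2pi[of "of_int k"] by (simp add: Complex.DeMoivre mult.left_commute mult.commute mult.assoc)
  ultimately have "?\<zeta>\<^sup>2 = 1 \<or> ?\<zeta>\<^sup>2 = - 1" by (metis power2_eq_1_iff)
  moreover have "x = (?\<zeta> * z, cnj ?\<zeta> * w)" by (simp add: x cis_cnj)
  ultimately show ?thesis using that[of ?\<zeta>] by simp
qed

lemma S3_iff: "(z, w) \<in> S3 \<longleftrightarrow> (cmod z)\<^sup>2 + (cmod w)\<^sup>2 = 1"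
  by (simp add: S3_def norm_Pair)

lemma S3_polar:
  assumes "x \<in> S3" and "cmod (snd x) = cmod (fst x)"
  obtains \<alpha> where "fst x = of_real (1 / sqrt 2) * cis \<alpha>"
proof -
  have "(cmod (fst x))\<^sup>2 = 1 / 2" using assms S3_iff[of "fst x" "snd x"] by simp
  hence "cmod (fst x) = sqrt (1 / 2)" by (metis norm_ge_zero real_sqrt_unique)
  hence "cmod (fst x) = 1 / sqrt 2" by (simp only: real_sqrt_divide real_sqrt_one)
  thus ?thesis using that[of "Arg (fst x)"] rcis_cmod_Arg[of "fst x"] by (simp only: rcis_def)
qed

text \<open>In an orbit \<open>(\<zeta> a, cnj \<zeta> a)\<close>, the conjugate of the fourth root of unity \<open>\<zeta>\<close> is \<open>\<zeta>\<close> or \<open>- \<zeta>\<close>, and both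
  signs occur: the two great circles are exchanged by the generator.\<close>

lemma lift_knot: "lift 4 1 knot = {x \<in> S3. snd x = fst x \<or> snd x = - fst x}"
proof (intro set_eqI iffI)
  fix x assume "x \<in> lift 4 1 knot"
  then obtain \<alpha> where x: "x \<in> S3" "lens_pr 4 1 x = lens_pr 4 1 ((1 / sqrt 2) *\<^sub>R (cis \<alpha>, cis \<alpha>))"
    unfolding lift_def knot_eq by auto
  define a where "a = (1 / sqrt 2) *\<^sub>R cis \<alpha>"
  obtain \<zeta> where \<zeta>: "\<zeta>\<^sup>2 = 1 \<or> \<zeta>\<^sup>2 = - 1" "cmod \<zeta> = 1" "x = (\<zeta> * a, cnj \<zeta> * a)"
    using lens_pr_4_1_eqD[of x a a] x(2) by (auto simp: a_def)
  have "cnj \<zeta> * \<zeta> = 1" using \<zeta>(2) complex_norm_square[of \<zeta>] by (simp add: mult.commute)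
  hence "cnj \<zeta> = \<zeta> \<or> cnj \<zeta> = - \<zeta>" using \<zeta>(1)
    by (metis mult_cancel_right mult_minus_left mult_zero_right power2_eq_square zero_neq_one minus_mult_minus
        minus_equation_iff)
  thus "x \<in> {x \<in> S3. snd x = fst x \<or> snd x = - fst x}" using x(1) \<zeta>(3) by auto
next
  fix x assume "x \<in> {x \<in> S3. snd x = fst x \<or> snd x = - fst x}"
  hence x: "x \<in> S3" "snd x = fst x \<or> snd x = - fst x" by auto
  have "\<exists>\<alpha>. lens_pr 4 1 x = lens_pr 4 1 ((1 / sqrt 2) *\<^sub>R (cis \<alpha>, cis \<alpha>))"
    using x(2)
  proof
    assume s: "snd x = fst x"
    obtain \<alpha> where "fst x = of_real (1 / sqrt 2) * cis \<alpha>"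
      using S3_polar[OF x(1)] s by (metis norm_minus_cancel)
    hence "x = (1 / sqrt 2) *\<^sub>R (cis \<alpha>, cis \<alpha>)"
      using s by (simp add: prod_eq_iff scaleR_conv_of_real)
    thus ?thesis by blast
  next
    assume s: "snd x = - fst x"
    obtain \<alpha> where \<alpha>: "fst x = of_real (1 / sqrt 2) * cis \<alpha>"
      using S3_polar[OF x(1)] s by (metis norm_minus_cancel)
    have "lens_pr 4 1 x = lens_pr 4 1 (\<i> * fst x, \<i> * fst x)"
    proof -
      have "(fst x, - fst x) = x" using s by (simp add: prod_eq_iff)
      thus ?thesis using lens_pr_4_1[of "fst x" "- fst x"] by simp
    qed
    also have "(\<i> * fst x, \<i> * fst x) = (1 / sqrt 2) *\<^sub>R (cis (\<alpha> + pi / 2), cis (\<alpha> + pi / 2))"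
    proof -
      have "\<i> * cis \<alpha> = cis (\<alpha> + pi / 2)" by (simp flip: cis_mult)
      thus ?thesis by (simp add: \<alpha> scaleR_conv_of_real mult.left_commute)
    qed
    finally show ?thesis by blast
  qed
  thus "x \<in> lift 4 1 knot" using x(1) unfolding lift_def knot_eq by auto
qed

text \<open>The equation \<open>w = \<i> cnj z\<close> is invariant under \<open>(z, w) \<mapsto> (\<zeta> z, cnj \<zeta> w)\<close>, so that each great
  circle covers one component.\<close>

lemma lift_circles: "lift 4 1 circles = {x \<in> S3. snd x = \<i> * cnj (fst x) \<or> snd x = - (\<i> * cnj (fst x))}"
proof (intro set_eqI iffI)
  fix x assume "x \<in> lift 4 1 circles"
  then obtain \<alpha> and \<epsilon> :: real where x: "x \<in> S3" "\<epsilon> = 1 \<or> \<epsilon> = - 1"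
      "lens_pr 4 1 x = lens_pr 4 1 ((1 / sqrt 2) *\<^sub>R (cis \<alpha>, of_real \<epsilon> * \<i> * cis (- \<alpha>)))"
    unfolding lift_def circles_eq by blast
  obtain \<zeta> where \<zeta>: "x = (\<zeta> * ((1 / sqrt 2) *\<^sub>R cis \<alpha>), cnj \<zeta> * ((1 / sqrt 2) *\<^sub>R (of_real \<epsilon> * \<i> * cis (- \<alpha>))))"
    using lens_pr_4_1_eqD[of x "(1 / sqrt 2) *\<^sub>R cis \<alpha>" "(1 / sqrt 2) *\<^sub>R (of_real \<epsilon> * \<i> * cis (- \<alpha>))"] x(3)
    by auto
  have "snd x = of_real \<epsilon> * \<i> * cnj (fst x)"
    by (simp add: \<zeta> cis_cnj scaleR_conv_of_real algebra_simps)
  thus "x \<in> {x \<in> S3. snd x = \<i> * cnj (fst x) \<or> snd x = - (\<i> * cnj (fst x))}" using x(1,2) by auto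
next
  fix x assume "x \<in> {x \<in> S3. snd x = \<i> * cnj (fst x) \<or> snd x = - (\<i> * cnj (fst x))}"
  then obtain \<epsilon> :: real where x: "x \<in> S3" "\<epsilon> \<in> {1, - 1}" "snd x = of_real \<epsilon> * \<i> * cnj (fst x)"
    by (auto intro: that[of 1] that[of "- 1"])
  obtain \<alpha> where \<alpha>: "fst x = of_real (1 / sqrt 2) * cis \<alpha>"
  proof (rule S3_polar[OF x(1)])
    show "cmod (snd x) = cmod (fst x)" using x(2) by (auto simp: x(3) norm_mult)
  qed
  have "x = (1 / sqrt 2) *\<^sub>R (cis \<alpha>, of_real \<epsilon> * \<i> * cis (- \<alpha>))"
    using x(3) by (simp add: prod_eq_iff \<alpha> scaleR_conv_of_real cis_cnj algebra_simps)
  thus "x \<in> lift 4 1 circles" using x(1,2) unfolding lift_def circles_eq by blast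
qed

text \<open>With \<open>z = x + \<i> y\<close> and \<open>w = a + \<i> b\<close>, the time-\<open>1\<close> map is the rotation
  \<open>(x, y, a, b) \<mapsto> (y, a, x, b)\<close>, a product of quarter turns in the \<open>(x, y)\<close>- and the
  \<open>(y, a)\<close>-plane.\<close>

definition rotation :: "real \<Rightarrow> complex \<times> complex \<Rightarrow> complex \<times> complex" where
  "rotation \<phi> x = (let z = cis (- \<phi>) * fst x; w = snd x in
     (Complex (Re z) (Im z * cos \<phi> + Re w * sin \<phi>), Complex (Re w * cos \<phi> - Im z * sin \<phi>) (Im w)))"

definition rotation_inv :: "real \<Rightarrow> complex \<times> complex \<Rightarrow> complex \<times> complex" where
  "rotation_inv \<phi> x = (cis \<phi> * Complex (Re (fst x)) (Im (fst x) * cos \<phi> - Re (snd x) * sin \<phi>),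
     Complex (Re (snd x) * cos \<phi> + Im (fst x) * sin \<phi>) (Im (snd x)))"

lemma plane_rotation:
  fixes u v :: real
  shows "(u * cos \<phi> + v * sin \<phi>) * cos \<phi> - (v * cos \<phi> - u * sin \<phi>) * sin \<phi> = u"
    and "(v * cos \<phi> - u * sin \<phi>) * cos \<phi> + (u * cos \<phi> + v * sin \<phi>) * sin \<phi> = v"
    and "(u * cos \<phi> + v * sin \<phi>)\<^sup>2 + (v * cos \<phi> - u * sin \<phi>)\<^sup>2 = u\<^sup>2 + v\<^sup>2"
proof -
  have c: "(sin \<phi>)\<^sup>2 = 1 - (cos \<phi>)\<^sup>2" by (simp add: sin_squared_eq)
  show "(u * cos \<phi> + v * sin \<phi>) * cos \<phi> - (v * cos \<phi> - u * sin \<phi>) * sin \<phi> = u"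
    "(v * cos \<phi> - u * sin \<phi>) * cos \<phi> + (u * cos \<phi> + v * sin \<phi>) * sin \<phi> = v"
    "(u * cos \<phi> + v * sin \<phi>)\<^sup>2 + (v * cos \<phi> - u * sin \<phi>)\<^sup>2 = u\<^sup>2 + v\<^sup>2"
    using c by algebra+
qed

lemma rotation_inverse: "rotation_inv \<phi> (rotation \<phi> x) = x" "rotation \<phi> (rotation_inv \<phi> x) = x"
proof -
  have "cis \<phi> * (cis (- \<phi>) * fst x) = fst x" by (simp add: cis_mult flip: mult.assoc)
  note c = this
  show "rotation_inv \<phi> (rotation \<phi> x) = x"
    unfolding rotation_def rotation_inv_def Let_def fst_conv snd_conv complex.sel plane_rotation
      complex_surj c prod.collapse ..
  let ?z = "Complex (Re (fst x)) (Im (fst x) * cos \<phi> - Re (snd x) * sin \<phi>)"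
  have z: "cis (- \<phi>) * (cis \<phi> * ?z) = ?z" by (simp add: cis_mult flip: mult.assoc)
  have p: "(u * cos \<phi> - v * sin \<phi>) * cos \<phi> + (v * cos \<phi> + u * sin \<phi>) * sin \<phi> = u"
    "(v * cos \<phi> + u * sin \<phi>) * cos \<phi> - (u * cos \<phi> - v * sin \<phi>) * sin \<phi> = v" for u v :: real
    using plane_rotation(1,2)[where u = u and v = v and \<phi> = "- \<phi>"] by simp_all
  show "rotation \<phi> (rotation_inv \<phi> x) = x"
    unfolding rotation_def rotation_inv_def Let_def fst_conv snd_conv z complex.sel p complex_surj
      prod.collapse ..
qed

lemma rotation_S3: "x \<in> S3 \<Longrightarrow> rotation \<phi> x \<in> S3"
proof -
  let ?z = "cis (- \<phi>) * fst x" and ?w = "snd x"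
  assume "x \<in> S3"
  hence "(cmod ?z)\<^sup>2 + (cmod ?w)\<^sup>2 = 1" using S3_iff[of "fst x" "snd x"] by (simp add: norm_mult)
  hence "(Re ?z)\<^sup>2 + ((Im ?z)\<^sup>2 + (Re ?w)\<^sup>2) + (Im ?w)\<^sup>2 = 1"
    unfolding cmod_power2 by (simp only: add.assoc)
  thus "rotation \<phi> x \<in> S3"
    unfolding rotation_def Let_def S3_iff cmod_power2 complex.sel
    using plane_rotation(3)[of "Im ?z" \<phi> "Re ?w"] by linarith
qed

lemma rotation_inv_S3: "x \<in> S3 \<Longrightarrow> rotation_inv \<phi> x \<in> S3"
proof -
  assume x: "x \<in> S3"
  have p: "(u * cos \<phi> - v * sin \<phi>)\<^sup>2 + (v * cos \<phi> + u * sin \<phi>)\<^sup>2 = u\<^sup>2 + v\<^sup>2" for u v :: real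
    using plane_rotation(3)[of u "- \<phi>" v] by simp
  have "(Re (fst x))\<^sup>2 + ((Im (fst x))\<^sup>2 + (Re (snd x))\<^sup>2) + (Im (snd x))\<^sup>2 = 1"
    using x S3_iff[of "fst x" "snd x"] unfolding cmod_power2 by simp
  thus "rotation_inv \<phi> x \<in> S3"
    unfolding rotation_inv_def S3_iff norm_mult norm_cis mult_1_left cmod_power2 complex.sel
    using p[of "Im (fst x)" "Re (snd x)"] by linarith
qed

lemma smooth_on_rotation:
  assumes "smooth_on S f" and "smooth_on S x"
  shows "smooth_on S (\<lambda>y. rotation (f y) (x y))" "smooth_on S (\<lambda>y. rotation_inv (f y) (x y))"
proof -
  have m: "smooth_on S (\<lambda>y. - f y)"
    by (rule smooth_on_bounded_linear[OF bounded_linear_minus[OF bounded_linear_ident] assms(1)])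
  show "smooth_on S (\<lambda>y. rotation (f y) (x y))"
    unfolding rotation_def Let_def by (intro smooth_intros assms m)
  show "smooth_on S (\<lambda>y. rotation_inv (f y) (x y))"
    unfolding rotation_inv_def by (intro smooth_intros assms)
qed

lemma manifold_S3: "manifold (\<lambda>x. x) = S3"
  by (simp add: manifold_def)

lemma ambient_isotopy_rotation: "ambient_isotopy (\<lambda>x. x) (\<lambda>t. rotation (t * (pi / 2)))"
proof -
  have "diffeo (\<lambda>x. x) (rotation \<phi>)" for \<phi>
  proof -
    have b: "bij_betw (rotation \<phi>) S3 S3"
      by (rule bij_betw_byWitness[where f' = "rotation_inv \<phi>"])
        (auto simp: rotation_inverse rotation_S3 rotation_inv_S3)
    have inv: "rotation_inv \<phi> x = inv_into S3 (rotation \<phi>) x" if "x \<in> S3" for x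
      using inv_into_f_eq[OF bij_betw_imp_inj_on[OF b] rotation_inv_S3[OF that] rotation_inverse(2)]
      by simp
    have "smooth_to (\<lambda>x. x) S3 (rotation \<phi>)"
      by (rule smooth_to_I[of _ "rotation \<phi>"])
        (auto intro!: smooth_on_rotation smooth_intros rotation_S3)
    moreover have "smooth_to (\<lambda>x. x) S3 (rotation_inv \<phi>)"
      by (rule smooth_to_I[of _ "rotation_inv \<phi>"])
        (auto intro!: smooth_on_rotation smooth_intros rotation_inv_S3)
    hence "smooth_to (\<lambda>x. x) S3 (inv_into S3 (rotation \<phi>))"
      by (rule smooth_to_cong) (rule inv)
    ultimately show ?thesis using b by (simp add: diffeo_def manifold_S3)
  qed
  moreover have "smooth_to (\<lambda>x. x) ({0..1} \<times> S3) (\<lambda>y. rotation (fst y * (pi / 2)) (snd y))"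
    by (rule smooth_to_I[of _ "\<lambda>y. rotation (fst y * (pi / 2)) (snd y)"])
      (auto intro!: smooth_on_rotation(1) smooth_intros rotation_S3)
  moreover have "rotation 0 x = x" for x by (simp add: rotation_def)
  ultimately show ?thesis by (simp add: ambient_isotopy_def case_prod_unfold)
qed

lemma equivalent_lifts: "equivalent (\<lambda>x. x) (lift 4 1 knot) (lift 4 1 circles)"
proof -
  let ?r = "rotation (pi / 2)" and ?i = "rotation_inv (pi / 2)"
  have r: "?r x = (Complex (Im (fst x)) (Re (snd x)), Complex (Re (fst x)) (Im (snd x)))" for x
    by (simp add: rotation_def Let_def)
  have i: "?i x = (Complex (Re (snd x)) (Re (fst x)), Complex (Im (fst x)) (Im (snd x)))" for x
    by (simp add: rotation_inv_def complex_eq_iff)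
  have "?r ` lift 4 1 knot = lift 4 1 circles"
  proof (intro equalityI subsetI)
    fix y assume "y \<in> ?r ` lift 4 1 knot"
    then obtain x where "y = ?r x" "x \<in> S3" "snd x = fst x \<or> snd x = - fst x"
      unfolding lift_knot by auto
    thus "y \<in> lift 4 1 circles"
      unfolding lift_circles using rotation_S3[of x "pi / 2"] by (auto simp: r complex_eq_iff)
  next
    fix y assume "y \<in> lift 4 1 circles"
    hence "?i y \<in> lift 4 1 knot"
      unfolding lift_circles lift_knot using rotation_inv_S3[of y "pi / 2"]
      by (auto simp: i complex_eq_iff)
    thus "y \<in> ?r ` lift 4 1 knot" using rotation_inverse(2)[of "pi / 2" y] by (metis imageI)
  qed
  thus ?thesis
    unfolding equivalent_def using ambient_isotopy_rotation by (intro exI) auto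
qed

interpretation lens: euclidean_quotient "lens_pr 4 1" "\<lambda>x. (fst x ^ 4, snd x ^ 4, fst x * snd x)"
  by (rule euclidean_quotient_lens_space) simp

text \<open>The framings of the diagrams of a link affect its values, but not their weight.\<close>

lemma KBSM_weight:
  assumes "L \<subseteq> manifold (lens_pr 4 1)" and "X \<in> KBSM 4 1 L"
  obtains F where "F \<in> framed_links (lens_pr 4 1)" "X = skein_class (lens_pr 4 1) F"
    "lens.weight F = (- 2) ^ lens.number_of_components L"
proof -
  obtain F where F: "X = skein_class (lens_pr 4 1) F" "F \<in> framed_links (lens_pr 4 1)"
    "equivalent (lens_pr 4 1) (fst F) L"
    using assms(2) unfolding KBSM_def by force
  obtain H where "ambient_isotopy (lens_pr 4 1) H" "H 1 ` fst F = L"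
    using F(3) unfolding equivalent_def by blast
  hence "lens.number_of_components L = lens.number_of_components (fst F)"
    using lens.number_of_components_isotopy is_link_subset_manifold[OF framed_links_core[OF F(2)]] by blast
  hence "lens.weight F = (- 2) ^ lens.number_of_components L" unfolding lens.weight_def by simp
  thus ?thesis by (rule that[OF F(2,1)])
qed

theorem mainTheorem4:
  shows "(\<forall>p q L L'. lens_parameters p q \<and> is_link (lens_pr p q) L \<and> is_link (lens_pr p q) L' \<and>
            equivalent (lens_pr p q) L L' \<longrightarrow> KBSM p q L = KBSM p q L') \<and>
         (\<exists>p q L\<^sub>1 L\<^sub>2. lens_parameters p q \<and>
            is_link (lens_pr p q) L\<^sub>1 \<and> is_link (lens_pr p q) L\<^sub>2 \<and>
            \<not> equivalent (lens_pr p q) L\<^sub>1 L\<^sub>2 \<and>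
            equivalent (\<lambda>x. x) (lift p q L\<^sub>1) (lift p q L\<^sub>2) \<and>
            KBSM p q L\<^sub>1 \<noteq> {} \<and> KBSM p q L\<^sub>2 \<noteq> {} \<and> KBSM p q L\<^sub>1 \<inter> KBSM p q L\<^sub>2 = {})"
proof (intro conjI)
  show "\<forall>p q L L'. lens_parameters p q \<and> is_link (lens_pr p q) L \<and> is_link (lens_pr p q) L' \<and>
      equivalent (lens_pr p q) L L' \<longrightarrow> KBSM p q L = KBSM p q L'"
    using KBSM_equivalent by blast
  have p: "(0::nat) < 4" by simp
  have links: "is_link (lens_pr 4 1) knot" "is_link (lens_pr 4 1) circles"
    unfolding knot_def circles_def
    by (rule diagram_is_link[OF p knot_diagram] diagram_is_link[OF p circles_diagram])+
  have count: "lens.number_of_components knot = 1" "lens.number_of_components circles = 2"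
    unfolding knot_def circles_def
    by (rule number_of_components_diagram[OF lens.euclidean_quotient_axioms p knot_diagram]
        number_of_components_diagram[OF lens.euclidean_quotient_axioms p circles_diagram])+
  have ne1: "KBSM 4 1 knot \<noteq> {}"
    unfolding knot_def
  proof (rule KBSM_diagram_nonempty[OF p knot_diagram, where c = "\<lambda>_. knot_c"])
    show "fst (band knot_k knot_c knot_h (t, s)) \<noteq> 0" if "\<bar>s\<bar> < 2" for t s
    proof -
      have "1 + of_real (s / 20) * (\<i> * knot_c t) \<noteq> 0"
        using knot_nz(3)[OF that, of t] by (metis zero_complex.sel(1))
      thus ?thesis unfolding band_def fst_conv snd_conv using knot_nz(1)[of t] by simp
    qed
  qed (use knot_k_deriv in \<open>auto simp: knot_smooth knot_immersive knot_band_inj\<close>)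
  have ne2: "KBSM 4 1 circles \<noteq> {}"
    unfolding circles_def
  proof (rule KBSM_diagram_nonempty[OF p circles_diagram, where c = "\<lambda>_ _. \<i>"])
    show "fst (band (circle_k i) (\<lambda>_. \<i>) (\<lambda>_. 0) (t, s)) \<noteq> 0" if "\<bar>s\<bar> < 2" for i t s
    proof -
      have "circle_radius i * (1 - s / 20) \<noteq> 0" using that by (simp add: circle_radius_def)
      thus ?thesis
        unfolding circle_band_eq fst_conv using cis_neq_zero[of "2 * pi * t"]
        by (simp only: mult_eq_0_iff of_real_eq_0_iff) simp
    qed
    show "inj (frechet_derivative (band (circle_k i) (\<lambda>_. \<i>) (\<lambda>_. 0)) (at (t, s)))" if "\<bar>s\<bar> < 2" for i t s
      by (rule band_immersive[OF circle_k_deriv has_vector_derivative_const DERIV_const])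
        (use that circle_k_nz in auto)
  qed (use circle_k_deriv in \<open>auto simp: circle_smooth circle_band_inj smooth_on_const\<close>)
  have disj: "KBSM 4 1 knot \<inter> KBSM 4 1 circles = {}"
  proof (rule ccontr)
    assume "KBSM 4 1 knot \<inter> KBSM 4 1 circles \<noteq> {}"
    then obtain X where X: "X \<in> KBSM 4 1 knot" "X \<in> KBSM 4 1 circles" by blast
    obtain F where F: "F \<in> framed_links (lens_pr 4 1)" "X = skein_class (lens_pr 4 1) F" "lens.weight F = - 2"
      using KBSM_weight[OF is_link_subset_manifold[OF links(1)] X(1)] unfolding count by auto
    obtain G where G: "G \<in> framed_links (lens_pr 4 1)" "X = skein_class (lens_pr 4 1) G" "lens.weight G = 4"
      using KBSM_weight[OF is_link_subset_manifold[OF links(2)] X(2)] unfolding count by auto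
    have "lens.weight F = lens.weight G"
      by (rule lens.skein_class_eq_weight[OF F(1) G(1)]) (use F G in simp)
    thus False using F G by simp
  qed
  have "\<not> equivalent (lens_pr 4 1) knot circles"
    using KBSM_equivalent[OF links(1)] ne1 disj by force
  thus "\<exists>p q L\<^sub>1 L\<^sub>2. lens_parameters p q \<and>
      is_link (lens_pr p q) L\<^sub>1 \<and> is_link (lens_pr p q) L\<^sub>2 \<and>
      \<not> equivalent (lens_pr p q) L\<^sub>1 L\<^sub>2 \<and>
      equivalent (\<lambda>x. x) (lift p q L\<^sub>1) (lift p q L\<^sub>2) \<and>
      KBSM p q L\<^sub>1 \<noteq> {} \<and> KBSM p q L\<^sub>2 \<noteq> {} \<and> KBSM p q L\<^sub>1 \<inter> KBSM p q L\<^sub>2 = {}"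
    using links ne1 ne2 disj equivalent_lifts
    by (intro exI[of _ 4] exI[of _ 1] exI[of _ knot] exI[of _ circles]) (simp add: lens_parameters_def)
qed

end
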